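(* Let $k\geq 2$ be a real number and let $q$ be a sufficiently large prime. If $1\leq x\leq q^{1/2}$, then \begin{equation*} \frac{1}{\phi(q)}\sum_{\substack{\chi \bmod q\\ \chi\neq \chi_0}} \bigg| \sum_{n\leq x} \chi(n)\bigg|^{2k}\gg_k x^k (\log x)^{(k-1)^2}. \end{equation*} If $q^{1/2}\leq x\leq q/2$, then \begin{equation*} \frac{1}{\phi(q)} \sum_{\substack{\chi \bmod q\\ \chi\neq \chi_0}} \bigg| \sum_{n\leq x} \chi(n)\bigg|^{2k}\gg_k x^k \Big(\log \frac{q}{x}\Big)^{(k-1)^2}. \end{equation*}
   Context: The sums over $\chi$ run over all non-principal Dirichlet characters modulo $q$ ($\chi_0$ denotes the principal character), and $\phi$ is Euler's totient function. The notation $A\gg_k B$ means $A\geq c(k)B$ for some constant $c(k)>0$ depending only on $k$. *)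

theory Defs
  imports Complex_Main "HOL-Number_Theory.Number_Theory"
begin

definition dirichlet_character :: "nat \<Rightarrow> (int \<Rightarrow> complex) \<Rightarrow> bool" where
  "dirichlet_character q \<chi> \<longleftrightarrow>
     (\<forall>m n. \<chi> (m * n) = \<chi> m * \<chi> n) \<and>
     (\<forall>n. \<chi> (n + int q) = \<chi> n) \<and>
     (\<forall>n. \<chi> n = 0 \<longleftrightarrow> \<not> coprime n (int q))"

definition principal_character :: "nat \<Rightarrow> int \<Rightarrow> complex" where
  "principal_character q n = (if coprime n (int q) then 1 else 0)"

lemma dirichlet_character_principal: "dirichlet_character q (principal_character q)"
proof -
  have "coprime (n + int q) (int q) \<longleftrightarrow> coprime n (int q)" for n
    unfolding coprime_iff_gcd_eq_1 by (simp only: gcd_add1)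
  then show ?thesis
    by (auto simp: dirichlet_character_def principal_character_def)
qed

lemma dirichlet_character_cong:
  assumes "dirichlet_character q \<chi>" "[m = n] (mod int q)"
  shows "\<chi> m = \<chi> n"
proof -
  have per: "\<chi> (a + int q) = \<chi> a" for a
    using assms(1) by (simp add: dirichlet_character_def)
  have nat: "\<chi> (a + int j * int q) = \<chi> a" for a j
  proof (induction j)
    case (Suc j)
    have "\<chi> (a + int (Suc j) * int q) = \<chi> ((a + int j * int q) + int q)"
      by (simp add: algebra_simps)
    then show ?case using per Suc by simp
  qed simp
  obtain k where k: "n = m + int q * k"
    using assms(2) by (auto simp: cong_iff_lin)
  show ?thesis
  proof (cases "k \<ge> 0")
    case True
    then show ?thesis using nat[of m "nat k"] k by (simp add: mult.commute)
  next
    case False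
    then show ?thesis using nat[of n "nat (- k)"] k by (simp add: mult.commute)
  qed
qed

text \<open>Finiteness guarantees that sums over the characters modulo \<open>q\<close> are genuine
  (a sum over an infinite set would be 0).\<close>

lemma finite_dirichlet_characters:
  assumes q: "q > 0"
  shows "finite {\<chi>. dirichlet_character q \<chi>}"
proof -
  define R where "R = insert 0 {z::complex. z ^ totient q = 1}"
  define D where "D = {\<chi>. dirichlet_character q \<chi>}"
  have finR: "finite R"
    unfolding R_def using q by (intro finite.insertI finite_roots_unity) (simp add: Suc_le_eq)
  have val: "\<chi> n \<in> R" if c: "dirichlet_character q \<chi>" for \<chi> n
  proof (cases "coprime n (int q)")
    case False
    then show ?thesis using c by (simp add: dirichlet_character_def R_def)
  next
    case True
    have mult: "\<chi> (a * b) = \<chi> a * \<chi> b" for a b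
      using c by (simp add: dirichlet_character_def)
    have nz: "\<chi> 1 \<noteq> 0" using c by (simp add: dirichlet_character_def)
    have one: "\<chi> 1 = 1" using mult[of 1 1] nz by simp
    have pow: "\<chi> (n ^ j) = \<chi> n ^ j" for j
      by (induction j) (simp_all add: one mult)
    define m where "m = nat (n mod int q)"
    have m: "[int m = n] (mod int q)" using q by (simp add: m_def cong_def)
    have "coprime (int m) (int q)" using True m by (metis cong_imp_coprime cong_sym)
    then have "[m ^ totient q = 1] (mod q)" by (intro euler_theorem) simp
    then have "[int m ^ totient q = 1] (mod int q)"
      by (metis cong_int_iff of_nat_1 of_nat_power)
    then have "[n ^ totient q = 1] (mod int q)"
      using m by (meson cong_pow cong_sym cong_trans)
    then have "\<chi> (n ^ totient q) = \<chi> 1" by (rule dirichlet_character_cong[OF c])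
    then show ?thesis by (simp add: pow one R_def)
  qed
  have "inj_on (\<lambda>\<chi>. restrict \<chi> {0..<int q}) D"
  proof (rule inj_onI)
    fix \<chi> \<psi> assume *: "\<chi> \<in> D" "\<psi> \<in> D" "restrict \<chi> {0..<int q} = restrict \<psi> {0..<int q}"
    show "\<chi> = \<psi>"
    proof
      fix n
      have "\<chi> (n mod int q) = \<psi> (n mod int q)"
        using fun_cong[OF *(3), of "n mod int q"] q by simp
      moreover have "[n = n mod int q] (mod int q)" by (simp add: cong_def)
      ultimately show "\<chi> n = \<psi> n"
        using * dirichlet_character_cong unfolding D_def by (metis mem_Collect_eq)
    qed
  qed
  moreover have "(\<lambda>\<chi>. restrict \<chi> {0..<int q}) ` D \<subseteq> {0..<int q} \<rightarrow>\<^sub>E R"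
    using val by (auto simp: D_def)
  moreover have "finite ({0..<int q} \<rightarrow>\<^sub>E R)" using finR by (intro finite_PiE) auto
  ultimately have "finite D" by (meson finite_imageD finite_subset)
  then show ?thesis by (simp add: D_def)
qed

definition nonprincipal_moment :: "nat \<Rightarrow> real \<Rightarrow> real \<Rightarrow> real" where
  "nonprincipal_moment q k x =
     1 / real (totient q) *
     (\<Sum>\<chi> | dirichlet_character q \<chi> \<and> \<chi> \<noteq> principal_character q.
        cmod (\<Sum>n\<in>{1..\<lfloor>x\<rfloor>}. \<chi> n) powr (2 * k))"

end

theory Submission
  imports Defs "HOL-Analysis.Analysis"
begin

text \<open>
  Write \<open>\<kappa> = k - 1\<close>, \<open>S\<close> for the character sum, \<open>E\<close> for the average over the characters and
  \<open>y = min x (q / x)\<close>. By Hoelder's inequality, \<open>E \<bar>S\<bar> ^ (2 k)\<close> is at least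
  \<open>(E (\<bar>S\<bar>\<^sup>2 W)) ^ k / (E W ^ (k / \<kappa>)) ^ \<kappa>\<close> for every weight \<open>W \<ge> 0\<close>. We take for \<open>W\<close> an average of
  \<open>\<bar>R\<^sub>t\<bar>\<^sup>2\<close> over about \<open>log y\<close> shifts \<open>t\<close> in \<open>[-1, 1]\<close>, where \<open>R\<^sub>t\<close> is a short Dirichlet polynomial imitating
  the exponential of \<open>\<kappa> \<Sum> \<xi>(p) p ^ (-1/2 - i t)\<close>: the primes are split into the blocks
  \<open>2 ^ 2 ^ i < p \<le> 2 ^ 2 ^ (i + 1)\<close>, \<open>i < J\<close>, over each of which \<open>\<Sum> 1 / p\<close> is bounded, and the exponential
  of the block \<open>i\<close> is truncated at a degree proportional to \<open>J - i\<close>. With \<open>2 ^ J\<close> of order \<open>log y\<close>, all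
  products have length less than \<open>q\<close>, so orthogonality reduces every average to a diagonal count.

  In \<open>E (\<bar>S\<bar>\<^sup>2 W)\<close> the shifts combine to a Fejer kernel, so all terms are nonnegative and can be bounded
  from below by a quadratic form in greatest common divisors. For the upper bound, \<open>k \<ge> 2\<close> makes
  \<open>u \<mapsto> u ^ (1 / \<kappa>)\<close> subadditive, which reduces \<open>E W ^ (k / \<kappa>)\<close> to correlations of \<open>\<bar>R\<^sub>t\<bar>\<^sup>2\<close> with
  \<open>\<bar>R\<^sub>u\<bar> ^ (2 / \<kappa>)\<close>; the latter is bounded pointwise by a nonnegative trigonometric polynomial. Since
  \<open>\<Sum> cos ((t - u) log p) / p\<close> is governed by the pole of the zeta function at \<open>1\<close>, these correlations
  decay at least quadratically in \<open>\<bar>t - u\<bar> 2 ^ J\<close>, and their sum is dominated by the diagonal \<open>t = u\<close>.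
\<close>

subsection \<open>Dirichlet characters modulo a prime\<close>

text \<open>The shifts serve to recover a logarithm. In the twisted second moment only pairs
  \<open>a\<close>, \<open>b\<close> of resonator indices with bounded \<open>a / b\<close> are
  kept, at the cost of a factor of order N = \<open>2 ^ J\<close>. With one shift this loss would
  stay. N shifts multiply both the lower bound A for the twisted moment and the upper bound B for E
  W^(k/\<kappa>) by N, and A enters with exponent k, B only with k - 1. With L the sum of 1/p over
  all blocks, A has order x exp ((\<kappa>^2 + 2 \<kappa>) L) and B has order N exp ((\<kappa> +
  1)^2 L). So A^k / B^\<kappa> has order x^k N^(-\<kappa>) exp (\<kappa> (\<kappa> + 1) L), and L
  \<ge> log N - O(1) leaves N^(\<kappa>^2). Degrees proportional to J - i make two sums converge:
  the sum of 2^i (J - i) is O(2^J), which keeps lengths short, and the sum of exp (- M (J - i)) is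
  O(1), so truncation costs a constant. Prime sums are taken at real part 1 + 1 / 2^J, which acts as
  a smooth cut-off at \<open>2 ^ 2 ^ J\<close>. The principal character takes part in orthogonality
  but not in the moment; there W is bounded trivially, by sqrt y.\<close>

lemma dirichlet_character_mult: "dirichlet_character q \<xi> \<Longrightarrow> \<xi> (m * n) = \<xi> m * \<xi> n"
  by (simp add: dirichlet_character_def)

lemma dirichlet_character_eq_0_iff:
  "dirichlet_character q \<xi> \<Longrightarrow> \<xi> n = 0 \<longleftrightarrow> \<not> coprime n (int q)"
  by (simp add: dirichlet_character_def)

lemma dirichlet_character_1 [simp]: "dirichlet_character q \<xi> \<Longrightarrow> \<xi> 1 = 1"
  using dirichlet_character_mult[of q \<xi> 1 1] dirichlet_character_eq_0_iff[of q \<xi> 1] by simp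

lemma dirichlet_character_power: "dirichlet_character q \<xi> \<Longrightarrow> \<xi> (n ^ j) = \<xi> n ^ j"
  by (induction j) (simp_all add: dirichlet_character_mult)

lemma cong_power_totient_int:
  assumes "q > 0" "coprime n (int q)"
  shows "[n ^ totient q = 1] (mod int q)"
proof -
  define m where "m = nat (n mod int q)"
  have m: "[int m = n] (mod int q)" using assms(1) by (simp add: m_def Cong.cong_def)
  have "coprime (int m) (int q)" using assms(2) m by (metis cong_imp_coprime cong_sym)
  then have "[m ^ totient q = 1] (mod q)" by (intro euler_theorem) simp
  then have "[int m ^ totient q = 1] (mod int q)"
    by (metis cong_int_iff of_nat_1 of_nat_power)
  then show ?thesis using m by (meson cong_pow cong_sym cong_trans)
qed

lemma norm_dirichlet_character:
  assumes c: "dirichlet_character q \<xi>" and "q > 0" "coprime n (int q)"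
  shows "norm (\<xi> n) = 1"
proof -
  have "\<xi> n ^ totient q = \<xi> 1"
    using dirichlet_character_cong[OF c cong_power_totient_int[OF assms(2,3)]]
    by (simp add: dirichlet_character_power[OF c])
  then have "norm (\<xi> n) ^ totient q = 1"
    using c by (metis dirichlet_character_1 norm_one norm_power)
  then show ?thesis
    using assms(2) power_eq_iff_eq_base[of "totient q" "norm (\<xi> n)" 1] by simp
qed

lemma dirichlet_character_times:
  assumes "dirichlet_character q \<xi>" "dirichlet_character q \<psi>"
  shows "dirichlet_character q (\<lambda>n. \<xi> n * \<psi> n)"
  using assms by (auto simp: dirichlet_character_def)

text \<open>A primitive root identifies the units with the integers modulo \<open>totient q\<close>.
  A faithful additive character composed with the discrete logarithm is injective on the units, so
  this one character separates every unit from 1.\<close>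

lemma ex_dirichlet_character_neq_1:
  assumes q: "prime q" and a: "coprime a (int q)" "\<not> [a = 1] (mod int q)"
  shows "\<exists>\<xi>. dirichlet_character q \<xi> \<and> \<xi> a \<noteq> 1"
proof -
  from prime_primitive_root_exists[of q] q obtain g where g: "residue_primroot q g"
    using prime_gt_1_nat[OF q] by blast
  have q1: "q > 1" using prime_gt_1_nat[OF q] .
  define \<phi> where "\<phi> = totient q"
  have \<phi>: "\<phi> > 0" using q1 by (simp add: \<phi>_def)
  have ordg: "ord q g = \<phi>" and cg: "coprime q g"
    using g by (auto simp: residue_primroot_def \<phi>_def)
  have bij: "bij_betw (\<lambda>i. g ^ i mod q) {..<\<phi>} (totatives q)"
    unfolding \<phi>_def by (rule residue_primroot_is_generator[OF q1 g])
  \<comment> \<open>Discrete logarithm to the base \<open>g\<close>, with values below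
    \<open>\<phi>\<close>.\<close>
  define e where "e = (\<lambda>n::int. inv_into {..<\<phi>} (\<lambda>i. g ^ i mod q) (nat (n mod int q)))"
  have tot: "nat (n mod int q) \<in> totatives q" if "coprime n (int q)" for n
  proof -
    have "coprime (n mod int q) (int q)" using that q1
      by (subst coprime_mod_left_iff) auto
    moreover have "n mod int q \<noteq> 0"
      using calculation q1 by auto
    moreover have "n mod int q \<ge> 0" "n mod int q < int q" using q1 by auto
    ultimately show ?thesis
      by (auto simp: totatives_def le_nat_iff coprime_int_iff[symmetric] simp del: coprime_int_iff)
  qed
  have e: "[int (g ^ e n) = n] (mod int q)" if "coprime n (int q)" for n
  proof -
    have "g ^ e n mod q = nat (n mod int q)"
      unfolding e_def using bij_betw_inv_into_right[OF bij tot[OF that]] .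
    then show ?thesis using q1 by (simp add: Cong.cong_def del: of_nat_power flip: zmod_int)
  qed
  have e_cong: "[i = j] (mod \<phi>) \<longleftrightarrow> [int (g ^ i) = int (g ^ j)] (mod int q)" for i j
    using order_divides_expdiff[OF cg, of i j] by (simp add: ordg cong_int_iff del: of_nat_power)
  define E where "E = (\<lambda>j::nat. cis (2 * pi * j / \<phi>))"
  have E_add: "E (i + j) = E i * E j" for i j
    by (simp add: E_def cis_mult ring_distribs add_divide_distrib)
  have E_phi: "E (\<phi> * j) = 1" for j
    using \<phi> cis_multiple_2pi[of "real j"] by (simp add: E_def mult_ac)
  have E_mod: "E j = E (j mod \<phi>)" for j
  proof -
    have "E j = E (\<phi> * (j div \<phi>) + j mod \<phi>)" by simp
    then show ?thesis by (simp only: E_add E_phi) simp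
  qed
  have E_cong: "E i = E j" if "[i = j] (mod \<phi>)" for i j
    using that E_mod[of i] E_mod[of j] by (simp add: Cong.cong_def)
  define \<xi> where "\<xi> = (\<lambda>n. if coprime n (int q) then E (e n) else 0)"
  have "dirichlet_character q \<xi>"
    unfolding dirichlet_character_def
  proof (intro conjI allI)
    fix m n
    show "\<xi> (m * n) = \<xi> m * \<xi> n"
    proof (cases "coprime m (int q) \<and> coprime n (int q)")
      case True
      then have cop: "coprime (m * n) (int q)" by simp
      have "[int (g ^ e (m * n)) = int (g ^ (e m + e n))] (mod int q)"
        using e[OF cop] cong_mult[OF e[of m] e[of n]] True
        by (simp add: power_add) (meson cong_sym cong_trans)
      then have "[e (m * n) = e m + e n] (mod \<phi>)" by (simp only: e_cong)
      then show ?thesis using True cop E_cong[of "e (m * n)" "e m + e n"] by (simp add: \<xi>_def E_add)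
    qed (auto simp: \<xi>_def)
    have "coprime (n + int q) (int q) \<longleftrightarrow> coprime n (int q)"
      unfolding coprime_iff_gcd_eq_1 by (simp only: gcd_add1)
    then show "\<xi> (n + int q) = \<xi> n" by (simp add: \<xi>_def e_def)
    show "\<xi> n = 0 \<longleftrightarrow> \<not> coprime n (int q)" by (simp add: \<xi>_def E_def)
  qed
  moreover have "\<xi> a \<noteq> 1"
  proof
    assume "\<xi> a = 1"
    then have "E (e a) = 1" using a by (simp add: \<xi>_def)
    moreover have "e a < \<phi>"
      unfolding e_def using bij_betwE[OF bij_betw_inv_into[OF bij]] tot[OF a(1)] by auto
    moreover have "e a \<noteq> 0"
    proof
      assume "e a = 0"
      then show False using e[OF a(1)] a(2) by (simp add: cong_sym_eq)
    qed
    ultimately show False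
    proof -
      assume "E (e a) = 1" "e a < \<phi>" "e a \<noteq> 0"
      then have "cos (2 * pi * e a / \<phi>) = 1"
        by (metis E_def cis.simps(1) one_complex.simps(1))
      then obtain n :: int where "2 * pi * e a / \<phi> = of_int n * 2 * pi"
        using cos_one_2pi_int by auto
      then have "real (e a) = of_int n * real \<phi>" using \<phi> by (simp add: field_simps)
      then have "int (e a) = n * int \<phi>" by (metis of_int_eq_iff of_int_mult of_int_of_nat_eq)
      then have "\<phi> dvd e a" by (metis dvd_triv_right int_dvd_int_iff)
      then show False using \<open>e a < \<phi>\<close> \<open>e a \<noteq> 0\<close> by (simp add: nat_dvd_not_less)
    qed
  qed
  ultimately show ?thesis by blast
qed

section \<open>Orthogonality relations and averages over the characters\<close>

definition char_avg :: "nat \<Rightarrow> ((int \<Rightarrow> complex) \<Rightarrow> 'a::real_normed_field) \<Rightarrow> 'a" where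
  "char_avg q F = (\<Sum>\<xi> | dirichlet_character q \<xi>. F \<xi>) / of_nat (totient q)"

text \<open>Multiplication by a character \<open>\<psi>\<close> with
  \<open>\<psi> a \<noteq> 1\<close> permutes the finite set of characters, so the sum equals
  \<open>\<psi> a\<close> times itself. If \<open>a\<close> is not coprime to \<open>q\<close>,
  every term vanishes.\<close>

lemma sum_characters_eq_0:
  assumes q: "prime q" and a: "\<not> [a = 1] (mod int q)"
  shows "(\<Sum>\<xi> | dirichlet_character q \<xi>. \<xi> a) = 0"
proof (cases "coprime a (int q)")
  case False
  then show ?thesis by (intro sum.neutral) (auto simp: dirichlet_character_eq_0_iff)
next
  case True
  define D where "D = {\<xi>. dirichlet_character q \<xi>}"
  have fin: "finite D"
    unfolding D_def using finite_dirichlet_characters prime_gt_0_nat[OF q] by blast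
  from ex_dirichlet_character_neq_1[OF q True a] obtain \<psi> where
    \<psi>: "dirichlet_character q \<psi>" "\<psi> a \<noteq> 1" by blast
  have inj: "inj_on (\<lambda>\<xi> n. \<psi> n * \<xi> n) D"
  proof (rule inj_onI, rule ext)
    fix \<xi> \<xi>' n assume D: "\<xi> \<in> D" "\<xi>' \<in> D" and eq: "(\<lambda>n. \<psi> n * \<xi> n) = (\<lambda>n. \<psi> n * \<xi>' n)"
    show "\<xi> n = \<xi>' n"
    proof (cases "\<psi> n = 0")
      case True
      then have "\<not> coprime n (int q)" using \<psi>(1) by (simp add: dirichlet_character_eq_0_iff)
      then show ?thesis using D by (metis D_def dirichlet_character_eq_0_iff mem_Collect_eq)
    next
      case False
      then show ?thesis using fun_cong[OF eq, of n] by simp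
    qed
  qed
  moreover have sub: "(\<lambda>\<xi> n. \<psi> n * \<xi> n) ` D \<subseteq> D"
    using dirichlet_character_times[OF \<psi>(1)] by (auto simp: D_def)
  ultimately have img: "(\<lambda>\<xi> n. \<psi> n * \<xi> n) ` D = D"
    using fin by (metis endo_inj_surj)
  have "(\<Sum>\<xi>\<in>D. \<xi> a) = (\<Sum>\<xi>\<in>(\<lambda>\<xi> n. \<psi> n * \<xi> n) ` D. \<xi> a)" by (simp only: img)
  also have "\<dots> = \<psi> a * (\<Sum>\<xi>\<in>D. \<xi> a)"
    by (subst sum.reindex[OF inj]) (simp add: sum_distrib_left)
  finally show ?thesis using \<psi>(2) by (simp add: D_def)
qed

lemma sum_character_residues_eq_0:
  assumes q: "q > 0" and c: "dirichlet_character q \<xi>" "\<xi> \<noteq> principal_character q"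
  shows "(\<Sum>n\<in>{0..<int q}. \<xi> n) = 0"
proof -
  obtain a where a: "\<xi> a \<noteq> principal_character q a" using c(2) by blast
  then have cop: "coprime a (int q)" and neq: "\<xi> a \<noteq> 1"
    using dirichlet_character_eq_0_iff[OF c(1), of a] by (auto simp: principal_character_def)
  define h where "h = (\<lambda>n. a * n mod int q)"
  have inj: "inj_on h {0..<int q}"
  proof (rule inj_onI)
    fix m n assume mn: "m \<in> {0..<int q}" "n \<in> {0..<int q}" "h m = h n"
    then have "[a * m = a * n] (mod int q)" by (simp add: h_def Cong.cong_def)
    then have "[m = n] (mod int q)" using cop by (simp add: cong_mult_lcancel)
    then show "m = n" using mn by (simp add: Cong.cong_def)
  qed
  moreover have "h ` {0..<int q} \<subseteq> {0..<int q}" using q by (auto simp: h_def)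
  ultimately have img: "h ` {0..<int q} = {0..<int q}" by (intro endo_inj_surj) auto
  have hval: "\<xi> (h n) = \<xi> a * \<xi> n" for n
    using dirichlet_character_cong[OF c(1), of "h n" "a * n"]
    by (simp add: h_def dirichlet_character_mult[OF c(1)])
  have "(\<Sum>n\<in>{0..<int q}. \<xi> n) = (\<Sum>n\<in>h ` {0..<int q}. \<xi> n)" by (simp only: img)
  also have "\<dots> = \<xi> a * (\<Sum>n\<in>{0..<int q}. \<xi> n)"
    by (subst sum.reindex[OF inj]) (simp add: hval sum_distrib_left)
  finally show ?thesis using neq by simp
qed

text \<open>The sum of all values of all characters on the residues is evaluated twice: if the
  residues are summed first, only the principal character contributes; if the characters are summed
  first, only the residue 1.\<close>

lemma card_dirichlet_characters:
  assumes q: "prime q"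
  shows "card {\<xi>. dirichlet_character q \<xi>} = totient q"
proof -
  define D where "D = {\<xi>. dirichlet_character q \<xi>}"
  have q1: "q > 1" using prime_gt_1_nat[OF q] .
  have fin: "finite D"
    unfolding D_def using finite_dirichlet_characters q1 by simp
  have pD: "principal_character q \<in> D" by (simp add: D_def dirichlet_character_principal)
  have "(\<Sum>\<xi>\<in>D. \<Sum>n\<in>{0..<int q}. \<xi> n) = (\<Sum>n\<in>{0..<int q}. principal_character q n)"
    using sum_character_residues_eq_0[of q] q1
    by (subst sum.remove[OF fin pD]) (auto simp: D_def intro!: sum.neutral)
  also have "\<dots> = (\<Sum>n\<in>{1..<int q}. 1)"
  proof (rule sum.mono_neutral_cong_right)
    show "principal_character q n = 1" if "n \<in> {1..<int q}" for n
    proof -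
      have "\<not> int q dvd n" using that by (auto dest: zdvd_imp_le)
      then have "coprime (int q) n" using q by (intro prime_imp_coprime) auto
      then show ?thesis by (simp add: principal_character_def coprime_commute)
    qed
    show "\<forall>i\<in>{0..<int q} - {1..<int q}. principal_character q i = 0"
    proof
      fix i assume "i \<in> {0..<int q} - {1..<int q}"
      then have "i = 0" by auto
      then show "principal_character q i = 0" using q1 by (simp add: principal_character_def)
    qed
  qed auto
  also have "\<dots> = of_nat (totient q)"
    using q1 by (simp add: totient_prime[OF q])
  finally have "of_nat (totient q) = (\<Sum>n\<in>{0..<int q}. \<Sum>\<xi>\<in>D. \<xi> n)"
    by (subst sum.swap) simp
  also have "\<dots> = (\<Sum>n\<in>{1}. \<Sum>\<xi>\<in>D. \<xi> n)"
  proof (rule sum.mono_neutral_right)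
    show "\<forall>i\<in>{0..<int q} - {1}. (\<Sum>\<xi>\<in>D. \<xi> i) = 0"
      unfolding D_def using q1 by (auto intro!: sum_characters_eq_0[OF q] simp: Cong.cong_def)
  qed (use q1 in auto)
  also have "\<dots> = of_nat (card D)" by (simp add: D_def)
  finally have "(of_nat (totient q) :: complex) = of_nat (card D)" .
  then show ?thesis unfolding D_def by (metis of_nat_eq_iff)
qed

text \<open>Values at units have modulus 1, so conjugation amounts to evaluation at the inverse
  \<open>b'\<close> of \<open>b\<close>, and each term is a single character value at
  \<open>a * b'\<close>.\<close>

lemma dirichlet_character_orthogonality:
  assumes q: "prime q" and a: "coprime a (int q)" and b: "coprime b (int q)"
  shows "(\<Sum>\<xi> | dirichlet_character q \<xi>. \<xi> a * cnj (\<xi> b)) =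
         (if [a = b] (mod int q) then of_nat (totient q) else 0)"
proof -
  have q1: "q > 1" using prime_gt_1_nat[OF q] .
  obtain b' where b': "[b * b' = 1] (mod int q)"
    using cong_solve_coprime_int[OF b] by blast
  then have copb': "coprime b' (int q)"
    by (metis cong_imp_coprime cong_sym coprime_1_left coprime_mult_left_iff)
  have "\<xi> a * cnj (\<xi> b) = \<xi> (a * b')" if c: "dirichlet_character q \<xi>" for \<xi>
  proof -
    have "\<xi> b * \<xi> b' = 1"
      using dirichlet_character_cong[OF c b'] c by (simp add: dirichlet_character_mult)
    moreover have "\<xi> b * cnj (\<xi> b) = 1"
      using norm_dirichlet_character[OF c _ b] q1 by (simp add: complex_norm_square[symmetric])
    ultimately have "cnj (\<xi> b) = \<xi> b'"
      by (metis mult_cancel_left mult_zero_left zero_neq_one)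
    then show ?thesis using c by (simp add: dirichlet_character_mult)
  qed
  then have eq: "(\<Sum>\<xi> | dirichlet_character q \<xi>. \<xi> a * cnj (\<xi> b)) =
      (\<Sum>\<xi> | dirichlet_character q \<xi>. \<xi> (a * b'))" by (intro sum.cong) auto
  have iff: "[a * b' = 1] (mod int q) \<longleftrightarrow> [a = b] (mod int q)"
  proof
    assume "[a * b' = 1] (mod int q)"
    then have "[a * b' = b * b'] (mod int q)" using b' by (meson cong_sym cong_trans)
    then show "[a = b] (mod int q)" using copb' by (simp add: cong_mult_rcancel)
  next
    assume "[a = b] (mod int q)"
    then show "[a * b' = 1] (mod int q)" using b' by (meson cong_scalar_right cong_trans)
  qed
  show ?thesis
  proof (cases "[a = b] (mod int q)")
    case True
    have "\<xi> (a * b') = 1" if c: "dirichlet_character q \<xi>" for \<xi>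
      using dirichlet_character_cong[OF c] True iff c by (metis dirichlet_character_1)
    then have "(\<Sum>\<xi> | dirichlet_character q \<xi>. \<xi> (a * b')) = (\<Sum>\<xi> | dirichlet_character q \<xi>. 1)"
      by (intro sum.cong) auto
    then show ?thesis unfolding eq using True card_dirichlet_characters[OF q] by simp
  next
    case False
    then show ?thesis unfolding eq using sum_characters_eq_0[OF q] iff by simp
  qed
qed

text \<open>The frequencies lie strictly between 0 and \<open>q\<close>, so congruent ones are
  equal. \<open>\<nu>\<close> may take a value several times: in the twisted second moment these
  coincidences are exactly what is counted.\<close>

lemma char_avg_norm_sum_sq:
  fixes w :: "'i \<Rightarrow> complex" and \<nu> :: "'i \<Rightarrow> nat"
  assumes q: "prime q" and fin: "finite I" and \<nu>: "\<And>i. i \<in> I \<Longrightarrow> 0 < \<nu> i \<and> \<nu> i < q"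
  shows "complex_of_real (char_avg q (\<lambda>\<xi>. (cmod (\<Sum>i\<in>I. w i * \<xi> (int (\<nu> i))))\<^sup>2)) =
         (\<Sum>i\<in>I. \<Sum>j\<in>I. if \<nu> i = \<nu> j then w i * cnj (w j) else 0)"
proof -
  define D where "D = {\<xi>. dirichlet_character q \<xi>}"
  have tot: "totient q > 0" using prime_gt_0_nat[OF q] by simp
  have cop: "coprime (int (\<nu> i)) (int q)" if "i \<in> I" for i
  proof -
    have "\<not> q dvd \<nu> i" using \<nu>[OF that] by (auto dest: dvd_imp_le)
    then show ?thesis using q by (simp add: prime_imp_coprime coprime_commute)
  qed
  have "complex_of_real (\<Sum>\<xi>\<in>D. (cmod (\<Sum>i\<in>I. w i * \<xi> (int (\<nu> i))))\<^sup>2) =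
    (\<Sum>\<xi>\<in>D. \<Sum>i\<in>I. \<Sum>j\<in>I. w i * cnj (w j) * (\<xi> (int (\<nu> i)) * cnj (\<xi> (int (\<nu> j)))))"
    unfolding of_real_sum
    by (intro sum.cong refl, simp only: complex_norm_square, simp add: sum_product mult_ac)
  also have "\<dots> = (\<Sum>i\<in>I. \<Sum>j\<in>I. w i * cnj (w j) * (\<Sum>\<xi>\<in>D. \<xi> (int (\<nu> i)) * cnj (\<xi> (int (\<nu> j)))))"
    unfolding sum_distrib_left
    by (subst sum.swap, intro sum.cong refl, rule sum.swap)
  also have "\<dots> = (\<Sum>i\<in>I. \<Sum>j\<in>I. of_nat (totient q) * (if \<nu> i = \<nu> j then w i * cnj (w j) else 0))"
  proof (intro sum.cong refl)
    fix i j assume ij: "i \<in> I" "j \<in> I"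
    have "[int (\<nu> i) = int (\<nu> j)] (mod int q) \<longleftrightarrow> \<nu> i = \<nu> j"
      using \<nu>[OF ij(1)] \<nu>[OF ij(2)] by (simp add: cong_int_iff Cong.cong_def)
    then show "w i * cnj (w j) * (\<Sum>\<xi>\<in>D. \<xi> (int (\<nu> i)) * cnj (\<xi> (int (\<nu> j)))) =
        of_nat (totient q) * (if \<nu> i = \<nu> j then w i * cnj (w j) else 0)"
      unfolding D_def dirichlet_character_orthogonality[OF q cop[OF ij(1)] cop[OF ij(2)]] by simp
  qed
  finally show ?thesis using tot
    by (simp add: char_avg_def D_def sum_distrib_left[symmetric])
qed

subsection \<open>Mean squares of Dirichlet polynomials\<close>

definition completely_mult :: "(nat \<Rightarrow> complex) \<Rightarrow> bool" where
  "completely_mult f \<longleftrightarrow> f 1 = 1 \<and> (\<forall>m n. f (m * n) = f m * f n)"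

lemma completely_mult_prod:
  "completely_mult f \<Longrightarrow> f (\<Prod>i\<in>I. g i) = (\<Prod>i\<in>I. f (g i))"
  by (induction I rule: infinite_finite_induct) (auto simp: completely_mult_def)

lemma completely_mult_character:
  "dirichlet_character q \<xi> \<Longrightarrow> completely_mult (\<lambda>n. \<xi> (int n))"
  by (simp add: completely_mult_def dirichlet_character_mult)

text \<open>Prime factors are counted with multiplicity: this is the support of the
  \<open>m\<close>-th power of a linear form over \<open>P\<close>.\<close>

definition omega_set :: "nat set \<Rightarrow> nat \<Rightarrow> nat set" where
  "omega_set P m = {n. n > 0 \<and> size (prime_factorization n) = m \<and> prime_factors n \<subseteq> P}"

lemma omega_set_0 [simp]: "omega_set P 0 = {1}"
  by (auto simp: omega_set_def prime_factorization_empty_iff)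

lemma omega_set_mult:
  assumes "prime p" "p \<in> P" "n \<in> omega_set P m"
  shows "p * n \<in> omega_set P (Suc m)"
  using assms
  by (auto simp: omega_set_def prime_factorization_mult prime_factorization_prime prime_gt_0_nat)

lemma omega_set_div:
  assumes "prime p" "p dvd n" "n \<in> omega_set P (Suc m)"
  shows "n div p \<in> omega_set P m"
proof -
  obtain k where k: "n = p * k" using assms(2) by blast
  have "k > 0" using assms k by (auto simp: omega_set_def intro: Nat.gr0I)
  then show ?thesis using assms k
    by (auto simp: omega_set_def prime_factorization_mult prime_factorization_prime)
qed

lemma omega_set_bound:
  assumes "n \<in> omega_set P m" "\<And>p. p \<in> P \<Longrightarrow> p \<le> b"
  shows "n \<le> b ^ m"
proof -
  have "n = prod_mset (prime_factorization n)"
    using assms by (auto simp: omega_set_def prod_mset_prime_factorization_nat)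
  also have "\<dots> \<le> b ^ size (prime_factorization n)"
  proof -
    have *: "prod_mset M \<le> b ^ size M" if "set_mset M \<subseteq> P" for M
      using that by (induction M) (auto intro!: mult_mono assms(2))
    show ?thesis by (rule *) (use assms(1) in \<open>simp add: omega_set_def\<close>)
  qed
  also have "\<dots> = b ^ m" using assms(1) by (simp add: omega_set_def)
  finally show ?thesis .
qed

lemma finite_omega_set:
  assumes "finite P"
  shows "finite (omega_set P m)"
proof (rule finite_subset)
  show "omega_set P m \<subseteq> {..Max P ^ m}"
    using omega_set_bound[of _ P m "Max P"] assms by auto
qed simp

lemma omega_set_disjoint: "m \<noteq> n \<Longrightarrow> omega_set P m \<inter> omega_set P n = {}"
  by (auto simp: omega_set_def)

text \<open>The map from \<open>(p, n)\<close> to \<open>(p * n, p)\<close> is a bijection onto the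
  pairs of an integer of degree \<open>Suc m\<close> and one of its prime divisors, so an integer is
  hit once for each prime divisor.\<close>

lemma sum_omega_set_Suc:
  fixes h :: "nat \<Rightarrow> nat \<Rightarrow> 'a::comm_monoid_add"
  assumes P: "finite P" "\<And>p. p \<in> P \<Longrightarrow> prime p"
  shows "(\<Sum>p\<in>P. \<Sum>n\<in>omega_set P m. h p n) =
         (\<Sum>n\<in>omega_set P (Suc m). \<Sum>p\<in>{p\<in>P. p dvd n}. h p (n div p))"
proof -
  have "(\<Sum>p\<in>P. \<Sum>n\<in>omega_set P m. h p n) = (\<Sum>(p, n)\<in>P \<times> omega_set P m. h p n)"
    by (simp add: sum.cartesian_product)
  also have "\<dots> = (\<Sum>(n, p)\<in>Sigma (omega_set P (Suc m)) (\<lambda>n. {p\<in>P. p dvd n}). h p (n div p))"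
  proof (rule sum.reindex_bij_witness[where i = "\<lambda>(n, p). (p, n div p)" and j = "\<lambda>(p, n). (p * n, p)"])
    fix a assume "a \<in> P \<times> omega_set P m"
    then obtain p n where a: "a = (p, n)" "p \<in> P" "n \<in> omega_set P m" by auto
    have "p > 0" using P(2) a prime_gt_0_nat by blast
    then show "(\<lambda>(n, p). (p, n div p)) ((\<lambda>(p, n). (p * n, p)) a) = a"
      "(\<lambda>(p, n). (p * n, p)) a \<in> Sigma (omega_set P (Suc m)) (\<lambda>n. {p\<in>P. p dvd n})"
      "(case (\<lambda>(p, n). (p * n, p)) a of (n, p) \<Rightarrow> h p (n div p)) = (case a of (p, n) \<Rightarrow> h p n)"
      using a P(2) by (auto intro!: omega_set_mult)
  next
    fix b assume "b \<in> Sigma (omega_set P (Suc m)) (\<lambda>n. {p\<in>P. p dvd n})"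
    then obtain p n where b: "b = (n, p)" "p \<in> P" "p dvd n" "n \<in> omega_set P (Suc m)" by auto
    then show "(\<lambda>(p, n). (p * n, p)) ((\<lambda>(n, p). (p, n div p)) b) = b"
      "(\<lambda>(n, p). (p, n div p)) b \<in> P \<times> omega_set P m"
      using P(2) by (auto intro!: omega_set_div)
  qed
  also have "\<dots> = (\<Sum>n\<in>omega_set P (Suc m). \<Sum>p\<in>{p\<in>P. p dvd n}. h p (n div p))"
    using finite_omega_set[OF P(1)] P(1) by (subst sum.Sigma) auto
  finally show ?thesis .
qed

lemma card_set_mset_le_size: "card (set_mset M) \<le> size M"
  by (induction M) (auto simp: card_insert_if)

lemma card_prime_divisors_le:
  assumes "n \<in> omega_set P m" "\<And>p. p \<in> Q \<Longrightarrow> prime p"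
  shows "card {p\<in>Q. p dvd n} \<le> m"
proof -
  have "{p\<in>Q. p dvd n} \<subseteq> set_mset (prime_factorization n)"
    using assms by (auto simp: omega_set_def in_prime_factors_iff)
  then have "card {p\<in>Q. p dvd n} \<le> card (set_mset (prime_factorization n))"
    by (intro card_mono) auto
  also have "\<dots> \<le> size (prime_factorization n)"
    by (rule card_set_mset_le_size)
  finally show ?thesis using assms(1) by (simp add: omega_set_def)
qed

section \<open>Square sums of the coefficients of Dirichlet polynomials\<close>

definition linear_form :: "nat set \<Rightarrow> (nat \<Rightarrow> complex) \<Rightarrow> (nat \<Rightarrow> complex) \<Rightarrow> complex" where
  "linear_form P x f = (\<Sum>p\<in>P. x p * f p)"

text \<open>A formal identity: the coefficients do not depend on \<open>f\<close>, and only their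
  existence and a bound for their square sum are recorded. If the elements of \<open>T\<close> lie
  strictly between 0 and \<open>q\<close>, orthogonality turns \<open>B\<close> into a bound for the
  mean square over the characters.\<close>

definition represents :: "nat set \<Rightarrow> ((nat \<Rightarrow> complex) \<Rightarrow> complex) \<Rightarrow> real \<Rightarrow> bool" where
  "represents T G B \<longleftrightarrow>
     (\<exists>c. (\<forall>f. completely_mult f \<longrightarrow> G f = (\<Sum>n\<in>T. c n * f n)) \<and> (\<Sum>n\<in>T. (cmod (c n))\<^sup>2) \<le> B)"

lemma representsI:
  assumes "\<And>f. completely_mult f \<Longrightarrow> G f = (\<Sum>n\<in>T. c n * f n)"
    and "(\<Sum>n\<in>T. (cmod (c n))\<^sup>2) \<le> B"
  shows "represents T G B"
  using assms unfolding represents_def by blast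

lemma represents_mono: "represents T G B \<Longrightarrow> B \<le> B' \<Longrightarrow> represents T G B'"
  unfolding represents_def by (meson order_trans)

lemma represents_cong:
  assumes "represents T G B" "\<And>f. completely_mult f \<Longrightarrow> G f = G' f"
  shows "represents T G' B"
  using assms unfolding represents_def by metis

lemma represents_superset:
  assumes "represents T G B" "T \<subseteq> T'" "finite T'"
  shows "represents T' G B"
proof -
  obtain c where c: "\<And>f. completely_mult f \<Longrightarrow> G f = (\<Sum>n\<in>T. c n * f n)"
    and B: "(\<Sum>n\<in>T. (cmod (c n))\<^sup>2) \<le> B"
    using assms(1) unfolding represents_def by blast
  show ?thesis
  proof (rule representsI[where c = "\<lambda>n. if n \<in> T then c n else 0"])
    fix f assume "completely_mult f"
    then show "G f = (\<Sum>n\<in>T'. (if n \<in> T then c n else 0) * f n)"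
      using c assms(2,3) by (auto intro!: sum.mono_neutral_cong_left)
  next
    have "(\<Sum>n\<in>T'. (cmod (if n \<in> T then c n else 0))\<^sup>2) = (\<Sum>n\<in>T. (cmod (c n))\<^sup>2)"
      using assms(2,3) by (intro sum.mono_neutral_cong_right) auto
    then show "(\<Sum>n\<in>T'. (cmod (if n \<in> T then c n else 0))\<^sup>2) \<le> B" using B by simp
  qed
qed

lemma represents_1: "represents (omega_set P 0) (\<lambda>_. 1) 1"
  by (rule representsI[where c = "\<lambda>_. 1"]) (auto simp: completely_mult_def)

lemma represents_scale:
  assumes "represents T G B"
  shows "represents T (\<lambda>f. a * G f) ((cmod a)\<^sup>2 * B)"
proof -
  obtain c where c: "\<And>f. completely_mult f \<Longrightarrow> G f = (\<Sum>n\<in>T. c n * f n)"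
    and B: "(\<Sum>n\<in>T. (cmod (c n))\<^sup>2) \<le> B"
    using assms(1) unfolding represents_def by blast
  show ?thesis
  proof (rule representsI[where c = "\<lambda>n. a * c n"])
    show "(\<Sum>n\<in>T. (cmod (a * c n))\<^sup>2) \<le> (cmod a)\<^sup>2 * B"
      using B by (simp add: norm_mult power_mult_distrib mult_left_mono flip: sum_distrib_left)
  qed (simp add: c sum_distrib_left mult_ac)
qed

lemma norm_sum_sq_le_card:
  fixes v :: "'i \<Rightarrow> complex"
  shows "(cmod (\<Sum>i\<in>I. v i))\<^sup>2 \<le> card I * (\<Sum>i\<in>I. (cmod (v i))\<^sup>2)"
proof -
  have "(cmod (\<Sum>i\<in>I. v i))\<^sup>2 \<le> (\<Sum>i\<in>I. cmod (v i))\<^sup>2"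
    by (intro power_mono norm_sum) auto
  also have "\<dots> \<le> card I * (\<Sum>i\<in>I. (cmod (v i))\<^sup>2)"
    using sum_squared_le_sum_of_squares[of "\<lambda>i. cmod (v i)" I]
    by (cases "finite I") (auto simp: mult.commute)
  finally show ?thesis .
qed

lemma represents_sum:
  assumes "\<And>i. i \<in> I \<Longrightarrow> represents T (G i) (B i)"
  shows "represents T (\<lambda>f. \<Sum>i\<in>I. G i f) (real (card I) * (\<Sum>i\<in>I. B i))"
proof -
  have "\<forall>i\<in>I. \<exists>c. (\<forall>f. completely_mult f \<longrightarrow> G i f = (\<Sum>n\<in>T. c n * f n)) \<and> (\<Sum>n\<in>T. (cmod (c n))\<^sup>2) \<le> B i"
    using assms unfolding represents_def by blast
  then obtain c where c: "\<And>i f. i \<in> I \<Longrightarrow> completely_mult f \<Longrightarrow> G i f = (\<Sum>n\<in>T. c i n * f n)"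
    and B: "\<And>i. i \<in> I \<Longrightarrow> (\<Sum>n\<in>T. (cmod (c i n))\<^sup>2) \<le> B i"
    by metis
  show ?thesis
  proof (rule representsI[where c = "\<lambda>n. \<Sum>i\<in>I. c i n"])
    fix f assume f: "completely_mult f"
    show "(\<Sum>i\<in>I. G i f) = (\<Sum>n\<in>T. (\<Sum>i\<in>I. c i n) * f n)"
      unfolding sum_distrib_right by (subst sum.swap) (use c f in auto)
  next
    have "(\<Sum>n\<in>T. (cmod (\<Sum>i\<in>I. c i n))\<^sup>2) \<le> (\<Sum>n\<in>T. real (card I) * (\<Sum>i\<in>I. (cmod (c i n))\<^sup>2))"
      by (intro sum_mono norm_sum_sq_le_card)
    also have "\<dots> = real (card I) * (\<Sum>i\<in>I. \<Sum>n\<in>T. (cmod (c i n))\<^sup>2)"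
      by (subst sum.swap) (simp add: sum_distrib_left)
    also have "\<dots> \<le> real (card I) * (\<Sum>i\<in>I. B i)"
      by (intro mult_left_mono sum_mono B) auto
    finally show "(\<Sum>n\<in>T. (cmod (\<Sum>i\<in>I. c i n))\<^sup>2) \<le> real (card I) * (\<Sum>i\<in>I. B i)" .
  qed
qed

text \<open>Each coefficient comes from exactly one summand, so the square sums add up without the
  factor \<open>card I\<close> that Cauchy's inequality costs in
  \<open>represents_sum\<close>.\<close>

lemma represents_UN_disjoint:
  assumes "finite I" "\<And>i. i \<in> I \<Longrightarrow> finite (T i)"
    and "\<And>i j. i \<in> I \<Longrightarrow> j \<in> I \<Longrightarrow> i \<noteq> j \<Longrightarrow> T i \<inter> T j = {}"
    and "\<And>i. i \<in> I \<Longrightarrow> represents (T i) (G i) (B i)"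
  shows "represents (\<Union>i\<in>I. T i) (\<lambda>f. \<Sum>i\<in>I. G i f) (\<Sum>i\<in>I. B i)"
proof -
  have "\<forall>i\<in>I. \<exists>c. (\<forall>f. completely_mult f \<longrightarrow> G i f = (\<Sum>n\<in>T i. c n * f n)) \<and> (\<Sum>n\<in>T i. (cmod (c n))\<^sup>2) \<le> B i"
    using assms(4) unfolding represents_def by blast
  then obtain c where c: "\<And>i f. i \<in> I \<Longrightarrow> completely_mult f \<Longrightarrow> G i f = (\<Sum>n\<in>T i. c i n * f n)"
    and B: "\<And>i. i \<in> I \<Longrightarrow> (\<Sum>n\<in>T i. (cmod (c i n))\<^sup>2) \<le> B i"
    by metis
  define d where "d n = c (THE i. i \<in> I \<and> n \<in> T i) n" for n
  have d: "d n = c i n" if "i \<in> I" "n \<in> T i" for i n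
  proof -
    have "(THE i. i \<in> I \<and> n \<in> T i) = i" using that assms(3) by (intro the_equality) blast+
    then show ?thesis by (simp add: d_def)
  qed
  show ?thesis
  proof (rule representsI[where c = d])
    fix f assume f: "completely_mult f"
    show "(\<Sum>i\<in>I. G i f) = (\<Sum>n\<in>(\<Union>i\<in>I. T i). d n * f n)"
      using assms(1-3) f by (subst sum.UNION_disjoint) (auto simp: c d intro!: sum.cong)
  next
    have "(\<Sum>n\<in>(\<Union>i\<in>I. T i). (cmod (d n))\<^sup>2) = (\<Sum>i\<in>I. \<Sum>n\<in>T i. (cmod (c i n))\<^sup>2)"
      using assms(1-3) by (subst sum.UNION_disjoint) (auto simp: d intro!: sum.cong)
    then show "(\<Sum>n\<in>(\<Union>i\<in>I. T i). (cmod (d n))\<^sup>2) \<le> (\<Sum>i\<in>I. B i)"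
      by (simp add: sum_mono B)
  qed
qed

text \<open>The coefficient of the product at \<open>n\<close> is a sum over the at most
  \<open>Suc m\<close> primes dividing \<open>n\<close>, so Cauchy's inequality costs
  \<open>Suc m\<close>. Iteration yields \<open>fact m\<close> for an \<open>m\<close>-th power. It
  cancels one of the two factorials in the squared coefficient of the exponential, so that the
  bounds form an exponential series again.\<close>

lemma represents_linear_form_mult:
  assumes P: "finite P" "\<And>p. p \<in> P \<Longrightarrow> prime p"
    and G: "represents (omega_set P m) G B"
  shows "represents (omega_set P (Suc m)) (\<lambda>f. linear_form P x f * G f)
           (real (Suc m) * (\<Sum>p\<in>P. (cmod (x p))\<^sup>2) * B)"
proof -
  obtain c where c: "\<And>f. completely_mult f \<Longrightarrow> G f = (\<Sum>n\<in>omega_set P m. c n * f n)"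
    and B: "(\<Sum>n\<in>omega_set P m. (cmod (c n))\<^sup>2) \<le> B"
    using G unfolding represents_def by blast
  let ?c = "\<lambda>n. \<Sum>p\<in>{p\<in>P. p dvd n}. x p * c (n div p)"
  show ?thesis
  proof (rule representsI[where c = ?c])
    fix f assume f: "completely_mult f"
    have "linear_form P x f * G f = (\<Sum>p\<in>P. \<Sum>n\<in>omega_set P m. x p * c n * f (p * n))"
      using f unfolding c[OF f] linear_form_def sum_product
      by (simp add: completely_mult_def mult_ac)
    also have "\<dots> = (\<Sum>n\<in>omega_set P (Suc m). \<Sum>p\<in>{p\<in>P. p dvd n}. x p * c (n div p) * f (p * (n div p)))"
      by (rule sum_omega_set_Suc[OF P])
    also have "\<dots> = (\<Sum>n\<in>omega_set P (Suc m). ?c n * f n)"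
      by (simp add: sum_distrib_right)
    finally show "linear_form P x f * G f = (\<Sum>n\<in>omega_set P (Suc m). ?c n * f n)" .
  next
    have "(\<Sum>n\<in>omega_set P (Suc m). (cmod (?c n))\<^sup>2) \<le>
        (\<Sum>n\<in>omega_set P (Suc m). real (Suc m) * (\<Sum>p\<in>{p\<in>P. p dvd n}. (cmod (x p * c (n div p)))\<^sup>2))"
    proof (rule sum_mono)
      fix n assume "n \<in> omega_set P (Suc m)"
      then have "card {p\<in>P. p dvd n} \<le> Suc m" by (rule card_prime_divisors_le) (rule P(2))
      then have "real (card {p\<in>P. p dvd n}) \<le> Suc m" by linarith
      then show "(cmod (?c n))\<^sup>2 \<le> real (Suc m) * (\<Sum>p\<in>{p\<in>P. p dvd n}. (cmod (x p * c (n div p)))\<^sup>2)"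
        by (intro order_trans[OF norm_sum_sq_le_card] mult_right_mono sum_nonneg) auto
    qed
    also have "\<dots> = real (Suc m) * (\<Sum>p\<in>P. \<Sum>n\<in>omega_set P m. (cmod (x p * c n))\<^sup>2)"
      using sum_omega_set_Suc[OF P, of "\<lambda>p n. (cmod (x p * c n))\<^sup>2" m]
      by (simp only: sum_distrib_left)
    also have "\<dots> = real (Suc m) * (\<Sum>p\<in>P. (cmod (x p))\<^sup>2) * (\<Sum>n\<in>omega_set P m. (cmod (c n))\<^sup>2)"
      by (simp add: norm_mult power_mult_distrib sum_product)
    also have "\<dots> \<le> real (Suc m) * (\<Sum>p\<in>P. (cmod (x p))\<^sup>2) * B"
      by (intro mult_left_mono B mult_nonneg_nonneg sum_nonneg) auto
    finally show "(\<Sum>n\<in>omega_set P (Suc m). (cmod (?c n))\<^sup>2) \<le> \<dots>" .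
  qed
qed

lemma represents_linear_form_powers:
  assumes P: "finite P" "\<And>p. p \<in> P \<Longrightarrow> prime p"
  shows "represents (omega_set P (a + b)) (\<lambda>f. linear_form P x f ^ a * linear_form P y f ^ b)
           (fact (a + b) * (\<Sum>p\<in>P. (cmod (x p))\<^sup>2) ^ a * (\<Sum>p\<in>P. (cmod (y p))\<^sup>2) ^ b)"
proof (induction a)
  case 0
  show ?case
  proof (induction b)
    case 0
    show ?case using represents_1 by simp
  next
    case (Suc b)
    from represents_linear_form_mult[OF P this, of y] show ?case
      by (simp add: mult_ac)
  qed
next
  case (Suc a)
  from represents_linear_form_mult[OF P this, of x] show ?case
    by (simp add: mult_ac)
qed

text \<open>The factors live on disjoint sets of primes, so a product of indices determines every
  single index. As all products stay below \<open>q\<close>, only the diagonal survives, and the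
  mean square of the product is the product of the square sums.\<close>

lemma char_avg_prod_le:
  assumes q: "prime q" and I: "finite I"
    and G: "\<And>i. i \<in> I \<Longrightarrow> represents (T i) (G i) (B i)"
    and fin: "\<And>i. i \<in> I \<Longrightarrow> finite (T i)"
    and T: "\<And>i n. i \<in> I \<Longrightarrow> n \<in> T i \<Longrightarrow> 0 < n \<and> n \<le> b i \<and> prime_factors n \<subseteq> P i"
    and disj: "\<And>i j. i \<in> I \<Longrightarrow> j \<in> I \<Longrightarrow> i \<noteq> j \<Longrightarrow> P i \<inter> P j = {}"
    and b: "(\<Prod>i\<in>I. b i) < q"
  shows "char_avg q (\<lambda>\<xi>. \<Prod>i\<in>I. (cmod (G i (\<lambda>n. \<xi> (int n))))\<^sup>2) \<le> (\<Prod>i\<in>I. B i)"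
proof -
  have "\<forall>i\<in>I. \<exists>c. (\<forall>f. completely_mult f \<longrightarrow> G i f = (\<Sum>n\<in>T i. c n * f n)) \<and> (\<Sum>n\<in>T i. (cmod (c n))\<^sup>2) \<le> B i"
    using G unfolding represents_def by blast
  then obtain c where c: "\<And>i f. i \<in> I \<Longrightarrow> completely_mult f \<Longrightarrow> G i f = (\<Sum>n\<in>T i. c i n * f n)"
    and B: "\<And>i. i \<in> I \<Longrightarrow> (\<Sum>n\<in>T i. (cmod (c i n))\<^sup>2) \<le> B i"
    by metis
  define E where "E = Pi\<^sub>E I T"
  define \<nu> where "\<nu> g = (\<Prod>i\<in>I. g i)" for g :: "'a \<Rightarrow> nat"
  define w where "w g = (\<Prod>i\<in>I. c i (g i))" for g
  have finE: "finite E" unfolding E_def using I fin by (intro finite_PiE)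
  have gT: "0 < g i \<and> g i \<le> b i \<and> prime_factors (g i) \<subseteq> P i" if "g \<in> E" "i \<in> I" for g i
    using that T[of i "g i"] unfolding E_def by (auto simp: PiE_iff)
  have \<nu>: "0 < \<nu> g \<and> \<nu> g < q" if "g \<in> E" for g
  proof
    show "0 < \<nu> g" unfolding \<nu>_def using gT[OF that] by (intro prod_pos) auto
    have "\<nu> g \<le> (\<Prod>i\<in>I. b i)" unfolding \<nu>_def using gT[OF that] by (intro prod_mono) auto
    then show "\<nu> g < q" using b by simp
  qed
  have count: "count (prime_factorization (\<nu> g)) p = count (prime_factorization (g i)) p"
    if "g \<in> E" "i \<in> I" "p \<in> P i" for g i p
  proof -
    have "prime_factorization (\<nu> g) = (\<Sum>j\<in>I. prime_factorization (g j))"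
      unfolding \<nu>_def using gT[OF that(1)] by (intro prime_factorization_prod I) force
    then have "count (prime_factorization (\<nu> g)) p = (\<Sum>j\<in>I. count (prime_factorization (g j)) p)"
      by (simp add: count_sum)
    also have "\<dots> = (\<Sum>j\<in>{i}. count (prime_factorization (g j)) p)"
    proof (rule sum.mono_neutral_right)
      show "\<forall>j\<in>I - {i}. count (prime_factorization (g j)) p = 0"
      proof
        fix j assume j: "j \<in> I - {i}"
        then have "p \<notin> prime_factors (g j)"
          using gT[OF that(1), of j] disj[of i j] that by auto
        then show "count (prime_factorization (g j)) p = 0" by (simp add: not_in_iff)
      qed
    qed (use I that in auto)
    finally show ?thesis by simp
  qed
  have inj: "g = g'" if g: "g \<in> E" "g' \<in> E" "\<nu> g = \<nu> g'" for g g'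
  proof
    fix i show "g i = g' i"
    proof (cases "i \<in> I")
      case True
      have "prime_factorization (g i) = prime_factorization (g' i)"
      proof (rule multiset_eqI)
        fix p show "count (prime_factorization (g i)) p = count (prime_factorization (g' i)) p"
        proof (cases "p \<in> P i")
          case True
          then show ?thesis using count[OF g(1) \<open>i \<in> I\<close>] count[OF g(2) \<open>i \<in> I\<close>] g(3) by metis
        next
          case False
          then have "p \<notin> prime_factors (g i)" "p \<notin> prime_factors (g' i)"
            using gT[OF g(1) \<open>i \<in> I\<close>] gT[OF g(2) \<open>i \<in> I\<close>] by auto
          then show ?thesis by (simp only: not_in_iff)
        qed
      qed
      then show ?thesis
        using gT[OF g(1) True] gT[OF g(2) True] prod_mset_prime_factorization_nat by metis
    next
      case False
      then show ?thesis using g unfolding E_def by (auto simp: PiE_iff extensional_def)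
    qed
  qed
  have prod: "(\<Prod>i\<in>I. G i (\<lambda>n. \<xi> (int n))) = (\<Sum>g\<in>E. w g * \<xi> (int (\<nu> g)))"
    if x: "dirichlet_character q \<xi>" for \<xi>
  proof -
    have "(\<Prod>i\<in>I. G i (\<lambda>n. \<xi> (int n))) = (\<Prod>i\<in>I. \<Sum>n\<in>T i. c i n * \<xi> (int n))"
      using c completely_mult_character[OF x] by (intro prod.cong) auto
    also have "\<dots> = (\<Sum>g\<in>E. \<Prod>i\<in>I. c i (g i) * \<xi> (int (g i)))"
      unfolding E_def using I fin by (intro prod_sum_PiE) auto
    also have "\<dots> = (\<Sum>g\<in>E. w g * \<xi> (int (\<nu> g)))"
      using completely_mult_prod[OF completely_mult_character[OF x], of _ I]
      by (simp add: w_def \<nu>_def prod.distrib)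
    finally show ?thesis .
  qed
  have "char_avg q (\<lambda>\<xi>. \<Prod>i\<in>I. (cmod (G i (\<lambda>n. \<xi> (int n))))\<^sup>2) =
      char_avg q (\<lambda>\<xi>. (cmod (\<Sum>g\<in>E. w g * \<xi> (int (\<nu> g))))\<^sup>2)"
    unfolding char_avg_def
    by (intro arg_cong2[of _ _ _ _ "(/)"] sum.cong refl)
       (simp add: prod[symmetric] prod_power_distrib flip: prod_norm)
  also have "complex_of_real \<dots> = (\<Sum>g\<in>E. \<Sum>g'\<in>E. if \<nu> g = \<nu> g' then w g * cnj (w g') else 0)"
    by (rule char_avg_norm_sum_sq[OF q finE \<nu>])
  also have "\<dots> = (\<Sum>g\<in>E. \<Sum>g'\<in>{g}. w g * cnj (w g'))"
    using inj finE by (intro sum.cong refl sum.mono_neutral_cong_right) auto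
  also have "\<dots> = complex_of_real (\<Sum>g\<in>E. \<Prod>i\<in>I. (cmod (c i (g i)))\<^sup>2)"
    by (simp add: w_def complex_norm_square[unfolded of_real_power] prod.distrib)
  also have "(\<Sum>g\<in>E. \<Prod>i\<in>I. (cmod (c i (g i)))\<^sup>2) = (\<Prod>i\<in>I. \<Sum>n\<in>T i. (cmod (c i n))\<^sup>2)"
    unfolding E_def using I fin by (intro prod_sum_PiE[symmetric]) auto
  finally have "char_avg q (\<lambda>\<xi>. \<Prod>i\<in>I. (cmod (G i (\<lambda>n. \<xi> (int n))))\<^sup>2) =
      (\<Prod>i\<in>I. \<Sum>n\<in>T i. (cmod (c i n))\<^sup>2)"
    by (simp only: of_real_eq_iff)
  also have "\<dots> \<le> (\<Prod>i\<in>I. B i)"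
    using B by (intro prod_mono) (auto intro: sum_nonneg)
  finally show ?thesis .
qed

subsection \<open>Truncated exponentials\<close>

definition trunc_exp :: "nat \<Rightarrow> complex \<Rightarrow> complex" where
  "trunc_exp N z = (\<Sum>m\<le>N. z ^ m / fact m)"

lemma power_le_exp_fact:
  fixes x :: real
  assumes "x \<ge> 0"
  shows "x ^ n \<le> exp x * fact n"
proof -
  have "x ^ n / fact n \<le> exp x"
    using sum_le_suminf[OF summable_exp[of x], of "{n}"] assms
    by (simp add: exp_def divide_inverse mult.commute)
  then show ?thesis by (simp add: field_simps)
qed

lemma sum_power_fact_le_exp:
  fixes x :: real
  assumes "x \<ge> 0" "finite A"
  shows "(\<Sum>m\<in>A. x ^ m / fact m) \<le> exp x"
  using sum_le_suminf[OF summable_exp[of x] assms(2)] assms(1)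
  by (simp add: exp_def divide_inverse mult.commute)

lemma norm_trunc_exp_le: "norm (trunc_exp N z) \<le> (\<Sum>m\<le>N. norm z ^ m / fact m)"
  unfolding trunc_exp_def by (rule order_trans[OF norm_sum]) (simp add: norm_divide norm_power)

text \<open>Taylor's remainder, combined with \<open>N ^ N \<le> exp N * fact N\<close>. The radius
  \<open>N / 60\<close> works because the growing factors amount to at most
  \<open>(2 * 3 ^ 3) ^ N = 54 ^ N\<close>. The error is relative to \<open>exp w\<close>, whose
  modulus is at least \<open>exp (- N / 60)\<close>, so that it survives the passage to
  powers.\<close>

lemma trunc_exp_error:
  assumes N: "N \<ge> 1" and w: "norm w \<le> real N / 60"
  shows "norm (exp w - trunc_exp N w) \<le> exp (- real N) / 2 * norm (exp w)"
proof -
  have e3: "exp (1::real) \<le> 3" by (rule exp_le)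
  have NN: "real N ^ N \<le> exp (real N) * fact N" by (rule power_le_exp_fact) simp
  have "norm (exp w - trunc_exp N w) \<le> exp (norm w) * (norm w ^ Suc N) / fact N"
    unfolding trunc_exp_def by (rule Taylor_exp_field)
  also have "\<dots> \<le> exp (real N / 60) * ((real N / 60) ^ Suc N) / fact N"
    using w by (intro divide_right_mono mult_mono power_mono) auto
  also have "\<dots> = exp (real N / 60) * (real N / 60) * (1 / 60) ^ N * (real N ^ N / fact N)"
    by (simp add: power_divide)
  also have "\<dots> \<le> exp (real N / 60) * (real N / 60) * (1 / 60) ^ N * exp (real N)"
    using NN by (intro mult_left_mono) (auto simp: field_simps)
  also have "\<dots> \<le> exp (- real N) / 2 * exp (- (real N / 60))"
  proof -
    have "real N / 30 * exp (real N * (2 + 1/30)) \<le> 60 ^ N"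
    proof -
      have "real N / 30 \<le> 2 ^ N" using of_nat_less_two_power[where 'a = real, of N] by linarith
      moreover have "exp (real N * (2 + 1/30)) \<le> exp (real N * 3)" by simp
      moreover have "exp (real N * 3) = exp 1 ^ (3 * N)" by (simp add: exp_of_nat_mult[symmetric] mult.commute)
      moreover have "exp 1 ^ (3 * N) \<le> (3::real) ^ (3 * N)" using e3 by (intro power_mono) auto
      ultimately have "real N / 30 * exp (real N * (2 + 1/30)) \<le> 2 ^ N * 3 ^ (3 * N)"
        by (intro mult_mono) auto
      also have "\<dots> = 54 ^ N" by (simp add: power_mult flip: power_mult_distrib)
      also have "\<dots> \<le> 60 ^ N" by (intro power_mono) auto
      finally show ?thesis .
    qed
    then have "real N / 30 * exp (real N * (2 + 1/30)) * (1/60) ^ N \<le> 1"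
      by (simp add: field_simps power_divide)
    then have "real N / 30 * exp (real N * (2 + 1/30)) * (1/60) ^ N * exp (- (real N * (1 + 1/60))) \<le>
        exp (- (real N * (1 + 1/60)))"
      by (intro mult_left_le_one_le) auto
    moreover have "exp (- (real N * (1 + 1/60))) = exp (- real N) * exp (- (real N / 60))"
      by (simp add: field_simps flip: exp_add)
    moreover have "exp (real N / 60) * (real N / 60) * (1/60) ^ N * exp (real N) =
        real N / 30 * exp (real N * (2 + 1/30)) * (1/60) ^ N * exp (- (real N * (1 + 1/60))) / 2"
    proof -
      have "exp (real N / 60) * exp (real N) =
          exp (real N * (2 + 1/30)) * exp (- (real N * (1 + 1/60)))"
        by (simp add: field_simps flip: exp_add)
      then show ?thesis by (simp add: mult_ac)
    qed
    ultimately show ?thesis by linarith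
  qed
  also have "\<dots> \<le> exp (- real N) / 2 * norm (exp w)"
  proof -
    have "- (real N / 60) \<le> Re w" using abs_Re_le_cmod[of w] w by linarith
    then show ?thesis by (intro mult_left_mono) (auto simp: norm_exp_eq_Re)
  qed
  finally show ?thesis .
qed

lemma powr_two_div_le_square:
  fixes a \<kappa> :: real
  assumes "a \<ge> 1" "\<kappa> \<ge> 1"
  shows "a powr (2 / \<kappa>) \<le> a\<^sup>2"
proof -
  have "2 / \<kappa> \<le> 2" using assms by (simp add: field_simps)
  then have "a powr (2 / \<kappa>) \<le> a powr 2" using assms by (intro powr_mono) auto
  then show ?thesis using assms by (simp add: powr_numeral)
qed

text \<open>A pointwise substitute for \<open>\<bar>exp (\<kappa> z)\<bar>\<close> to the power \<open>2 / \<kappa>\<close> being \<open>\<bar>exp z\<bar>\<^sup>2\<close>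
  that survives truncation: the last summand takes over where the truncation is inaccurate.\<close>

lemma trunc_exp_powr_le:
  fixes \<kappa> :: real and z :: complex
  assumes \<kappa>: "\<kappa> \<ge> 1" and N: "N \<ge> 1"
  shows "norm (trunc_exp N (of_real \<kappa> * z)) powr (2 / \<kappa>) \<le>
           (1 + 4 * exp (- real N)) * (norm (trunc_exp N z))\<^sup>2 + (120 * \<kappa> * norm z / real N) ^ (2 * N)"
proof (cases "\<kappa> * norm z \<le> real N / 60")
  case True
  define \<delta> where "\<delta> = exp (- real N) / 2"
  have "exp (- real N) \<le> 1 / 2"
  proof -
    have "exp (1::real) \<ge> 2" using exp_ge_add_one_self[of 1] by simp
    moreover have "exp (real N) \<ge> exp 1" using N by simp
    ultimately have "exp (real N) \<ge> 2" by linarith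
    then show ?thesis by (simp add: exp_minus field_simps)
  qed
  then have \<delta>: "0 \<le> \<delta>" "\<delta> \<le> 1 / 4" by (simp_all add: \<delta>_def)
  have "norm z \<le> \<kappa> * norm z" using \<kappa> mult_right_mono[of 1 \<kappa> "norm z"] by simp
  then have z: "norm z \<le> real N / 60" using True by simp
  have "norm (exp z - trunc_exp N z) \<le> \<delta> * norm (exp z)"
    unfolding \<delta>_def by (rule trunc_exp_error[OF N z])
  then have low: "norm (exp z) * (1 - \<delta>) \<le> norm (trunc_exp N z)"
    using norm_triangle_ineq2[of "exp z" "trunc_exp N z"] by (simp add: algebra_simps)
  have "norm (exp (of_real \<kappa> * z) - trunc_exp N (of_real \<kappa> * z)) \<le> \<delta> * norm (exp (of_real \<kappa> * z))"
    unfolding \<delta>_def by (rule trunc_exp_error[OF N]) (use True \<kappa> in \<open>simp add: norm_mult\<close>)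
  then have "norm (trunc_exp N (of_real \<kappa> * z)) \<le> norm (exp (of_real \<kappa> * z)) * (1 + \<delta>)"
    using norm_triangle_ineq2[of "trunc_exp N (of_real \<kappa> * z)" "exp (of_real \<kappa> * z)"]
    by (simp add: algebra_simps norm_minus_commute)
  then have "norm (trunc_exp N (of_real \<kappa> * z)) powr (2 / \<kappa>) \<le> (norm (exp (of_real \<kappa> * z)) * (1 + \<delta>)) powr (2 / \<kappa>)"
    using \<kappa> by (intro powr_mono2) auto
  also have "\<dots> = norm (exp (of_real \<kappa> * z)) powr (2 / \<kappa>) * (1 + \<delta>) powr (2 / \<kappa>)"
    using \<delta> by (simp add: powr_mult)
  also have "norm (exp (of_real \<kappa> * z)) powr (2 / \<kappa>) = (norm (exp z))\<^sup>2"
    using \<kappa> by (simp add: norm_exp_eq_Re exp_powr_real power2_eq_square flip: exp_add)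
  also have "(norm (exp z))\<^sup>2 * (1 + \<delta>) powr (2 / \<kappa>) \<le> (norm (exp z))\<^sup>2 * (1 + \<delta>)\<^sup>2"
    using \<delta> \<kappa> by (intro mult_left_mono powr_two_div_le_square) auto
  \<comment> \<open>For \<open>\<delta> \<le> 1 / 4\<close> the quotient of
    \<open>(1 + \<delta>) ^ 2\<close> by \<open>(1 - \<delta>) ^ 2\<close> is at most
    \<open>1 + 8 * \<delta>\<close>, and \<open>8 * \<delta>\<close> is the
    \<open>4 * exp (- N)\<close> of the statement.\<close>
  also have "\<dots> \<le> (1 + 8 * \<delta>) * (norm (exp z) * (1 - \<delta>))\<^sup>2"
  proof -
    have "(1 + 8 * \<delta>) * (1 - \<delta>)\<^sup>2 - (1 + \<delta>)\<^sup>2 = \<delta> * (4 - 16 * \<delta> + 8 * \<delta>\<^sup>2)"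
      by (simp add: power2_eq_square algebra_simps)
    moreover have "\<dots> \<ge> 0" using \<delta> by (intro mult_nonneg_nonneg) auto
    ultimately have "(1 + \<delta>)\<^sup>2 \<le> (1 + 8 * \<delta>) * (1 - \<delta>)\<^sup>2" by simp
    then have "(norm (exp z))\<^sup>2 * (1 + \<delta>)\<^sup>2 \<le> (norm (exp z))\<^sup>2 * ((1 + 8 * \<delta>) * (1 - \<delta>)\<^sup>2)"
      by (intro mult_left_mono) auto
    then show ?thesis by (simp add: power_mult_distrib mult_ac)
  qed
  also have "\<dots> \<le> (1 + 8 * \<delta>) * (norm (trunc_exp N z))\<^sup>2"
    using \<delta> low by (intro mult_left_mono power_mono) auto
  also have "\<dots> \<le> (1 + 8 * \<delta>) * (norm (trunc_exp N z))\<^sup>2 + (120 * \<kappa> * norm z / real N) ^ (2 * N)"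
    using \<kappa> by simp
  finally show ?thesis by (simp add: \<delta>_def)
next
  case False
  \<comment> \<open>\<open>w\<close> measures how far \<open>\<kappa> * z\<close> leaves the disc of
    radius \<open>N / 60\<close>. Once \<open>w ^ N\<close> is taken out,
    \<open>exp (N / 60) \<le> 2 ^ N\<close> remains, whence 120 = 2 * 60 in the statement.\<close>
  define w where "w = 60 * \<kappa> * norm z / real N"
  have w: "w \<ge> 1" and wN: "\<kappa> * norm z = w * (real N / 60)"
    using False N by (simp_all add: w_def field_simps)
  have "norm (trunc_exp N (of_real \<kappa> * z)) \<le> (\<Sum>m\<le>N. (\<kappa> * norm z) ^ m / fact m)"
    using norm_trunc_exp_le[of N "of_real \<kappa> * z"] \<kappa> by (simp add: norm_mult)
  also have "\<dots> \<le> (\<Sum>m\<le>N. w ^ N * ((real N / 60) ^ m / fact m))"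
  proof (rule sum_mono)
    fix m assume "m \<in> {..N}"
    then have "w ^ m * ((real N / 60) ^ m / fact m) \<le> w ^ N * ((real N / 60) ^ m / fact m)"
      using w by (intro mult_right_mono power_increasing) auto
    then show "(\<kappa> * norm z) ^ m / fact m \<le> w ^ N * ((real N / 60) ^ m / fact m)"
      unfolding wN power_mult_distrib[of w] by simp
  qed
  also have "\<dots> \<le> w ^ N * exp (real N / 60)"
    unfolding sum_distrib_left[symmetric]
    using w by (intro mult_left_mono sum_power_fact_le_exp) auto
  also have "exp (real N / 60) \<le> 2 ^ N"
  proof -
    have "exp (1/60) \<le> (2::real)"
    proof -
      have "exp (1/60) \<le> exp (1/2 :: real)" by simp
      also have "\<dots> \<le> 2"
      proof (rule power2_le_imp_le)
        show "(exp (1/2))\<^sup>2 \<le> (2::real)\<^sup>2" using exp_le by (simp add: power2_eq_square flip: exp_add)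
      qed auto
      finally show ?thesis .
    qed
    moreover have "exp (real N / 60) = exp (1/60) ^ N" by (simp add: exp_of_nat_mult[symmetric])
    ultimately show ?thesis by (simp add: power_mono)
  qed
  finally have "norm (trunc_exp N (of_real \<kappa> * z)) \<le> (2 * w) ^ N"
    using w by (simp add: power_mult_distrib mult_left_mono mult.commute)
  then have "norm (trunc_exp N (of_real \<kappa> * z)) powr (2 / \<kappa>) \<le> ((2 * w) ^ N) powr (2 / \<kappa>)"
    using \<kappa> by (intro powr_mono2) auto
  also have "\<dots> \<le> ((2 * w) ^ N)\<^sup>2"
    using w \<kappa> by (intro powr_two_div_le_square one_le_power) auto
  also have "\<dots> = (120 * \<kappa> * norm z / real N) ^ (2 * N)"
    by (simp add: w_def power_mult[symmetric] mult.commute mult.left_commute)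
  finally show ?thesis by (smt (verit) exp_ge_zero mult_nonneg_nonneg zero_le_power2)
qed

text \<open>Sorted by total degree. For \<open>m \<le> N\<close> the two cut-offs on
  \<open>a\<close> are void and the inner sum is a complete binomial expansion; only higher degrees
  feel the truncation.\<close>

lemma trunc_exp_mult:
  "trunc_exp N z * trunc_exp N w =
     (\<Sum>m\<le>2 * N. \<Sum>a\<in>{a. a \<le> m \<and> a \<le> N \<and> m - a \<le> N}. z ^ a * w ^ (m - a) / (fact a * fact (m - a)))"
proof -
  have fin: "finite {a. a \<le> m \<and> a \<le> N \<and> m - a \<le> N}" for m
    by (rule finite_subset[of _ "{..N}"]) auto
  have "trunc_exp N z * trunc_exp N w = (\<Sum>(a, b)\<in>{..N} \<times> {..N}. z ^ a * w ^ b / (fact a * fact b))"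
    unfolding trunc_exp_def sum_product by (simp add: sum.cartesian_product)
  also have "\<dots> = (\<Sum>(m, a)\<in>Sigma {..2 * N} (\<lambda>m. {a. a \<le> m \<and> a \<le> N \<and> m - a \<le> N}).
      z ^ a * w ^ (m - a) / (fact a * fact (m - a)))"
    by (rule sum.reindex_bij_witness[where i = "\<lambda>(m, a). (a, m - a)" and j = "\<lambda>(a, b). (a + b, a)"]) auto
  also have "\<dots> = (\<Sum>m\<le>2 * N. \<Sum>a\<in>{a. a \<le> m \<and> a \<le> N \<and> m - a \<le> N}. z ^ a * w ^ (m - a) / (fact a * fact (m - a)))"
    using fin by (subst sum.Sigma) auto
  finally show ?thesis .
qed

lemma linear_form_add:
  "linear_form P (\<lambda>p. a * x p + y p) f = a * linear_form P x f + linear_form P y f"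
  by (simp add: linear_form_def ring_distribs sum.distrib sum_distrib_left mult_ac)

lemma binomial_fact_sum:
  fixes u v :: "'a::field_char_0"
  shows "(\<Sum>a\<le>m. u ^ a * v ^ (m - a) / (fact a * fact (m - a))) = (u + v) ^ m / fact m"
  unfolding binomial_ring sum_divide_distrib
  by (intro sum.cong refl) (simp add: binomial_fact field_simps)

text \<open>Rankin's trick: for \<open>m \<ge> N\<close> the factor \<open>exp (- N) * 3 ^ m\<close>
  is at least 1.\<close>

lemma exp_tail_bound:
  fixes z :: real
  assumes "z \<ge> 0" "finite A" "\<And>m. m \<in> A \<Longrightarrow> N \<le> m"
  shows "(\<Sum>m\<in>A. z ^ m / fact m) \<le> exp (- real N) * exp (3 * z)"
proof -
  have "(\<Sum>m\<in>A. z ^ m / fact m) \<le> (\<Sum>m\<in>A. exp (- real N) * ((3 * z) ^ m / fact m))"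
  proof (rule sum_mono)
    fix m assume m: "m \<in> A"
    have "exp (real N) \<le> exp (real m)" using assms(3)[OF m] by simp
    also have "\<dots> = exp 1 ^ m" by (simp add: exp_of_nat_mult[symmetric])
    also have "\<dots> \<le> 3 ^ m" using exp_le by (intro power_mono) auto
    finally have "1 \<le> exp (- real N) * 3 ^ m" by (simp add: exp_minus field_simps)
    then have "1 * (z ^ m / fact m) \<le> (exp (- real N) * 3 ^ m) * (z ^ m / fact m)"
      using assms(1) by (intro mult_right_mono) auto
    then show "z ^ m / fact m \<le> exp (- real N) * ((3 * z) ^ m / fact m)"
      by (simp add: power_mult_distrib mult_ac)
  qed
  also have "\<dots> \<le> exp (- real N) * exp (3 * z)"
    unfolding sum_distrib_left[symmetric] using assms by (intro mult_left_mono sum_power_fact_le_exp) auto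
  finally show ?thesis .
qed

lemma sum_squares_le_square_sum:
  fixes v :: "'i \<Rightarrow> real"
  assumes "\<And>i. i \<in> I \<Longrightarrow> v i \<ge> 0"
  shows "(\<Sum>i\<in>I. (v i)\<^sup>2) \<le> (\<Sum>i\<in>I. v i)\<^sup>2"
  using assms
proof (induction I rule: infinite_finite_induct)
  case (insert i I)
  then have "0 \<le> v i * (\<Sum>i\<in>I. v i)" by (intro mult_nonneg_nonneg sum_nonneg) auto
  then show ?case using insert by (simp add: power2_sum)
qed auto

text \<open>The homogeneous components of degree at most \<open>N\<close> of the product are those of
  \<open>exp (\<kappa> X + Y)\<close>, which gives the main term; those of higher degree are negligible.\<close>

lemma represents_trunc_exp_mult:
  fixes \<kappa> :: real and x y :: "nat \<Rightarrow> complex"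
  assumes P: "finite P" "\<And>p. p \<in> P \<Longrightarrow> prime p" and \<kappa>: "\<kappa> \<ge> 1"
    and x: "(\<Sum>p\<in>P. (cmod (x p))\<^sup>2) \<le> s" and y: "(\<Sum>p\<in>P. (cmod (y p))\<^sup>2) \<le> s"
    and N: "N \<ge> 1"
  shows "represents (\<Union>m\<le>2 * N. omega_set P m)
           (\<lambda>f. trunc_exp N (\<kappa> * linear_form P x f) * trunc_exp N (linear_form P y f))
           (exp (\<Sum>p\<in>P. (cmod (\<kappa> * x p + y p))\<^sup>2) + exp (- real N) * exp (6 * (1 + \<kappa>)\<^sup>2 * s))"
proof -
  define \<sigma> where "\<sigma> = (\<Sum>p\<in>P. (cmod (\<kappa> * x p + y p))\<^sup>2)"
  \<comment> \<open>A crude bound valid in every degree: 2 accounts for the number of monomials in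
    Cauchy's inequality, at most \<open>2 ^ m\<close>, the factor \<open>(1 + \<kappa>) ^ 2\<close>
    for the squared binomial sum and \<open>s\<close> for the two forms. The crudeness is harmless,
    as above degree \<open>N\<close> the factor \<open>exp (- N)\<close> is gained.\<close>
  define z where "z = 2 * (1 + \<kappa>)\<^sup>2 * s"
  have s: "s \<ge> 0" using x by (rule order_trans[rotated]) (auto intro: sum_nonneg)
  have \<sigma>: "\<sigma> \<ge> 0" by (auto simp: \<sigma>_def intro: sum_nonneg)
  have z: "z \<ge> 0" using s by (simp add: z_def)
  define I where "I m = {a. a \<le> m \<and> a \<le> N \<and> m - a \<le> N}" for m
  have I: "I m \<subseteq> {..m}" for m by (auto simp: I_def)
  define G where "G m f = (\<Sum>a\<in>I m. (\<kappa> * linear_form P x f) ^ a * linear_form P y f ^ (m - a) / (fact a * fact (m - a)))"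
    for m f
  have low: "represents (omega_set P m) (G m) (\<sigma> ^ m / fact m)" if m: "m \<le> N" for m
  proof -
    have "I m = {..m}" using m by (auto simp: I_def)
    then have "G m f = linear_form P (\<lambda>p. \<kappa> * x p + y p) f ^ m / fact m" for f
      unfolding G_def linear_form_add by (simp add: binomial_fact_sum)
    moreover have "represents (omega_set P m)
        (\<lambda>f. (1 / fact m) * (linear_form P (\<lambda>p. \<kappa> * x p + y p) f ^ m * linear_form P y f ^ 0)) ((cmod (1 / fact m))\<^sup>2 * (fact m * \<sigma> ^ m * 1))"
      using represents_scale[OF represents_linear_form_powers[OF P, of m 0 "\<lambda>p. \<kappa> * x p + y p" y], of "1 / fact m"]
      by (simp add: \<sigma>_def)
    moreover have "(cmod (1 / fact m))\<^sup>2 * (fact m * \<sigma> ^ m * 1) = \<sigma> ^ m / fact m"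
      by (simp add: norm_divide power2_eq_square)
    ultimately show ?thesis by (auto elim!: represents_cong)
  qed
  have high: "represents (omega_set P m) (G m) (z ^ m / fact m)" for m
  proof -
    define B where "B a = (cmod (complex_of_real (\<kappa> ^ a / (fact a * fact (m - a)))))\<^sup>2 * (fact m * s ^ m)" for a
    have "represents (omega_set P m)
        (\<lambda>f. complex_of_real (\<kappa> ^ a / (fact a * fact (m - a))) * (linear_form P x f ^ a * linear_form P y f ^ (m - a))) (B a)"
      if a: "a \<in> I m" for a
    proof -
      have am: "a + (m - a) = m" using a by (auto simp: I_def)
      have "represents (omega_set P m) (\<lambda>f. linear_form P x f ^ a * linear_form P y f ^ (m - a))
          (fact m * (\<Sum>p\<in>P. (cmod (x p))\<^sup>2) ^ a * (\<Sum>p\<in>P. (cmod (y p))\<^sup>2) ^ (m - a))"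
        using represents_linear_form_powers[OF P, of a "m - a" x y] unfolding am .
      moreover have "(\<Sum>p\<in>P. (cmod (x p))\<^sup>2) ^ a * (\<Sum>p\<in>P. (cmod (y p))\<^sup>2) ^ (m - a) \<le> s ^ a * s ^ (m - a)"
        using x y s by (intro mult_mono power_mono) (auto intro!: sum_nonneg zero_le_power)
      ultimately have "represents (omega_set P m) (\<lambda>f. linear_form P x f ^ a * linear_form P y f ^ (m - a))
          (fact m * s ^ m)"
        using am by (elim represents_mono) (simp add: mult.assoc flip: power_add)
      then show ?thesis unfolding B_def by (rule represents_scale)
    qed
    then have "represents (omega_set P m)
        (\<lambda>f. \<Sum>a\<in>I m. complex_of_real (\<kappa> ^ a / (fact a * fact (m - a))) * (linear_form P x f ^ a * linear_form P y f ^ (m - a)))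
        (card (I m) * (\<Sum>a\<in>I m. B a))" by (rule represents_sum)
    then have "represents (omega_set P m) (G m) (card (I m) * (\<Sum>a\<in>I m. B a))"
      by (rule represents_cong) (simp add: G_def power_mult_distrib mult.assoc)
    moreover have "card (I m) * (\<Sum>a\<in>I m. B a) \<le> z ^ m / fact m"
    proof -
      have "card (I m) \<le> Suc m" using card_mono[OF _ I[of m]] by simp
      also have "\<dots> \<le> 2 ^ m" by (simp add: Suc_leI less_exp)
      finally have "real (card (I m)) \<le> real (2 ^ m)" by (simp only: of_nat_le_iff)
      then have c: "real (card (I m)) \<le> 2 ^ m" by simp
      have "(\<Sum>a\<in>I m. B a) = fact m * s ^ m * (\<Sum>a\<in>I m. (\<kappa> ^ a / (fact a * fact (m - a)))\<^sup>2)"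
        using \<kappa> unfolding B_def norm_of_real by (simp add: sum_distrib_left sum_distrib_right mult_ac)
      also have "(\<Sum>a\<in>I m. (\<kappa> ^ a / (fact a * fact (m - a)))\<^sup>2) \<le> (\<Sum>a\<le>m. (\<kappa> ^ a / (fact a * fact (m - a)))\<^sup>2)"
        using I by (intro sum_mono2) auto
      also have "\<dots> \<le> (\<Sum>a\<le>m. \<kappa> ^ a / (fact a * fact (m - a)))\<^sup>2"
        using \<kappa> by (intro sum_squares_le_square_sum) auto
      also have "(\<Sum>a\<le>m. \<kappa> ^ a / (fact a * fact (m - a))) = (1 + \<kappa>) ^ m / fact m"
        using binomial_fact_sum[of \<kappa> 1 m] by (simp add: add.commute)
      finally have "(\<Sum>a\<in>I m. B a) \<le> fact m * s ^ m * ((1 + \<kappa>) ^ m / fact m)\<^sup>2"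
        using s by (simp add: mult_left_mono)
      then have "card (I m) * (\<Sum>a\<in>I m. B a) \<le> 2 ^ m * (fact m * s ^ m * ((1 + \<kappa>) ^ m / fact m)\<^sup>2)"
        using c s by (intro mult_mono) (auto simp: B_def intro!: sum_nonneg)
      also have "\<dots> = z ^ m / fact m"
        by (simp add: z_def power_mult_distrib power2_eq_square)
      finally show ?thesis .
    qed
    ultimately show ?thesis by (rule represents_mono)
  qed
  define B where "B m = (if m \<le> N then \<sigma> ^ m / fact m else z ^ m / fact m)" for m
  have "represents (\<Union>m\<le>2 * N. omega_set P m) (\<lambda>f. \<Sum>m\<le>2 * N. G m f) (\<Sum>m\<le>2 * N. B m)"
  proof (rule represents_UN_disjoint)
    show "represents (omega_set P m) (G m) (B m)" for m
      using low high by (simp add: B_def)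
  qed (auto simp: omega_set_disjoint finite_omega_set[OF P(1)])
  moreover have "(\<Sum>m\<le>2 * N. B m) \<le> exp \<sigma> + exp (- real N) * exp (3 * z)"
  proof -
    have "(\<Sum>m\<le>2 * N. B m) = (\<Sum>m\<le>N. B m) + (\<Sum>m\<in>{N<..2 * N}. B m)"
      by (subst sum.union_disjoint[symmetric]) (auto intro!: sum.cong)
    also have "\<dots> = (\<Sum>m\<le>N. \<sigma> ^ m / fact m) + (\<Sum>m\<in>{N<..2 * N}. z ^ m / fact m)"
      by (intro arg_cong2[of _ _ _ _ "(+)"] sum.cong) (auto simp: B_def)
    also have "\<dots> \<le> exp \<sigma> + exp (- real N) * exp (3 * z)"
      using \<sigma> z by (intro add_mono sum_power_fact_le_exp exp_tail_bound) auto
    finally show ?thesis .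
  qed
  ultimately have "represents (\<Union>m\<le>2 * N. omega_set P m) (\<lambda>f. \<Sum>m\<le>2 * N. G m f)
      (exp \<sigma> + exp (- real N) * exp (3 * z))" by (rule represents_mono)
  then show ?thesis
    by (rule represents_mono[OF represents_cong]) (auto simp: G_def I_def trunc_exp_mult \<sigma>_def z_def)
qed

text \<open>Treats the part of the majorant that takes over where the truncation is inaccurate.
  Degree \<open>a + N\<close> costs \<open>fact (a + N) \<le> 2 ^ (a + N) * fact a * fact N\<close>.
  With \<open>fact N \<le> N ^ N\<close> the contribution of the \<open>N\<close>-th power becomes
  \<open>(28800 * \<kappa> ^ 2 * s / N) ^ N\<close>, where 28800 = 2 * 120^2. The bound on
  \<open>N\<close> is three times as large, so this is at most
  \<open>(1 / 3) ^ N \<le> exp (- N)\<close>.\<close>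

lemma represents_trunc_exp_power:
  fixes \<kappa> :: real and x y :: "nat \<Rightarrow> complex"
  assumes P: "finite P" "\<And>p. p \<in> P \<Longrightarrow> prime p" and \<kappa>: "\<kappa> \<ge> 1"
    and x: "(\<Sum>p\<in>P. (cmod (x p))\<^sup>2) \<le> s" and y: "(\<Sum>p\<in>P. (cmod (y p))\<^sup>2) \<le> s"
    and N: "N \<ge> 1" "real N \<ge> 86400 * \<kappa>\<^sup>2 * s"
  shows "represents (\<Union>m\<le>2 * N. omega_set P m)
           (\<lambda>f. trunc_exp N (\<kappa> * linear_form P x f) * (120 * \<kappa> / real N * linear_form P y f) ^ N)
           (exp (- real N) * exp (2 * \<kappa>\<^sup>2 * s))"
proof -
  define C where "C = 120 * \<kappa> / real N"
  have s: "s \<ge> 0" using x by (rule order_trans[rotated]) (auto intro: sum_nonneg)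
  define G where "G a f = complex_of_real (C ^ N * \<kappa> ^ a / fact a) * (linear_form P x f ^ a * linear_form P y f ^ N)" for a f
  define B where "B a = (2 * \<kappa>\<^sup>2 * s) ^ a / fact a * exp (- real N)" for a
  have "represents (omega_set P (a + N)) (G a) (B a)" for a
  proof -
    have "represents (omega_set P (a + N)) (\<lambda>f. linear_form P x f ^ a * linear_form P y f ^ N)
          (fact (a + N) * (\<Sum>p\<in>P. (cmod (x p))\<^sup>2) ^ a * (\<Sum>p\<in>P. (cmod (y p))\<^sup>2) ^ N)"
      by (rule represents_linear_form_powers[OF P])
    moreover have "fact (a + N) * ((\<Sum>p\<in>P. (cmod (x p))\<^sup>2) ^ a * (\<Sum>p\<in>P. (cmod (y p))\<^sup>2) ^ N)
       \<le> 2 ^ (a + N) * fact a * fact N * (s ^ a * s ^ N)"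
    proof (rule mult_mono)
      have "(a + N choose a) \<le> 2 ^ (a + N)" by (rule binomial_le_pow2)
      then have "real (a + N choose a) \<le> 2 ^ (a + N)" by (metis of_nat_le_iff of_nat_numeral of_nat_power)
      moreover have "real (a + N choose a) = fact (a + N) / (fact a * fact N)" by (simp add: binomial_fact)
      ultimately have "fact (a + N) / (fact a * fact N) \<le> (2 ^ (a + N) :: real)" by simp
      then show "fact (a + N) \<le> (2 ^ (a + N) * fact a * fact N :: real)"
        by (simp add: divide_le_eq mult.assoc)
    qed (use x y s in \<open>auto intro!: mult_mono power_mono sum_nonneg mult_nonneg_nonneg zero_le_power\<close>)
    ultimately have "represents (omega_set P (a + N)) (\<lambda>f. linear_form P x f ^ a * linear_form P y f ^ N)
          (2 ^ (a + N) * fact a * fact N * (s ^ a * s ^ N))"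
      by (elim represents_mono) (simp add: mult.assoc)
    then have "represents (omega_set P (a + N)) (G a)
       ((cmod (complex_of_real (C ^ N * \<kappa> ^ a / fact a)))\<^sup>2 * (2 ^ (a + N) * fact a * fact N * (s ^ a * s ^ N)))"
      unfolding G_def by (rule represents_scale)
    moreover have "(cmod (complex_of_real (C ^ N * \<kappa> ^ a / fact a)))\<^sup>2 * (2 ^ (a + N) * fact a * fact N * (s ^ a * s ^ N)) \<le> B a"
    proof -
      have "(cmod (complex_of_real (C ^ N * \<kappa> ^ a / fact a)))\<^sup>2 * (2 ^ (a + N) * fact a * fact N * (s ^ a * s ^ N))
         = ((C ^ N * \<kappa> ^ a / fact a)\<^sup>2) * (2 ^ (a + N) * fact a * fact N * (s ^ a * s ^ N))"
        unfolding norm_of_real by (simp only: power2_abs)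
      also have "\<dots> = (2 * \<kappa>\<^sup>2 * s) ^ a / fact a * ((2 * C\<^sup>2 * s) ^ N * fact N)"
        by (simp add: power_mult_distrib power_add power2_eq_square field_simps)
      also have "\<dots> \<le> (2 * \<kappa>\<^sup>2 * s) ^ a / fact a * exp (- real N)"
      proof (rule mult_left_mono)
        have "fact N \<le> real N ^ N" using fact_le_power[of N, where 'a = real] by simp
        then have "(2 * C\<^sup>2 * s) ^ N * fact N \<le> (2 * C\<^sup>2 * s) ^ N * real N ^ N"
          using s by (intro mult_left_mono) auto
        also have "\<dots> = (28800 * \<kappa>\<^sup>2 * s / real N) ^ N"
          using N(1) by (simp add: C_def power2_eq_square field_simps flip: power_mult_distrib)
        also have "\<dots> \<le> (1 / 3) ^ N"
          using N s by (intro power_mono) (auto simp: field_simps)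
        also have "\<dots> \<le> exp (- 1) ^ N"
          using exp_le by (intro power_mono) (auto simp: exp_minus field_simps)
        also have "\<dots> = exp (- real N)" by (simp add: exp_of_nat_mult[symmetric])
        finally show "(2 * C\<^sup>2 * s) ^ N * fact N \<le> exp (- real N)" .
      qed (use s in auto)
      finally show ?thesis by (simp add: B_def)
    qed
    ultimately show ?thesis by (rule represents_mono)
  qed
  then have "represents (\<Union>a\<le>N. omega_set P (a + N)) (\<lambda>f. \<Sum>a\<le>N. G a f) (\<Sum>a\<le>N. B a)"
    by (intro represents_UN_disjoint) (auto simp: omega_set_disjoint finite_omega_set[OF P(1)])
  then have "represents (\<Union>m\<le>2 * N. omega_set P m) (\<lambda>f. \<Sum>a\<le>N. G a f) (\<Sum>a\<le>N. B a)"
  proof (rule represents_superset)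
    show "(\<Union>a\<le>N. omega_set P (a + N)) \<subseteq> (\<Union>m\<le>2 * N. omega_set P m)"
    proof (rule UN_least)
      fix a assume "a \<in> {..N}"
      then show "omega_set P (a + N) \<subseteq> (\<Union>m\<le>2 * N. omega_set P m)" by (intro UN_upper) auto
    qed
  qed (simp add: finite_omega_set[OF P(1)])
  moreover have "(\<Sum>a\<le>N. B a) \<le> exp (- real N) * exp (2 * \<kappa>\<^sup>2 * s)"
  proof -
    have "(\<Sum>a\<le>N. B a) = exp (- real N) * (\<Sum>a\<le>N. (2 * \<kappa>\<^sup>2 * s) ^ a / fact a)"
      by (simp add: B_def sum_distrib_left mult.commute)
    also have "\<dots> \<le> exp (- real N) * exp (2 * \<kappa>\<^sup>2 * s)"
      using s by (intro mult_left_mono sum_power_fact_le_exp) auto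
    finally show ?thesis .
  qed
  ultimately have "represents (\<Union>m\<le>2 * N. omega_set P m) (\<lambda>f. \<Sum>a\<le>N. G a f) (exp (- real N) * exp (2 * \<kappa>\<^sup>2 * s))"
    by (rule represents_mono)
  then show ?thesis
    by (rule represents_cong)
       (simp add: G_def C_def trunc_exp_def sum_distrib_right sum_distrib_left sum_divide_distrib
         power_mult_distrib power_divide mult_ac)
qed

subsection \<open>Sums over primes\<close>

lemma prod_primes_dvd:
  assumes "finite Q" "\<forall>p\<in>Q. prime (p::nat) \<and> p dvd n"
  shows "\<Prod>Q dvd n"
  using assms
proof (induction Q rule: finite_induct)
  case (insert p Q)
  have "coprime p (\<Prod>Q)"
  proof (rule prod_coprime_right)
    fix r assume "r \<in> Q"
    then have "prime p" "prime r" "p \<noteq> r" using insert.prems insert.hyps by blast+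
    then show "coprime p r" by (rule primes_coprime)
  qed
  moreover have "p dvd n" "\<Prod>Q dvd n" using insert.prems insert.IH by blast+
  ultimately show ?case using insert.hyps by (simp add: divides_mult)
qed simp

lemma prime_dvd_central_binomial:
  assumes "prime p" "n < p" "p \<le> 2 * n"
  shows "p dvd (2 * n choose n)"
proof -
  have "p dvd fact (2 * n)" using assms by (simp add: prime_dvd_fact_iff)
  also have "fact (2 * n) = fact n * fact n * (2 * n choose n)"
    using binomial_fact_lemma[of n "2 * n"] by (simp add: mult_2)
  finally show ?thesis using assms by (auto simp: prime_dvd_mult_iff prime_dvd_fact_iff)
qed

text \<open>Chebyshev's argument: with \<open>n = 2 ^ l\<close>, the primes in (n, 2n] all divide
  the central binomial coefficient, which is at most \<open>2 ^ (2 * n)\<close>. Hence there are at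
  most \<open>2 * n / l\<close> of them, each contributing at most \<open>1 / n\<close>.\<close>

lemma sum_inverse_primes_dyadic:
  assumes l: "l \<ge> 1"
  shows "(\<Sum>p | prime p \<and> 2 ^ l < p \<and> p \<le> (2::nat) ^ Suc l. 1 / real p) \<le> 2 / real l"
proof -
  define n :: nat where "n = 2 ^ l"
  define Q where "Q = {p. prime p \<and> n < p \<and> p \<le> 2 * n}"
  have fin: "finite Q" by (rule finite_subset[of _ "{..2 * n}"]) (auto simp: Q_def)
  have "n ^ card Q = (\<Prod>p\<in>Q. n)" by simp
  also have "\<dots> \<le> \<Prod>Q" by (rule prod_mono) (auto simp: Q_def)
  also have "\<dots> \<le> (2 * n choose n)"
    by (rule dvd_imp_le[OF prod_primes_dvd[OF fin]]) (auto simp: Q_def prime_dvd_central_binomial)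
  also have "\<dots> \<le> 2 ^ (2 * n)" by (rule binomial_le_pow2)
  finally have "(2::nat) ^ (l * card Q) \<le> 2 ^ (2 * n)" by (simp add: n_def power_mult)
  then have "l * card Q \<le> 2 * n" by (rule power_le_imp_le_exp[rotated]) simp
  then have c: "real l * real (card Q) \<le> 2 * real n" by (metis of_nat_le_iff of_nat_mult of_nat_numeral)
  have "(\<Sum>p\<in>Q. 1 / real p) \<le> (\<Sum>p\<in>Q. 1 / real n)"
    by (rule sum_mono) (auto simp: Q_def n_def intro!: divide_left_mono)
  also have "\<dots> = real (card Q) / real n" by simp
  also have "\<dots> \<le> 2 / real l"
    using c l by (simp add: n_def field_simps)
  finally show ?thesis by (simp add: Q_def n_def)
qed

definition prime_block :: "nat \<Rightarrow> nat set" where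
  "prime_block i = {p. prime p \<and> 2 ^ 2 ^ i < p \<and> p \<le> 2 ^ 2 ^ Suc i}"

lemma finite_prime_block: "finite (prime_block i)"
  by (rule finite_subset[of _ "{..2 ^ 2 ^ Suc i}"]) (auto simp: prime_block_def)

lemma prime_prime_block: "p \<in> prime_block i \<Longrightarrow> prime p"
  by (simp add: prime_block_def)

lemma ex_dyadic:
  assumes "2 ^ a < (p::nat)" "p \<le> 2 ^ b"
  obtains l where "a \<le> l" "l < b" "2 ^ l < p" "p \<le> 2 ^ Suc l"
proof -
  define m where "m = (LEAST m. p \<le> 2 ^ m)"
  have m: "p \<le> 2 ^ m" unfolding m_def by (rule LeastI[of _ b]) (rule assms(2))
  have mb: "m \<le> b" unfolding m_def by (rule Least_le) (rule assms(2))
  have "a < m"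
  proof (rule ccontr)
    assume "\<not> a < m"
    then have "(2::nat) ^ m \<le> 2 ^ a" by (intro power_increasing) auto
    then show False using m assms(1) by linarith
  qed
  then obtain l where l: "m = Suc l" using gr0_conv_Suc[of m] by auto
  have "\<not> p \<le> 2 ^ l"
  proof
    assume "p \<le> 2 ^ l"
    then have "m \<le> l" unfolding m_def by (rule Least_le)
    then show False using l by simp
  qed
  then show ?thesis using that[of l] l m mb \<open>a < m\<close> by auto
qed

lemma sum_UN_le:
  fixes f :: "'a \<Rightarrow> real"
  assumes "finite I" "\<And>i. i \<in> I \<Longrightarrow> finite (A i)" "\<And>x. f x \<ge> 0"
  shows "sum f (\<Union>i\<in>I. A i) \<le> (\<Sum>i\<in>I. sum f (A i))"
  using assms
proof (induction I rule: finite_induct)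
  case (insert i I)
  have "sum f (A i \<union> (\<Union>i\<in>I. A i)) \<le> sum f (A i) + sum f (\<Union>i\<in>I. A i)"
    using insert.prems insert.hyps by (subst sum_Un) (auto intro!: sum_nonneg)
  then show ?case using insert by fastforce
qed auto

text \<open>The block splits into \<open>2 ^ i\<close> dyadic ranges, each of mass at most
  \<open>2 / 2 ^ i\<close>.\<close>

lemma sum_prime_block_le: "(\<Sum>p\<in>prime_block i. 1 / real p) \<le> 2"
proof -
  define D where "D l = {p::nat. prime p \<and> 2 ^ l < p \<and> p \<le> 2 ^ Suc l}" for l
  have finD: "finite (D l)" for l
    by (rule finite_subset[of _ "{..2 ^ Suc l}"]) (auto simp: D_def)
  have "prime_block i \<subseteq> (\<Union>l\<in>{2 ^ i..<2 ^ Suc i}. D l)"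
  proof
    fix p assume p: "p \<in> prime_block i"
    then obtain l where "2 ^ i \<le> l" "l < 2 ^ Suc i" "2 ^ l < p" "p \<le> 2 ^ Suc l"
      using ex_dyadic[of "2 ^ i" p "2 ^ Suc i"] unfolding prime_block_def by blast
    then show "p \<in> (\<Union>l\<in>{2 ^ i..<2 ^ Suc i}. D l)"
      using p by (auto simp: D_def prime_block_def intro!: bexI[of _ l])
  qed
  then have "(\<Sum>p\<in>prime_block i. 1 / real p) \<le> (\<Sum>p\<in>(\<Union>l\<in>{2 ^ i..<2 ^ Suc i}. D l). 1 / real p)"
    using finD by (intro sum_mono2) auto
  also have "\<dots> \<le> (\<Sum>l\<in>{2 ^ i..<2 ^ Suc i}. \<Sum>p\<in>D l. 1 / real p)"
    using finD by (intro sum_UN_le) auto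
  also have "\<dots> \<le> (\<Sum>l\<in>{2 ^ i..<(2::nat) ^ Suc i}. 2 / 2 ^ i)"
  proof (rule sum_mono)
    fix l :: nat assume l: "l \<in> {2 ^ i..<2 ^ Suc i}"
    then have l': "(2::nat) ^ i \<le> l" by simp
    have "(1::nat) \<le> 2 ^ i" by simp
    then have l1: "1 \<le> l" using l' by linarith
    have "(2::real) ^ i \<le> real l" using l' by (metis of_nat_le_iff of_nat_numeral of_nat_power)
    then have "2 / real l \<le> 2 / 2 ^ i" using l1 by (intro divide_left_mono) auto
    then show "(\<Sum>p\<in>D l. 1 / real p) \<le> 2 / 2 ^ i"
      using sum_inverse_primes_dyadic[OF l1] by (simp add: D_def)
  qed
  also have "\<dots> = 2" by (simp add: field_simps)
  finally show ?thesis .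
qed

lemma geometric_tail_le:
  fixes r :: real
  assumes "0 \<le> r" "r < 1"
  shows "(\<Sum>l\<in>{a..<b}. r ^ l) \<le> r ^ a / (1 - r)"
proof (cases "a \<le> b")
  case True
  have "(1 - r) * (\<Sum>l\<in>{a..<b}. r ^ l) = r ^ a - r ^ b"
    using True
  proof (induction b rule: dec_induct)
    case (step b)
    then show ?case by (simp add: distrib_left) (simp add: left_diff_distrib)
  qed simp
  also have "\<dots> \<le> r ^ a" using assms by simp
  finally show ?thesis using assms by (simp add: field_simps)
qed (use assms in auto)

text \<open>The additional exponent \<open>\<delta> = 1 / 2 ^ J\<close> makes the dyadic
  contributions decay geometrically with ratio \<open>2 powr - \<delta>\<close>, so that the primes
  beyond \<open>2 ^ 2 ^ J\<close> contribute only a constant.\<close>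

lemma sum_prime_powr_tail_le:
  assumes "finite A" "\<And>p. p \<in> A \<Longrightarrow> prime p \<and> 2 ^ 2 ^ J < p"
  shows "(\<Sum>p\<in>A. real p powr - (1 + 1 / 2 ^ J)) \<le> 2"
proof -
  define \<delta> :: real where "\<delta> = 1 / 2 ^ J"
  have \<delta>: "0 < \<delta>" "\<delta> \<le> 1" by (auto simp: \<delta>_def)
  define r where "r = 2 powr - \<delta>"
  have r0: "0 < r" "r < 1" using \<delta> powr_less_mono[of "-\<delta>" 0 2] by (auto simp: r_def)
  have rn: "r ^ 2 ^ J = 1 / 2"
  proof -
    have "r ^ 2 ^ J = r powr real (2 ^ J)" using r0(1) by (rule powr_realpow[symmetric])
    also have "\<dots> = 2 powr (- \<delta> * 2 ^ J)" unfolding r_def powr_powr by simp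
    also have "- \<delta> * 2 ^ J = -1" by (simp add: \<delta>_def)
    finally show ?thesis by (simp add: powr_minus)
  qed
  \<comment> \<open>By Bernoulli, \<open>(1 - \<delta> / 2) ^ 2 ^ J \<ge> 1 / 2 = r ^ 2 ^ J\<close>.
    Thus \<open>1 / (1 - r) \<le> 2 / \<delta>\<close>, which cancels the factor
    \<open>\<delta>\<close> of the dyadic bound.\<close>
  have "r \<le> 1 - \<delta> / 2"
  proof (rule power_le_imp_le_base)
    have "1 + real (2 ^ J) * (- \<delta> / 2) \<le> (1 + (- \<delta> / 2)) ^ 2 ^ J"
      using \<delta> by (intro Bernoulli_inequality) auto
    then show "r ^ Suc (2 ^ J - 1) \<le> (1 - \<delta> / 2) ^ Suc (2 ^ J - 1)"
      using rn by (simp add: \<delta>_def)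
  qed (use \<delta> in auto)
  then have r1: "1 - r \<ge> \<delta> / 2" by simp
  define D where "D l = {p::nat. prime p \<and> 2 ^ l < p \<and> p \<le> 2 ^ Suc l}" for l
  have finD: "finite (D l)" for l
    by (rule finite_subset[of _ "{..2 ^ Suc l}"]) (auto simp: D_def)
  define L where "L = Max (insert 0 A)"
  have AL: "p \<le> 2 ^ L" if "p \<in> A" for p
  proof -
    have "p \<le> L" unfolding L_def using that assms(1) by (intro Max_ge) auto
    also have "L \<le> 2 ^ L" by (simp add: less_imp_le)
    finally show ?thesis .
  qed
  have "A \<subseteq> (\<Union>l\<in>{2 ^ J..<L}. D l)"
  proof
    fix p assume p: "p \<in> A"
    then obtain l where "2 ^ J \<le> l" "l < L" "2 ^ l < p" "p \<le> 2 ^ Suc l"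
      using ex_dyadic[of "2 ^ J" p L] AL[OF p] assms(2) by blast
    then show "p \<in> (\<Union>l\<in>{2 ^ J..<L}. D l)"
      using assms(2)[OF p] by (auto simp: D_def intro!: bexI[of _ l])
  qed
  then have "(\<Sum>p\<in>A. real p powr - (1 + \<delta>)) \<le> (\<Sum>p\<in>(\<Union>l\<in>{2 ^ J..<L}. D l). real p powr - (1 + \<delta>))"
    using finD by (intro sum_mono2) auto
  also have "\<dots> \<le> (\<Sum>l\<in>{2 ^ J..<L}. \<Sum>p\<in>D l. real p powr - (1 + \<delta>))"
    using finD by (intro sum_UN_le) auto
  also have "\<dots> \<le> (\<Sum>l\<in>{2 ^ J..<L}. 2 * \<delta> * r ^ l)"
  proof (rule sum_mono)
    fix l :: nat assume l: "l \<in> {2 ^ J..<L}"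
    have "(1::nat) \<le> 2 ^ J" by simp
    then have l1: "1 \<le> l" using l by (metis atLeastLessThan_iff le_trans)
    have "(\<Sum>p\<in>D l. real p powr - (1 + \<delta>)) \<le> (\<Sum>p\<in>D l. r ^ l * (1 / real p))"
    proof (rule sum_mono)
      fix p assume p: "p \<in> D l"
      then have "2 ^ l \<le> p" by (simp add: D_def)
      then have p2: "(2::real) ^ l \<le> real p" by (metis of_nat_le_iff of_nat_numeral of_nat_power)
      have p0: "real p > 0" using p by (auto simp: D_def intro: prime_gt_0_nat)
      have "real p powr - \<delta> \<le> (2 ^ l) powr - \<delta>"
        using p2 \<delta> by (intro powr_mono2') auto
      also have "\<dots> = (2 powr real l) powr - \<delta>" by (simp add: powr_realpow)
      also have "\<dots> = r powr real l" unfolding r_def powr_powr by (simp add: mult.commute)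
      also have "\<dots> = r ^ l" using r0 by (simp add: powr_realpow)
      finally show "real p powr - (1 + \<delta>) \<le> r ^ l * (1 / real p)"
        using p0 by (simp add: powr_diff powr_minus field_simps)
    qed
    also have "\<dots> = r ^ l * (\<Sum>p\<in>D l. 1 / real p)" by (simp add: sum_distrib_left)
    also have "\<dots> \<le> r ^ l * (2 / real l)"
      using sum_inverse_primes_dyadic[OF l1] r0 by (intro mult_left_mono) (auto simp: D_def)
    also have "2 / real l \<le> 2 / 2 ^ J"
    proof -
      have "(2::nat) ^ J \<le> l" using l by simp
      then have "(2::real) ^ J \<le> real l" by (metis of_nat_le_iff of_nat_numeral of_nat_power)
      then show ?thesis using l1 by (intro divide_left_mono) auto
    qed
    finally show "(\<Sum>p\<in>D l. real p powr - (1 + \<delta>)) \<le> 2 * \<delta> * r ^ l"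
      using r0 by (simp add: \<delta>_def mult_left_mono mult.commute)
  qed
  also have "\<dots> = 2 * \<delta> * (\<Sum>l\<in>{2 ^ J..<L}. r ^ l)" by (simp add: sum_distrib_left)
  also have "\<dots> \<le> 2 * \<delta> * (r ^ 2 ^ J / (1 - r))"
    using \<delta> r0 by (intro mult_left_mono geometric_tail_le) auto
  also have "\<dots> \<le> 2"
    using r1 \<delta> r0 unfolding rn by (simp add: field_simps)
  finally show ?thesis by (simp add: \<delta>_def)
qed

section \<open>The zeta function near its pole\<close>

lemma convex_of_real_interval: "convex (complex_of_real ` {a..b})"
  by (intro convex_linear_image bounded_linear.linear bounded_linear_of_real) simp

lemma nat_powr_bounds:
  fixes s :: complex
  assumes s: "Re s \<ge> 1" and n: "n \<ge> (1::nat)" and u: "real n \<le> u" "u \<le> real n + 1"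
  shows "cmod (of_real u powr - s - of_real (real n) powr - s) \<le> cmod s / (real n)\<^sup>2"
proof -
  let ?S = "complex_of_real ` {real n..real n + 1}"
  have "cmod (of_real u powr - s - of_real (real n) powr - s) \<le>
      cmod s / (real n)\<^sup>2 * cmod (of_real u - complex_of_real (real n))"
  proof (rule field_differentiable_bound[of ?S])
    fix z assume z: "z \<in> ?S"
    then obtain v where v: "z = of_real v" "real n \<le> v" "v \<le> real n + 1" by auto
    have "z \<notin> \<real>\<^sub>\<le>\<^sub>0" using v n by (auto simp: complex_nonpos_Reals_iff)
    then show "((\<lambda>z. z powr - s) has_field_derivative - s * z powr (- s - 1)) (at z within ?S)"
      by (rule has_field_derivative_at_within[OF has_field_derivative_powr])
    have "cmod (z powr (- s - 1)) = v powr (- Re s - 1)"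
      using v n by (subst norm_powr_real_powr) auto
    also have "\<dots> \<le> v powr - 2" using v n s by (intro powr_mono) auto
    also have "\<dots> \<le> real n powr - 2" using v n by (intro powr_mono2') auto
    also have "\<dots> = 1 / (real n)\<^sup>2" using n by (simp add: powr_minus_divide powr_numeral)
    finally have "cmod (z powr (- s - 1)) \<le> 1 / (real n)\<^sup>2" .
    from mult_left_mono[OF this, of "cmod s"] show "cmod (- s * z powr (- s - 1)) \<le> cmod s / (real n)\<^sup>2"
      by (simp add: norm_mult)
  next
    show "of_real u \<in> ?S" "complex_of_real (real n) \<in> ?S" by (rule imageI, use u in simp)+
  qed (rule convex_of_real_interval)
  also have "cmod (of_real u - complex_of_real (real n)) = \<bar>u - real n\<bar>"
    unfolding of_real_diff[symmetric] norm_of_real ..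
  also have "cmod s / (real n)\<^sup>2 * \<bar>u - real n\<bar> \<le> cmod s / (real n)\<^sup>2 * 1"
    using u by (intro mult_left_mono) auto
  finally show ?thesis by simp
qed

text \<open>Compares \<open>n powr - s\<close> with the integral of \<open>u powr - s\<close> over
  [n, n + 1], expressed by the antiderivative. The mean value inequality is applied to the
  antiderivative minus a linear function of slope \<open>n powr - s\<close>, so no integral
  occurs.\<close>

lemma nat_powr_telescope:
  fixes s :: complex
  assumes s: "Re s > 1" and n: "n \<ge> (1::nat)"
  shows "cmod (of_nat n powr - s - (of_nat (Suc n) powr (1 - s) - of_nat n powr (1 - s)) / (1 - s))
           \<le> cmod s / (real n)\<^sup>2"
proof -
  have s1: "1 - s \<noteq> 0" using s by auto
  let ?S = "complex_of_real ` {real n..real n + 1}"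
  have Suc: "complex_of_real (real n + 1) = of_nat (Suc n)" "complex_of_real (real n) = of_nat n" by simp_all
  have alg: "A / w - of_nat (Suc n) * c - (B / w - of_nat n * c) = - (c - (A - B) / w)" for A B c w :: complex
    by (simp add: diff_divide_distrib ring_distribs)
  define \<phi> where "\<phi> = (\<lambda>z. z powr (1 - s) / (1 - s) - z * of_real (real n) powr - s)"
  have "cmod (\<phi> (of_real (real n + 1)) - \<phi> (of_real (real n))) \<le>
      cmod s / (real n)\<^sup>2 * cmod (of_real (real n + 1) - complex_of_real (real n))"
  proof (rule field_differentiable_bound[of ?S])
    fix z assume z: "z \<in> ?S"
    then obtain v where v: "z = of_real v" "real n \<le> v" "v \<le> real n + 1" by auto
    have "z \<notin> \<real>\<^sub>\<le>\<^sub>0" using v n by (auto simp: complex_nonpos_Reals_iff)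
    then have "((\<lambda>z. z powr (1 - s)) has_field_derivative (1 - s) * z powr (1 - s - 1)) (at z)"
      by (rule has_field_derivative_powr)
    from DERIV_diff[OF DERIV_cdivide[OF this, of "1 - s"] DERIV_cmult_right[OF DERIV_ident, of "of_real (real n) powr - s"]]
    have "(\<phi> has_field_derivative ((1 - s) * z powr (1 - s - 1)) / (1 - s) - of_real (real n) powr - s) (at z)"
      unfolding \<phi>_def by simp
    then show "(\<phi> has_field_derivative z powr - s - of_real (real n) powr - s) (at z within ?S)"
      using s1 by (subst has_field_derivative_at_within) simp_all
    show "cmod (z powr - s - of_real (real n) powr - s) \<le> cmod s / (real n)\<^sup>2"
      unfolding v(1) using s n v by (intro nat_powr_bounds) auto
  next
    show "of_real (real n + 1) \<in> ?S" "complex_of_real (real n) \<in> ?S" by (rule imageI, simp)+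
  qed (rule convex_of_real_interval)
  also have "cmod (of_real (real n + 1) - complex_of_real (real n)) = 1" by simp
  also have "\<phi> (of_real (real n + 1)) - \<phi> (of_real (real n)) =
      - (of_nat n powr - s - (of_nat (Suc n) powr (1 - s) - of_nat n powr (1 - s)) / (1 - s))"
    unfolding \<phi>_def Suc using alg by blast
  finally show ?thesis unfolding norm_minus_cancel mult_1_right .
qed

lemma sum_inverse_squares_le: "(\<Sum>n\<in>{1..m}. 1 / (real n)\<^sup>2) \<le> 2"
proof -
  have "(\<Sum>n\<in>{1..m}. 1 / (real n)\<^sup>2) \<le> 2 - 1 / real m"
  proof (induction m)
    case (Suc m)
    have "1 / (real (Suc m))\<^sup>2 \<le> 1 / real m - 1 / real (Suc m)" if "m > 0"
      using that by (simp add: divide_simps power2_eq_square)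
    then show ?case using Suc by (cases "m = 0") auto
  qed simp
  also have "\<dots> \<le> 2" by simp
  finally show ?thesis .
qed

lemma completely_mult_powr: "completely_mult (\<lambda>n. of_nat n powr - s)"
  by (auto simp: completely_mult_def powr_times_real)

lemma norm_nat_powr: "cmod (of_nat n powr - s) = real n powr - Re s"
  by (subst norm_powr_real_powr) auto

lemma summable_nat_powr: "Re s > 1 \<Longrightarrow> summable (\<lambda>n. cmod (of_nat n powr - s))"
  by (simp add: norm_nat_powr summable_real_powr_iff)

text \<open>The comparisons with the integral are summed: the telescoping part tends to
  \<open>1 / (s - 1)\<close>, and the errors add up to at most \<open>cmod s\<close> times the sum
  of \<open>1 / n ^ 2\<close>, which is at most 2.\<close>

lemma zeta_pole_bound:
  assumes s: "Re s > 1"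
  shows "cmod ((\<Sum>n. of_nat n powr - s) - 1 / (s - 1)) \<le> 2 * cmod s"
proof -
  define g where "g n = of_nat n powr (1 - s)" for n :: nat
  have s1: "1 - s \<noteq> 0" using s by auto
  have part: "cmod ((\<Sum>n<Suc m. of_nat n powr - s) - (g (Suc m) - 1) / (1 - s)) \<le> 2 * cmod s" for m
  proof -
    have "(\<Sum>n<Suc m. of_nat n powr - s) = (\<Sum>n\<in>{1..m}. of_nat n powr - s)"
      by (rule sum.mono_neutral_cong_right) (auto simp: not_le)
    moreover have "(\<Sum>n\<in>{1..m}. g (Suc n) - g n) = g (Suc m) - 1"
      by (subst sum_Suc_diff) (auto simp: g_def)
    then have "(g (Suc m) - 1) / (1 - s) = (\<Sum>n\<in>{1..m}. (g (Suc n) - g n) / (1 - s))"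
      by (simp add: sum_divide_distrib[symmetric])
    ultimately have "cmod ((\<Sum>n<Suc m. of_nat n powr - s) - (g (Suc m) - 1) / (1 - s)) =
        cmod (\<Sum>n\<in>{1..m}. of_nat n powr - s - (g (Suc n) - g n) / (1 - s))"
      by (simp add: sum_subtractf)
    also have "\<dots> \<le> (\<Sum>n\<in>{1..m}. cmod s / (real n)\<^sup>2)"
      unfolding g_def using s by (intro sum_norm_le nat_powr_telescope) auto
    also have "\<dots> = cmod s * (\<Sum>n\<in>{1..m}. 1 / (real n)\<^sup>2)" by (simp add: sum_distrib_left)
    also have "\<dots> \<le> cmod s * 2" by (intro mult_left_mono sum_inverse_squares_le) auto
    finally show ?thesis by simp
  qed
  have "summable (\<lambda>n. of_nat n powr - s)" by (rule summable_norm_cancel[OF summable_nat_powr[OF s]])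
  then have lim1: "(\<lambda>m. \<Sum>n<Suc m. of_nat n powr - s) \<longlonglongrightarrow> (\<Sum>n. of_nat n powr - s)"
    by (intro LIMSEQ_Suc summable_LIMSEQ)
  have "(\<lambda>m. cmod (g (Suc m))) \<longlonglongrightarrow> 0"
  proof -
    have eq: "cmod (g n) = real n powr (1 - Re s)" for n
      unfolding g_def by (subst norm_powr_real_powr) auto
    have "(\<lambda>m. real m powr (1 - Re s)) \<longlonglongrightarrow> 0"
      using s by (intro tendsto_neg_powr filterlim_real_sequentially) auto
    then show ?thesis unfolding eq by (rule LIMSEQ_Suc)
  qed
  then have "(\<lambda>m. g (Suc m)) \<longlonglongrightarrow> 0" by (rule tendsto_norm_zero_cancel)
  then have "(\<lambda>m. (g (Suc m) - 1) / (1 - s)) \<longlonglongrightarrow> (0 - 1) / (1 - s)"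
    using s1 by (intro tendsto_intros) auto
  also have "(0 - 1) / (1 - s) = 1 / (s - 1)" using s1 by (simp add: field_simps)
  finally have "(\<lambda>m. cmod ((\<Sum>n<Suc m. of_nat n powr - s) - (g (Suc m) - 1) / (1 - s))) \<longlonglongrightarrow>
      cmod ((\<Sum>n. of_nat n powr - s) - 1 / (s - 1))"
    by (intro tendsto_norm tendsto_diff lim1)
  then show ?thesis using part by (intro LIMSEQ_le_const2) auto
qed

section \<open>Finite Euler products and sums over all primes\<close>

definition rough_set :: "nat set \<Rightarrow> nat set" where
  "rough_set Q = {n. n > 0 \<and> (\<forall>p\<in>Q. \<not> p dvd n)}"

lemma rough_set_insert:
  assumes "prime p" "p \<notin> Q" "\<And>r. r \<in> Q \<Longrightarrow> prime r"
  shows "rough_set Q = rough_set (insert p Q) \<union> (*) p ` rough_set Q"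
    and "rough_set (insert p Q) \<inter> (*) p ` rough_set Q = {}"
proof -
  have ndvd: "\<not> r dvd p" if "r \<in> Q" for r
    using that assms primes_dvd_imp_eq by blast
  show "rough_set Q = rough_set (insert p Q) \<union> (*) p ` rough_set Q"
  proof (intro equalityI subsetI)
    fix n assume n: "n \<in> rough_set Q"
    show "n \<in> rough_set (insert p Q) \<union> (*) p ` rough_set Q"
    proof (cases "p dvd n")
      case True
      then obtain m where m: "n = p * m" by blast
      then have "m \<in> rough_set Q" using n by (auto simp: rough_set_def)
      then show ?thesis using m by blast
    qed (use n in \<open>auto simp: rough_set_def\<close>)
  next
    fix n assume "n \<in> rough_set (insert p Q) \<union> (*) p ` rough_set Q"
    then show "n \<in> rough_set Q"
    proof
      assume "n \<in> (*) p ` rough_set Q"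
      then obtain m where m: "n = p * m" "m \<in> rough_set Q" by blast
      then show ?thesis using assms(1,3) ndvd
        by (auto simp: rough_set_def prime_dvd_mult_iff prime_gt_0_nat)
    qed (auto simp: rough_set_def)
  qed
qed (auto simp: rough_set_def)

text \<open>Sieving by one prime at a time: the multiples of \<open>p\<close> in
  \<open>rough_set Q\<close> are \<open>p\<close> times \<open>rough_set Q\<close>, so their removal
  multiplies the sum by \<open>1 - f p\<close>.\<close>

lemma euler_product_finite:
  assumes f: "completely_mult f" and sum: "summable (\<lambda>n. cmod (f n))"
    and Q: "finite Q" "\<And>p. p \<in> Q \<Longrightarrow> prime p"
  shows "infsum f (rough_set Q) = infsum f {0<..} * (\<Prod>p\<in>Q. 1 - f p)"
proof -
  have on: "f summable_on A" for A
    by (rule summable_on_subset_banach[OF norm_summable_imp_summable_on[OF sum]]) simp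
  show ?thesis using Q
  proof (induction Q rule: finite_induct)
    case empty
    have "rough_set {} = {0<..}" by (auto simp: rough_set_def)
    then show ?case by simp
  next
    case (insert p Q)
    have alg: "b = (1 - c) * a" if "a = b + c * a" for a b c :: complex
      unfolding left_diff_distrib mult_1 using that by (metis add_diff_cancel_right')
    have p: "prime p" using insert.prems by blast
    have R: "rough_set Q = rough_set (insert p Q) \<union> (*) p ` rough_set Q"
      "rough_set (insert p Q) \<inter> (*) p ` rough_set Q = {}"
      using rough_set_insert[OF p insert.hyps(2)] insert.prems by blast+
    have "infsum f (rough_set Q) = infsum f (rough_set (insert p Q)) + infsum f ((*) p ` rough_set Q)"
      using infsum_Un_disjoint[OF on on R(2)] by (simp only: R(1)[symmetric])
    also have "infsum f ((*) p ` rough_set Q) = infsum (f \<circ> (*) p) (rough_set Q)"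
      using p by (intro infsum_reindex) (auto simp: inj_on_def)
    also have "\<dots> = infsum (\<lambda>n. f p * f n) (rough_set Q)"
      using f by (intro infsum_cong) (auto simp: completely_mult_def)
    also have "\<dots> = f p * infsum f (rough_set Q)" by (rule infsum_cmult_right')
    finally have "infsum f (rough_set (insert p Q)) = (1 - f p) * infsum f (rough_set Q)" by (rule alg)
    moreover have "infsum f (rough_set Q) = infsum f {0<..} * (\<Prod>p\<in>Q. 1 - f p)"
    proof (rule insert.IH)
      fix r assume "r \<in> Q"
      then show "prime r" using insert.prems[of r] by blast
    qed
    ultimately show ?case by (simp only: prod.insert[OF insert.hyps] mult_ac)
  qed
qed

definition primes_le :: "nat \<Rightarrow> nat set" where
  "primes_le x = {p. prime p \<and> p \<le> x}"

lemma finite_primes_le [simp]: "finite (primes_le x)"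
  by (rule finite_subset[of _ "{..x}"]) (auto simp: primes_le_def)

text \<open>After sieving by all primes up to \<open>x\<close> only 1 and integers beyond
  \<open>x\<close> are left, so the error is bounded by a tail of an absolutely convergent series.
  Logarithms need the product only bounded away from 0 and from above, and 1/2 achieves
  this.\<close>

lemma eventually_euler_product:
  assumes f: "completely_mult f" "f 0 = 0" and sum: "summable (\<lambda>n. cmod (f n))"
  shows "eventually (\<lambda>x. cmod ((\<Sum>n. f n) * (\<Prod>p\<in>primes_le x. 1 - f p) - 1) \<le> 1 / 2) sequentially"
proof -
  have on: "f summable_on A" for A
    by (rule summable_on_subset_banach[OF norm_summable_imp_summable_on[OF sum]]) simp
  have on': "(\<lambda>n. cmod (f n)) summable_on A" for A
    using sum by (intro summable_on_subset_banach[OF norm_summable_imp_summable_on]) auto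
  define S where "S = infsum (\<lambda>n. cmod (f n)) UNIV"
  have "((\<lambda>n. cmod (f n)) has_sum S) UNIV" unfolding S_def by (rule has_sum_infsum[OF on'])
  then have "(\<lambda>n. cmod (f n)) sums S" by (rule has_sum_imp_sums)
  then have "(\<lambda>x. \<Sum>n<Suc x. cmod (f n)) \<longlonglongrightarrow> S" unfolding sums_def by (rule LIMSEQ_Suc)
  then have ev: "eventually (\<lambda>x. S - 1/2 < (\<Sum>n<Suc x. cmod (f n))) sequentially"
    by (rule order_tendstoD) simp
  have total: "(\<Sum>n. f n) = infsum f {0<..}"
  proof -
    have "(\<Sum>n. f n) = infsum f UNIV"
      by (rule sums_unique[OF has_sum_imp_sums[OF has_sum_infsum[OF on]], symmetric])
    also have "\<dots> = infsum f {0<..}" by (rule infsum_cong_neutral) (use f in auto)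
    finally show ?thesis .
  qed
  from ev show ?thesis
  proof eventually_elim
    case (elim x)
    let ?R = "rough_set (primes_le x)"
    have one: "1 \<in> ?R" by (auto simp: rough_set_def primes_le_def)
    have sub: "?R - {1} \<subseteq> {x<..}"
    proof
      fix n assume n: "n \<in> ?R - {1}"
      then obtain p where p: "prime p" "p dvd n" using prime_factor_nat[of n] by blast
      then have "\<not> p \<le> x" using n by (auto simp: rough_set_def primes_le_def)
      moreover have "p \<le> n" using p n by (intro dvd_imp_le) (auto simp: rough_set_def)
      ultimately show "n \<in> {x<..}" by auto
    qed
    have "(\<Sum>n. f n) * (\<Prod>p\<in>primes_le x. 1 - f p) = infsum f ?R"
      unfolding total
      by (rule euler_product_finite[OF f(1) sum, symmetric]) (auto simp: primes_le_def)
    also have "\<dots> = infsum f {1} + infsum f (?R - {1})"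
    proof -
      have "{1} \<union> (?R - {1}) = ?R" using one by blast
      moreover have "infsum f ({1} \<union> (?R - {1})) = infsum f {1} + infsum f (?R - {1})"
        by (rule infsum_Un_disjoint[OF on on]) simp
      ultimately show ?thesis by simp
    qed
    also have "infsum f {1} = 1" using f by (simp add: completely_mult_def)
    finally have "cmod ((\<Sum>n. f n) * (\<Prod>p\<in>primes_le x. 1 - f p) - 1) = cmod (infsum f (?R - {1}))"
      by simp
    also have "\<dots> \<le> infsum (\<lambda>n. cmod (f n)) (?R - {1})" by (rule norm_infsum_bound[OF on'])
    also have "\<dots> \<le> infsum (\<lambda>n. cmod (f n)) {x<..}"
      by (rule infsum_mono_neutral[OF on' on']) (use sub in auto)
    also have "\<dots> = S - (\<Sum>n<Suc x. cmod (f n))"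
    proof -
      have "S = infsum (\<lambda>n. cmod (f n)) ({..<Suc x} \<union> {x<..})"
        unfolding S_def by (intro arg_cong[of _ _ "infsum _"]) auto
      also have "\<dots> = infsum (\<lambda>n. cmod (f n)) {..<Suc x} + infsum (\<lambda>n. cmod (f n)) {x<..}"
        by (rule infsum_Un_disjoint[OF on' on']) auto
      finally show ?thesis by simp
    qed
    finally show ?case using elim by linarith
  qed
qed

text \<open>\<open>ln u \<le> u - 1\<close> at \<open>u = cmod (1 - w) ^ 2\<close> avoids branches
  of the complex logarithm.\<close>

lemma ln_norm_one_minus_le:
  assumes "w \<noteq> 1"
  shows "ln (cmod (1 - w)) \<le> - Re w + (cmod w)\<^sup>2 / 2"
proof -
  have pos: "cmod (1 - w) > 0" using assms by simp
  have "2 * ln (cmod (1 - w)) = ln ((cmod (1 - w))\<^sup>2)" using pos by (simp add: ln_realpow)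
  also have "\<dots> \<le> (cmod (1 - w))\<^sup>2 - 1" using pos by (intro ln_le_minus_one) simp
  also have "(cmod (1 - w))\<^sup>2 = 1 - 2 * Re w + (cmod w)\<^sup>2"
    unfolding cmod_power2 by (simp add: power2_eq_square algebra_simps)
  finally show ?thesis by simp
qed

lemma sum_prime_inverse_squares_le:
  assumes "finite Q" "\<And>p. p \<in> Q \<Longrightarrow> prime (p::nat)"
  shows "(\<Sum>p\<in>Q. 1 / (real p)\<^sup>2) \<le> 1"
proof -
  define m where "m = Max (insert 1 Q)"
  have "Q \<subseteq> {2..m}"
  proof
    fix p assume "p \<in> Q"
    then show "p \<in> {2..m}" using assms prime_ge_2_nat[of p] by (simp add: m_def)
  qed
  then have "(\<Sum>p\<in>Q. 1 / (real p)\<^sup>2) \<le> (\<Sum>p\<in>{2..m}. 1 / (real p)\<^sup>2)" by (intro sum_mono2) auto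
  also have "\<dots> = (\<Sum>p\<in>{1..m}. 1 / (real p)\<^sup>2) - 1"
  proof -
    have "m \<ge> 1" unfolding m_def using assms(1) by (intro Max_ge) auto
    then have "{1..m} = insert 1 {2..m}" by auto
    then show ?thesis by simp
  qed
  also have "\<dots> \<le> 1" using sum_inverse_squares_le[of m] by simp
  finally show ?thesis .
qed

text \<open>The series may start at 0 because \<open>0 powr z = 0\<close>.\<close>

definition zeta_series :: "complex \<Rightarrow> complex" where
  "zeta_series s = (\<Sum>n. of_nat n powr - s)"

lemma eventually_euler_product_zeta:
  assumes "Re s > 1"
  shows "eventually (\<lambda>x. 1 / 2 \<le> cmod (zeta_series s) * (\<Prod>p\<in>primes_le x. cmod (1 - of_nat p powr - s)) \<and>
            cmod (zeta_series s) * (\<Prod>p\<in>primes_le x. cmod (1 - of_nat p powr - s)) \<le> 3 / 2) sequentially"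
proof -
  have "eventually (\<lambda>x. cmod (zeta_series s * (\<Prod>p\<in>primes_le x. 1 - of_nat p powr - s) - 1) \<le> 1 / 2) sequentially"
    unfolding zeta_series_def
    by (rule eventually_euler_product[OF completely_mult_powr _ summable_nat_powr[OF assms]]) simp
  then show ?thesis
  proof eventually_elim
    case (elim x)
    define w where "w = zeta_series s * (\<Prod>p\<in>primes_le x. 1 - of_nat p powr - s)"
    have "cmod (w - 1) \<le> 1 / 2" using elim by (simp add: w_def)
    then have "1 / 2 \<le> cmod w" "cmod w \<le> 3 / 2"
      using norm_triangle_ineq2[of 1 w] norm_triangle_ineq2[of w 1] by (auto simp: norm_minus_commute)
    moreover have "cmod w = cmod (zeta_series s) * (\<Prod>p\<in>primes_le x. cmod (1 - of_nat p powr - s))"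
      by (simp add: w_def norm_mult prod_norm)
    ultimately show ?case by simp
  qed
qed

text \<open>Logarithm of the lower bound 1/2 for zeta times the finite product. The summand 1/2 is
  half the bound 1 for the sum of \<open>1 / p ^ 2\<close>, which takes care of the quadratic
  terms.\<close>

lemma eventually_prime_sum_le:
  assumes s: "Re s > 1"
  shows "eventually (\<lambda>x. (\<Sum>p\<in>primes_le x. Re (of_nat p powr - s)) \<le> ln (2 * cmod (zeta_series s)) + 1 / 2) sequentially"
  using eventually_euler_product_zeta[OF s]
proof eventually_elim
  case (elim x)
  define Z where "Z = cmod (zeta_series s)"
  define E where "E = (\<Prod>p\<in>primes_le x. cmod (1 - of_nat p powr - s))"
  have ZE: "1 / 2 \<le> Z * E" using elim by (simp add: Z_def E_def)
  have Z: "Z > 0" using ZE by (cases "Z = 0") (auto simp: Z_def)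
  have E: "E \<noteq> 0" using ZE by auto
  have w: "of_nat p powr - s \<noteq> 1" if "p \<in> primes_le x" for p
    using E that by (auto simp: E_def)
  then have E0: "E > 0" unfolding E_def by (intro prod_pos) auto
  have "1 / (2 * Z) \<le> E" using ZE Z by (simp add: field_simps)
  then have "ln (1 / (2 * Z)) \<le> ln E" using Z E0 by (subst ln_le_cancel_iff) auto
  then have "- ln (2 * Z) \<le> ln E" using Z by (simp add: ln_div)
  also have "ln E = (\<Sum>p\<in>primes_le x. ln (cmod (1 - of_nat p powr - s)))"
    unfolding E_def using w by (intro ln_prod) auto
  also have "\<dots> \<le> (\<Sum>p\<in>primes_le x. - Re (of_nat p powr - s) + 1 / (real p)\<^sup>2 * (1 / 2))"
  proof (rule sum_mono)
    fix p assume p: "p \<in> primes_le x"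
    then have p1: "real p \<ge> 1" using prime_ge_1_nat by (auto simp: primes_le_def)
    have "cmod (of_nat p powr - s) \<le> real p powr - 1"
      unfolding norm_nat_powr using p1 s by (intro powr_mono) auto
    also have "\<dots> = 1 / real p" using p1 by (simp add: powr_minus_divide)
    finally have "(cmod (of_nat p powr - s))\<^sup>2 \<le> (1 / real p)\<^sup>2" by (intro power_mono) auto
    then show "ln (cmod (1 - of_nat p powr - s)) \<le> - Re (of_nat p powr - s) + 1 / (real p)\<^sup>2 * (1 / 2)"
      using ln_norm_one_minus_le[OF w[OF p]] by (simp add: power_divide)
  qed
  also have "\<dots> = - (\<Sum>p\<in>primes_le x. Re (of_nat p powr - s)) + (\<Sum>p\<in>primes_le x. 1 / (real p)\<^sup>2) * (1 / 2)"
    by (simp only: sum.distrib sum_negf sum_distrib_right)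
  also have "(\<Sum>p\<in>primes_le x. 1 / (real p)\<^sup>2) \<le> 1"
    by (rule sum_prime_inverse_squares_le) (auto simp: primes_le_def)
  finally show ?case by (simp add: Z_def)
qed

text \<open>The reverse inequality at a real point, where the Euler factors are real and
  \<open>ln (1 - u) \<ge> - u - 2 * u ^ 2\<close> applies; this gives the 2. The second conclusion
  is for points that are not close to the pole, where \<open>zeta_pole_bound\<close> gives no lower
  bound.\<close>

lemma eventually_prime_sum_ge:
  assumes \<sigma>: "\<sigma> > 1"
  shows "eventually (\<lambda>x. ln (2 / 3 * cmod (zeta_series (of_real \<sigma>))) - 2 \<le> (\<Sum>p\<in>primes_le x. real p powr - \<sigma>) \<and>
           1 / 2 \<le> cmod (zeta_series (of_real \<sigma>))) sequentially"
proof -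
  have "Re (complex_of_real \<sigma>) > 1" using \<sigma> by simp
  from eventually_euler_product_zeta[OF this] show ?thesis
  proof eventually_elim
    case (elim x)
    define Z where "Z = cmod (zeta_series (of_real \<sigma>))"
    define u where "u p = real p powr - \<sigma>" for p :: nat
    have u: "0 < u p" "u p \<le> 1 / real p" "u p \<le> 1 / 2" if "p \<in> primes_le x" for p
    proof -
      have p: "real p \<ge> 2" using that prime_ge_2_nat by (auto simp: primes_le_def)
      then show "0 < u p" by (simp add: u_def)
      have "u p \<le> real p powr - 1" unfolding u_def using p \<sigma> by (intro powr_mono) auto
      also have "\<dots> = 1 / real p" using p by (simp add: powr_minus_divide)
      finally show "u p \<le> 1 / real p" .
      also have "\<dots> \<le> 1 / 2" using p by (intro divide_left_mono) auto
      finally show "u p \<le> 1 / 2" .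
    qed
    have abs: "cmod (1 - of_nat p powr - complex_of_real \<sigma>) = 1 - u p" if p: "p \<in> primes_le x" for p
    proof -
      have "of_nat p powr - complex_of_real \<sigma> = of_real (u p)"
        unfolding u_def using powr_of_real[of "real p" "- \<sigma>"] by simp
      then have "1 - of_nat p powr - complex_of_real \<sigma> = of_real (1 - u p)" by simp
      then show ?thesis using u[OF p] by (simp only: norm_of_real)
    qed
    define E where "E = (\<Prod>p\<in>primes_le x. 1 - u p)"
    have "E = (\<Prod>p\<in>primes_le x. cmod (1 - of_nat p powr - complex_of_real \<sigma>))"
      unfolding E_def using abs by (intro prod.cong) auto
    then have ZE: "1 / 2 \<le> Z * E" "Z * E \<le> 3 / 2" using elim by (simp_all add: Z_def)
    have E0: "E > 0" unfolding E_def using u by (intro prod_pos) force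
    have E1: "E \<le> 1" unfolding E_def using u by (intro prod_le_1) force
    have Z0: "Z \<ge> 0" by (simp add: Z_def)
    have Z: "1 / 2 \<le> Z" using ZE(1) mult_left_le[OF E1 Z0] by linarith
    have "E \<le> 1 / (2 / 3 * Z)" using ZE(2) Z by (simp add: field_simps)
    then have "ln E \<le> ln (1 / (2 / 3 * Z))" using Z E0 by (subst ln_le_cancel_iff) auto
    also have "\<dots> = - ln (2 / 3 * Z)" using Z by (subst ln_div) auto
    finally have "ln (2 / 3 * Z) \<le> - ln E" by simp
    also have "ln E = (\<Sum>p\<in>primes_le x. ln (1 - u p))"
      unfolding E_def using u by (intro ln_prod) force+
    also have "- \<dots> \<le> (\<Sum>p\<in>primes_le x. u p + 1 / (real p)\<^sup>2 * 2)"
      unfolding sum_negf[symmetric]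
    proof (rule sum_mono)
      fix p assume p: "p \<in> primes_le x"
      have "- u p - 2 * (u p)\<^sup>2 \<le> ln (1 - u p)"
        using u[OF p] by (intro ln_one_minus_pos_lower_bound) auto
      moreover have "(u p)\<^sup>2 \<le> (1 / real p)\<^sup>2" using u[OF p] by (intro power_mono) auto
      ultimately show "- ln (1 - u p) \<le> u p + 1 / (real p)\<^sup>2 * 2" by (simp add: power_divide)
    qed
    also have "\<dots> = (\<Sum>p\<in>primes_le x. u p) + (\<Sum>p\<in>primes_le x. 1 / (real p)\<^sup>2) * 2"
      by (simp only: sum.distrib sum_distrib_right)
    also have "(\<Sum>p\<in>primes_le x. 1 / (real p)\<^sup>2) \<le> 1"
      by (rule sum_prime_inverse_squares_le) (auto simp: primes_le_def)
    finally show ?case using Z by (simp add: Z_def u_def)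
  qed
qed

section \<open>Prime sums over the blocks\<close>

text \<open>The prime 2 stands alone because block 0 only begins above
  \<open>2 ^ 2 ^ 0 = 2\<close>.\<close>

lemma sum_primes_le_split:
  fixes g :: "nat \<Rightarrow> real"
  assumes "2 ^ 2 ^ J \<le> x"
  shows "(\<Sum>p\<in>primes_le x. g p) =
           g 2 + (\<Sum>i<J. \<Sum>p\<in>prime_block i. g p) + (\<Sum>p | p \<in> primes_le x \<and> 2 ^ 2 ^ J < p. g p)"
  using assms
proof (induction J)
  case 0
  have "primes_le x = insert 2 {p. p \<in> primes_le x \<and> 2 < p}"
    using 0 by (auto simp: primes_le_def dest: prime_ge_2_nat intro: le_neq_trans)
  moreover have "finite {p. p \<in> primes_le x \<and> 2 < p}" by simp
  ultimately have "(\<Sum>p\<in>primes_le x. g p) = g 2 + (\<Sum>p | p \<in> primes_le x \<and> 2 < p. g p)"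
    by (metis (no_types, lifting) less_irrefl mem_Collect_eq sum.insert)
  then show ?case by simp
next
  case (Suc J)
  have le: "(2::nat) ^ 2 ^ J \<le> 2 ^ 2 ^ Suc J" by (intro power_increasing) auto
  have "{p. p \<in> primes_le x \<and> 2 ^ 2 ^ J < p} = prime_block J \<union> {p. p \<in> primes_le x \<and> 2 ^ 2 ^ Suc J < p}"
    using Suc.prems le order.strict_trans1[OF le] by (auto simp: primes_le_def prime_block_def simp del: power_Suc)
  moreover have "prime_block J \<inter> {p. p \<in> primes_le x \<and> 2 ^ 2 ^ Suc J < p} = {}"
    by (auto simp: prime_block_def simp del: power_Suc)
  moreover have "finite {p. p \<in> primes_le x \<and> 2 ^ 2 ^ Suc J < p}" by simp
  ultimately have "(\<Sum>p | p \<in> primes_le x \<and> 2 ^ 2 ^ J < p. g p) =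
      (\<Sum>p\<in>prime_block J. g p) + (\<Sum>p | p \<in> primes_le x \<and> 2 ^ 2 ^ Suc J < p. g p)"
    by (metis (no_types, lifting) finite_prime_block sum.union_disjoint)
  then show ?case using Suc.IH Suc.prems le by simp
qed

text \<open>Both sums are compared with sums over all primes at real part
  \<open>1 + \<delta>\<close>, \<open>\<delta> = 1 / 2 ^ J\<close>, where the primes beyond the
  blocks contribute O(1). The first sum is then at least log zeta(1 + \<delta>), that is log
  (1/\<delta>), up to O(1). For the second, log |zeta(1 + \<delta> + i h)| with
  \<open>h = m * \<delta>\<close> is subtracted; by the pole it is at most log (1/h) + O(1) for
  \<open>h \<le> 2\<close>, and \<open>h / \<delta> = m\<close>.\<close>

lemma sum_prime_blocks_inverse_ge:
  "(\<Sum>i<J. \<Sum>p\<in>prime_block i. 1 / real p) \<ge> real J * ln 2 - (ln 24 + 5)"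
  and sum_prime_blocks_cos_ge:
  "\<And>m. 1 \<le> m \<Longrightarrow> m \<le> 2 * 2 ^ J \<Longrightarrow>
     (\<Sum>i<J. \<Sum>p\<in>prime_block i. (1 - cos (real m / 2 ^ J * ln (real p))) / real p) \<ge> ln (real m) - (ln 816 + 8)"
proof -
  define \<delta> :: real where "\<delta> = 1 / 2 ^ J"
  have \<delta>: "0 < \<delta>" "\<delta> \<le> 1" by (simp_all add: \<delta>_def)
  define Z where "Z = cmod (zeta_series (of_real (1 + \<delta>)))"
  define u where "u p = real p powr - (1 + \<delta>)" for p :: nat
  have ev0: "eventually (\<lambda>x. ln (2 / 3 * Z) - 2 \<le> (\<Sum>p\<in>primes_le x. u p) \<and> 1 / 2 \<le> Z) sequentially"
    unfolding Z_def u_def using eventually_prime_sum_ge[of "1 + \<delta>"] \<delta> by simp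
  then have "1 / 2 \<le> Z" using eventually_happens'[OF sequentially_bot] by blast
  moreover have "1 / \<delta> - 4 \<le> Z"
  proof -
    have "cmod (zeta_series (of_real (1 + \<delta>)) - 1 / (of_real (1 + \<delta>) - 1)) \<le> 2 * cmod (of_real (1 + \<delta>))"
      unfolding zeta_series_def using \<delta> by (intro zeta_pole_bound) auto
    also have "\<dots> = 2 * (1 + \<delta>)" unfolding norm_of_real using \<delta> by simp
    also have "\<dots> \<le> 4" using \<delta> by simp
    finally have "cmod (1 / complex_of_real \<delta>) - Z \<le> 4"
      using norm_triangle_ineq2[of "1 / complex_of_real \<delta>" "zeta_series (of_real (1 + \<delta>))"]
      by (simp add: Z_def norm_minus_commute)
    then show ?thesis using \<delta> by (simp add: norm_divide)
  qed
  \<comment> \<open>The pole bound is useful for small \<open>\<delta>\<close> only; for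
    \<open>\<delta> > 1 / 8\<close> the absolute bound 1/2 suffices.\<close>
  ultimately have Zd: "1 / (16 * \<delta>) \<le> Z"
  proof (cases "\<delta> \<le> 1 / 8")
    case True
    assume "1 / \<delta> - 4 \<le> Z"
    moreover have "1 / (16 * \<delta>) \<le> 1 / \<delta> - 4" using True \<delta> by (simp add: field_simps)
    ultimately show ?thesis by linarith
  next
    case False
    assume "1 / 2 \<le> Z"
    moreover have "1 / (16 * \<delta>) \<le> 1 / 2" using False \<delta> by (simp add: field_simps)
    ultimately show ?thesis by linarith
  qed
  have low: "eventually (\<lambda>x. ln (1 / (24 * \<delta>)) - 2 \<le> (\<Sum>p\<in>primes_le x. u p)) sequentially"
    using ev0
  proof eventually_elim
    case (elim x)
    have "ln (1 / (24 * \<delta>)) \<le> ln (2 / 3 * Z)"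
      using Zd \<delta> elim by (subst ln_le_cancel_iff) auto
    then show ?case using elim by linarith
  qed
  have lnd: "ln (1 / (24 * \<delta>)) = real J * ln 2 - ln 24"
    by (simp add: \<delta>_def ln_div ln_mult ln_realpow)
  have tail: "(\<Sum>p | p \<in> primes_le x \<and> 2 ^ 2 ^ J < p. u p) \<le> 2" for x
    unfolding u_def \<delta>_def by (rule sum_prime_powr_tail_le) (auto simp: primes_le_def)
  have up: "u p \<le> 1 / real p" "u p \<ge> 0" if "p \<ge> 1" for p
  proof -
    have "u p \<le> real p powr - 1" unfolding u_def using that \<delta> by (intro powr_mono) auto
    also have "\<dots> = 1 / real p" using that by (simp add: powr_minus_divide)
    finally show "u p \<le> 1 / real p" .
  qed (simp add: u_def)
  have block1: "p \<ge> 1" if "p \<in> prime_block i" for p i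
    using that prime_ge_1_nat by (auto simp: prime_block_def)
  have u2: "u 2 \<le> 1 / 2" using up(1)[of 2] by simp
  show "(\<Sum>i<J. \<Sum>p\<in>prime_block i. 1 / real p) \<ge> real J * ln 2 - (ln 24 + 5)"
  proof -
    obtain x where x: "ln (1 / (24 * \<delta>)) - 2 \<le> (\<Sum>p\<in>primes_le x. u p)" "2 ^ 2 ^ J \<le> x"
      using eventually_happens'[OF sequentially_bot eventually_conj[OF low eventually_ge_at_top[of "2 ^ 2 ^ J"]]] by blast
    have "(\<Sum>p\<in>primes_le x. u p) \<le> 1 / 2 + (\<Sum>i<J. \<Sum>p\<in>prime_block i. u p) + 2"
      unfolding sum_primes_le_split[OF x(2)] using u2 tail[of x] by linarith
    also have "(\<Sum>i<J. \<Sum>p\<in>prime_block i. u p) \<le> (\<Sum>i<J. \<Sum>p\<in>prime_block i. 1 / real p)"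
      using up block1 by (intro sum_mono) auto
    finally show ?thesis using x(1) lnd by linarith
  qed
  fix m :: nat
  assume m: "1 \<le> m" "m \<le> 2 * 2 ^ J"
  define h where "h = real m / 2 ^ J"
  have h: "0 < h" "h \<le> 2"
  proof -
    have "real m \<le> real (2 * 2 ^ J)" using m(2) by (simp only: of_nat_le_iff)
    then show "0 < h" "h \<le> 2" using m(1) by (simp_all add: h_def field_simps)
  qed
  define s where "s = Complex (1 + \<delta>) h"
  have s: "Re s = 1 + \<delta>" "Im s = h" by (simp_all add: s_def)
  have "cmod (zeta_series s) \<le> 17 / h"
  proof -
    have "cmod (s - 1) \<ge> h" using abs_Im_le_cmod[of "s - 1"] h s by simp
    then have "cmod (1 / (s - 1)) \<le> 1 / h" using h by (simp add: norm_divide frac_le)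
    moreover have "cmod (zeta_series s - 1 / (s - 1)) \<le> 2 * cmod s"
      unfolding zeta_series_def using \<delta> s by (intro zeta_pole_bound) auto
    moreover have "cmod s \<le> 4" using cmod_le[of s] s h \<delta> by simp
    ultimately have "cmod (zeta_series s) \<le> 1 / h + 8"
      using norm_triangle_ineq2[of "zeta_series s" "1 / (s - 1)"] by linarith
    also have "\<dots> \<le> 17 / h" using h by (simp add: field_simps)
    finally show ?thesis .
  qed
  have "eventually (\<lambda>x. (\<Sum>p\<in>primes_le x. Re (of_nat p powr - s)) \<le> ln (34 / h) + 1 / 2 \<and>
      ln (1 / (24 * \<delta>)) - 2 \<le> (\<Sum>p\<in>primes_le x. u p) \<and> 2 ^ 2 ^ J \<le> x) sequentially"
  proof -
    have "eventually (\<lambda>x. 1 / 2 \<le> cmod (zeta_series s) * (\<Prod>p\<in>primes_le x. cmod (1 - of_nat p powr - s))) sequentially"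
      using eventually_euler_product_zeta[of s] s \<delta> by (auto elim: eventually_mono)
    then have "zeta_series s \<noteq> 0"
      using eventually_happens'[OF sequentially_bot] by fastforce
    then have "ln (2 * cmod (zeta_series s)) \<le> ln (34 / h)"
      using \<open>cmod (zeta_series s) \<le> 17 / h\<close> h by (subst ln_le_cancel_iff) auto
    then have "eventually (\<lambda>x. (\<Sum>p\<in>primes_le x. Re (of_nat p powr - s)) \<le> ln (34 / h) + 1 / 2) sequentially"
      using eventually_prime_sum_le[of s] s \<delta> by (auto elim: eventually_mono)
    then show ?thesis by (intro eventually_conj low eventually_ge_at_top)
  qed
  then obtain x where x: "(\<Sum>p\<in>primes_le x. Re (of_nat p powr - s)) \<le> ln (34 / h) + 1 / 2"
      "ln (1 / (24 * \<delta>)) - 2 \<le> (\<Sum>p\<in>primes_le x. u p)" "2 ^ 2 ^ J \<le> x"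
    using eventually_happens'[OF sequentially_bot] by blast
  define c where "c p = 1 - cos (h * ln (real p))" for p :: nat
  have c: "0 \<le> c p" "c p \<le> 2" for p
    using cos_le_one[of "h * ln (real p)"] cos_ge_minus_one[of "h * ln (real p)"] by (auto simp: c_def simp del: cos_le_one cos_ge_minus_one)
  have Re: "Re (of_nat p powr - s) = u p * cos (h * ln (real p))" if "p \<ge> 1" for p :: nat
  proof -
    have "of_nat p powr - s = exp (- s * of_real (ln (real p)))"
      using that Ln_of_real[of "real p"] by (simp add: powr_def)
    then show ?thesis
      using that by (simp add: Re_exp s u_def powr_def algebra_simps)
  qed
  \<comment> \<open>816 = 24 * 34: 24 stems from the lower bound for zeta at
    \<open>1 + \<delta>\<close>, 34 is twice the 17 of the upper bound at \<open>s\<close>.\<close>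
  have "ln (h / \<delta>) - ln 816 - 5 / 2 = (ln (1 / (24 * \<delta>)) - 2) - (ln (34 / h) + 1 / 2)"
  proof -
    have "ln (816::real) = ln 24 + ln 34" by (simp flip: ln_mult_pos)
    then show ?thesis using h \<delta> by (simp add: ln_div ln_mult)
  qed
  also have "\<dots> \<le> (\<Sum>p\<in>primes_le x. u p) - (\<Sum>p\<in>primes_le x. Re (of_nat p powr - s))"
    using x by linarith
  also have "\<dots> = (\<Sum>p\<in>primes_le x. u p * c p)"
    unfolding sum_subtractf[symmetric]
    by (intro sum.cong refl) (use prime_ge_1_nat in \<open>auto simp: Re c_def algebra_simps primes_le_def\<close>)
  \<comment> \<open>The prime 2 costs at most 1 and the tail at most 2 * 2. Together with the 5/2
    above this stays below the 8 of the statement.\<close>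
  also have "\<dots> \<le> 1 + (\<Sum>i<J. \<Sum>p\<in>prime_block i. c p / real p) + 4"
    unfolding sum_primes_le_split[OF x(3)]
  proof (intro add_mono)
    have "u 2 * c 2 \<le> 1 / 2 * 2" using u2 c up(2)[of 2] by (intro mult_mono) auto
    then show "u 2 * c 2 \<le> 1" by simp
    show "(\<Sum>i<J. \<Sum>p\<in>prime_block i. u p * c p) \<le> (\<Sum>i<J. \<Sum>p\<in>prime_block i. c p / real p)"
    proof (intro sum_mono)
      fix i p assume "p \<in> prime_block i"
      then have "u p * c p \<le> 1 / real p * c p" using up[OF block1] c by (intro mult_right_mono) auto
      then show "u p * c p \<le> c p / real p" by simp
    qed
    have "(\<Sum>p | p \<in> primes_le x \<and> 2 ^ 2 ^ J < p. u p * c p) \<le> (\<Sum>p | p \<in> primes_le x \<and> 2 ^ 2 ^ J < p. u p * 2)"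
      using c by (intro sum_mono mult_left_mono) (auto simp: u_def)
    also have "\<dots> \<le> 2 * 2" unfolding sum_distrib_right[symmetric] using tail by (intro mult_right_mono) auto
    finally show "(\<Sum>p | p \<in> primes_le x \<and> 2 ^ 2 ^ J < p. u p * c p) \<le> 4" by simp
  qed
  also have "h / \<delta> = real m" by (simp add: h_def \<delta>_def)
  finally show "(\<Sum>i<J. \<Sum>p\<in>prime_block i. (1 - cos (real m / 2 ^ J * ln (real p))) / real p) \<ge> ln (real m) - (ln 816 + 8)"
    unfolding c_def h_def by linarith
qed

subsection \<open>The resonator and its majorant\<close>

text \<open>This is n^(-1/2 - i t), with modulus and phase kept apart.\<close>

definition npow :: "real \<Rightarrow> nat \<Rightarrow> complex" where
  "npow t n = of_real (real n powr - (1 / 2)) * cis (- t * ln (real n))"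

lemma completely_mult_npow:
  assumes "completely_mult f" and f0: "f 0 = 0"
  shows "completely_mult (\<lambda>n. npow t n * f n)"
  unfolding completely_mult_def
proof (intro conjI allI)
  show "npow t 1 * f 1 = 1" using assms by (simp add: npow_def completely_mult_def)
  fix m n
  show "npow t (m * n) * f (m * n) = npow t m * f m * (npow t n * f n)"
  proof (cases "m = 0 \<or> n = 0")
    case False
    then show ?thesis using assms
      by (simp add: npow_def completely_mult_def powr_mult ln_mult cis_mult algebra_simps)
  qed (auto simp: f0)
qed

definition block_form :: "nat \<Rightarrow> real \<Rightarrow> (nat \<Rightarrow> complex) \<Rightarrow> complex" where
  "block_form i t f = linear_form (prime_block i) (npow t) f"

definition resonator :: "real \<Rightarrow> nat \<Rightarrow> nat \<Rightarrow> real \<Rightarrow> (nat \<Rightarrow> complex) \<Rightarrow> complex" where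
  "resonator \<kappa> M J t f = (\<Prod>i<J. trunc_exp (M * (J - i)) (of_real \<kappa> * block_form i t f))"

text \<open>Blockwise the right-hand side of \<open>trunc_exp_powr_le\<close>. Unlike the power of
  the resonator that it bounds, it expands into squared moduli of Dirichlet polynomials, so
  orthogonality applies.\<close>

definition majorant :: "real \<Rightarrow> nat \<Rightarrow> nat \<Rightarrow> real \<Rightarrow> (nat \<Rightarrow> complex) \<Rightarrow> real" where
  "majorant \<kappa> M J t f =
     (\<Prod>i<J. (1 + 4 * exp (- real (M * (J - i)))) * (cmod (trunc_exp (M * (J - i)) (block_form i t f)))\<^sup>2
        + (120 * \<kappa> * cmod (block_form i t f) / real (M * (J - i))) ^ (2 * (M * (J - i))))"

lemma resonator_powr_le_majorant:
  assumes "\<kappa> \<ge> 1" "M \<ge> 1"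
  shows "cmod (resonator \<kappa> M J t f) powr (2 / \<kappa>) \<le> majorant \<kappa> M J t f"
proof -
  have "cmod (resonator \<kappa> M J t f) powr (2 / \<kappa>) =
      (\<Prod>i<J. cmod (trunc_exp (M * (J - i)) (of_real \<kappa> * block_form i t f)) powr (2 / \<kappa>))"
    unfolding resonator_def prod_norm[symmetric] by (rule prod_powr_distrib)
  also have "\<dots> \<le> majorant \<kappa> M J t f"
    unfolding majorant_def using assms by (intro prod_mono conjI trunc_exp_powr_le) auto
  finally show ?thesis .
qed

lemma prime_block_disjoint:
  assumes "i \<noteq> j"
  shows "prime_block i \<inter> prime_block j = {}"
proof -
  have *: "prime_block i \<inter> prime_block j = {}" if "i < j" for i j
  proof -
    have "(2::nat) ^ 2 ^ Suc i \<le> 2 ^ 2 ^ j" using that by (intro power_increasing) auto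
    then have "\<not> 2 ^ 2 ^ j < p" if "p \<le> 2 ^ 2 ^ Suc i" for p :: nat using that by linarith
    then show ?thesis unfolding prime_block_def by blast
  qed
  show ?thesis using assms *[of i j] *[of j i] by (cases i j rule: linorder_cases) auto
qed

text \<open>Controls the binary logarithm of the length of the resonator: block \<open>i\<close> has
  primes up to \<open>2 ^ 2 ^ Suc i\<close> and degree proportional to \<open>J - i\<close>. The
  induction runs on the exact value \<open>2 * 2 ^ J - J - 2\<close>.\<close>

lemma sum_pow2_weights_le: "(\<Sum>i<J. 2 ^ i * (J - i)) \<le> (2::nat) * 2 ^ J"
proof -
  have "(\<Sum>i<J. 2 ^ i * (J - i)) + J + 2 = (2::nat) * 2 ^ J"
  proof (induction J)
    case (Suc J)
    have "(\<Sum>i<Suc J. 2 ^ i * (Suc J - i)) = (\<Sum>i<Suc J. 2 ^ i * (J - i) + (2::nat) ^ i)"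
      by (intro sum.cong refl) (auto simp: Suc_diff_le)
    also have "\<dots> = (\<Sum>i<J. 2 ^ i * (J - i)) + (\<Sum>i<Suc J. 2 ^ i)"
      by (simp add: sum.distrib)
    also have "(\<Sum>i<Suc J. (2::nat) ^ i) + 1 = 2 ^ Suc J"
      by (induction J) auto
    then have "(\<Sum>i<Suc J. (2::nat) ^ i) = 2 ^ Suc J - 1" by simp
    finally show ?case using Suc by simp
  qed simp
  then show ?thesis by linarith
qed

text \<open>Makes the product over the blocks of all truncation errors
  \<open>1 + O(exp (- M * (J - i)))\<close> bounded uniformly in \<open>J\<close>.\<close>

lemma sum_exp_weights_le:
  assumes "M \<ge> 1"
  shows "(\<Sum>i<J. exp (- real (M * (J - i)))) \<le> 1"
proof -
  have "(\<Sum>i<J. exp (- real (M * (J - i)))) \<le> (\<Sum>i<J. (1/2) ^ (J - i))"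
  proof (rule sum_mono)
    fix i assume "i \<in> {..<J}"
    have "real (J - i) \<le> real (M * (J - i))" using assms by (metis mult_le_mono1 mult_1 of_nat_le_iff)
    then have "exp (- real (M * (J - i))) \<le> exp (- real (J - i))" by simp
    also have "\<dots> = exp (- 1) ^ (J - i)" by (simp add: exp_of_nat_mult[symmetric])
    also have "\<dots> \<le> (1/2) ^ (J - i)"
      using exp_ge_add_one_self[of 1] by (intro power_mono) (auto simp: exp_minus field_simps)
    finally show "exp (- real (M * (J - i))) \<le> (1/2) ^ (J - i)" .
  qed
  also have "\<dots> \<le> 1"
  proof -
    have "(\<Sum>i<J. (1/2) ^ (J - i)) = 1 - (1/2::real) ^ J"
    proof (induction J)
      case (Suc J)
      have "(\<Sum>i<Suc J. (1/2::real) ^ (Suc J - i)) = (\<Sum>i<Suc J. (1/2) * (1/2) ^ (J - i))"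
        by (intro sum.cong refl) (auto simp: Suc_diff_le)
      also have "\<dots> = (1/2) * (\<Sum>i<Suc J. (1/2) ^ (J - i))" by (rule sum_distrib_left[symmetric])
      also have "\<dots> = 1 - (1/2) ^ Suc J" using Suc by (simp add: field_simps)
      finally show ?case .
    qed simp
    then show ?thesis by simp
  qed
  finally show ?thesis .
qed

lemma norm_npow_square:
  assumes "p \<ge> 1"
  shows "(cmod (npow t p))\<^sup>2 = 1 / real p"
proof -
  have "(real p powr - (1 / 2))\<^sup>2 = real p powr - 1"
    unfolding power2_eq_square powr_add[symmetric] by simp
  then show ?thesis using assms
    by (simp only: npow_def norm_mult norm_of_real norm_cis mult_1_right power2_abs) (simp add: powr_minus_divide)
qed

lemma sum_norm_npow_block_le:
  "(\<Sum>p\<in>prime_block i. (cmod (npow t p))\<^sup>2) \<le> 2"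
proof -
  have "(cmod (npow t p))\<^sup>2 = 1 / real p" if "p \<in> prime_block i" for p
    using that prime_ge_1_nat by (intro norm_npow_square) (auto simp: prime_block_def)
  then show ?thesis using sum_prime_block_le[of i] by simp
qed

lemma char_avg_sum: "char_avg q (\<lambda>\<xi>. \<Sum>i\<in>I. F i \<xi>) = (\<Sum>i\<in>I. char_avg q (F i))"
  unfolding char_avg_def by (subst sum.swap) (simp add: sum_divide_distrib)

lemma char_avg_mono:
  fixes F G :: "(int \<Rightarrow> complex) \<Rightarrow> real"
  assumes "\<And>\<xi>. dirichlet_character q \<xi> \<Longrightarrow> F \<xi> \<le> G \<xi>"
  shows "char_avg q F \<le> char_avg q G"
  unfolding char_avg_def using assms by (intro divide_right_mono sum_mono) auto

text \<open>Each block contributes a sum of two squares. The product is expanded over the subsets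
  \<open>S\<close> of blocks on which the first one, \<open>X\<close>, is chosen;
  \<open>char_avg_prod_le\<close> applies to every choice, and the bounds recombine to a product.
  The constants are those of the coefficient lemmas at \<open>s = 2\<close>, the bound for the mass
  of a block.\<close>

lemma char_avg_resonator_majorant_le_prod:
  fixes \<kappa> t u :: real and M J q :: nat
  defines "N \<equiv> \<lambda>i. M * (J - i)"
  assumes q: "prime q" "2 ^ (8 * M * 2 ^ J) < q" and \<kappa>: "\<kappa> \<ge> 1"
    and M: "M \<ge> 1" "real M \<ge> 172800 * \<kappa>\<^sup>2"
  shows "char_avg q (\<lambda>\<xi>. (cmod (resonator \<kappa> M J t (\<lambda>n. \<xi> (int n))))\<^sup>2 * majorant \<kappa> M J u (\<lambda>n. \<xi> (int n)))
     \<le> (\<Prod>i<J. (1 + 4 * exp (- real (N i))) *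
          (exp (\<Sum>p\<in>prime_block i. (cmod (\<kappa> * npow t p + npow u p))\<^sup>2) + exp (- real (N i)) * exp (12 * (1 + \<kappa>)\<^sup>2))
          + exp (- real (N i)) * exp (4 * \<kappa>\<^sup>2))"
proof -
  define A where "A i = (1 + 4 * exp (- real (N i))) *
          (exp (\<Sum>p\<in>prime_block i. (cmod (\<kappa> * npow t p + npow u p))\<^sup>2) + exp (- real (N i)) * exp (12 * (1 + \<kappa>)\<^sup>2))" for i
  define B where "B i = exp (- real (N i)) * exp (4 * \<kappa>\<^sup>2)" for i
  \<comment> \<open>The square root brings the factor \<open>1 + 4 * exp (- N i)\<close> under the
    square.\<close>
  define X where "X i f = of_real (sqrt (1 + 4 * exp (- real (N i)))) *
     (trunc_exp (N i) (\<kappa> * block_form i t f) * trunc_exp (N i) (block_form i u f))" for i f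
  define Y where "Y i f = trunc_exp (N i) (\<kappa> * block_form i t f) * (120 * \<kappa> / real (N i) * block_form i u f) ^ N i" for i f
  define T where "T i = (\<Union>m\<le>2 * N i. omega_set (prime_block i) m)" for i
  have N1: "N i \<ge> 1" "real (N i) \<ge> 172800 * \<kappa>\<^sup>2" if "i < J" for i
  proof -
    have "M * 1 \<le> N i" unfolding N_def using that by (intro mult_le_mono2) auto
    then show "N i \<ge> 1" "real (N i) \<ge> 172800 * \<kappa>\<^sup>2" using M by linarith+
  qed
  have repX: "represents (T i) (X i) (A i)" if "i < J" for i
  proof -
    have "represents (T i)
      (\<lambda>f. trunc_exp (N i) (\<kappa> * block_form i t f) * trunc_exp (N i) (block_form i u f))
      (exp (\<Sum>p\<in>prime_block i. (cmod (\<kappa> * npow t p + npow u p))\<^sup>2) + exp (- real (N i)) * exp (6 * (1 + \<kappa>)\<^sup>2 * 2))"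
      unfolding T_def block_form_def using N1[OF that] \<kappa>
      by (intro represents_trunc_exp_mult finite_prime_block sum_norm_npow_block_le prime_prime_block) auto
    from represents_scale[OF this, of "of_real (sqrt (1 + 4 * exp (- real (N i))))"]
    have "represents (T i) (X i) ((cmod (complex_of_real (sqrt (1 + 4 * exp (- real (N i))))))\<^sup>2 *
      (exp (\<Sum>p\<in>prime_block i. (cmod (\<kappa> * npow t p + npow u p))\<^sup>2) + exp (- real (N i)) * exp (6 * (1 + \<kappa>)\<^sup>2 * 2)))"
      unfolding X_def .
    moreover have "(cmod (complex_of_real (sqrt (1 + 4 * exp (- real (N i))))))\<^sup>2 = 1 + 4 * exp (- real (N i))"
      unfolding norm_of_real by (simp add: add_nonneg_nonneg)
    ultimately show ?thesis by (simp add: A_def)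
  qed
  have repY: "represents (T i) (Y i) (B i)" if "i < J" for i
  proof -
    have "represents (T i) (Y i) (exp (- real (N i)) * exp (2 * \<kappa>\<^sup>2 * 2))"
      unfolding T_def Y_def block_form_def using N1[OF that] \<kappa>
      by (intro represents_trunc_exp_power finite_prime_block sum_norm_npow_block_le prime_prime_block) auto
    then show ?thesis by (simp add: B_def)
  qed
  \<comment> \<open>Elements of \<open>T i\<close> have at most \<open>2 * N i\<close> prime
    factors, each at most \<open>2 ^ 2 ^ Suc i\<close>. The product of all \<open>b i\<close> is at
    most \<open>2 ^ (8 * M * 2 ^ J)\<close>, which explains the hypothesis on
    \<open>q\<close>.\<close>
  define b :: "nat \<Rightarrow> nat" where "b i = 2 ^ (2 ^ Suc i * (2 * N i))" for i
  have Tb: "0 < n \<and> n \<le> b i \<and> prime_factors n \<subseteq> prime_block i" if n: "n \<in> T i" for i n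
  proof -
    obtain m where m: "m \<le> 2 * N i" "n \<in> omega_set (prime_block i) m" using n by (auto simp: T_def)
    have "n \<le> (2 ^ 2 ^ Suc i) ^ m"
      using m(2) by (rule omega_set_bound) (auto simp: prime_block_def)
    also have "\<dots> \<le> (2 ^ 2 ^ Suc i) ^ (2 * N i)" using m(1) by (intro power_increasing) auto
    also have "\<dots> = b i" by (simp only: b_def power_mult)
    finally show ?thesis using m(2) by (auto simp: omega_set_def)
  qed
  have prodb: "(\<Prod>i<J. b i) < q"
  proof -
    have "(\<Prod>i<J. b i) = 2 ^ (\<Sum>i<J. 2 ^ Suc i * (2 * N i))" unfolding b_def by (rule power_sum[symmetric])
    also have "(\<Sum>i<J. 2 ^ Suc i * (2 * N i)) = 4 * M * (\<Sum>i<J. 2 ^ i * (J - i))"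
      by (simp add: N_def sum_distrib_left mult_ac)
    also have "(2::nat) ^ \<dots> \<le> 2 ^ (4 * M * (2 * 2 ^ J))"
      by (intro power_increasing mult_le_mono2 sum_pow2_weights_le) auto
    also have "\<dots> < q" using q(2) by (simp add: mult_ac)
    finally show ?thesis .
  qed
  have eq: "(cmod (resonator \<kappa> M J t f))\<^sup>2 * majorant \<kappa> M J u f =
     (\<Sum>S\<in>Pow {..<J}. \<Prod>i<J. (cmod ((if i \<in> S then X i else Y i) f))\<^sup>2)" for f
  proof -
    have "(cmod (resonator \<kappa> M J t f))\<^sup>2 * majorant \<kappa> M J u f =
        (\<Prod>i<J. (cmod (X i f))\<^sup>2 + (cmod (Y i f))\<^sup>2)"
      unfolding resonator_def majorant_def prod_norm[symmetric] prod_power_distrib prod.distrib[symmetric]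
    proof (intro prod.cong refl)
      fix i
      have "(cmod (X i f))\<^sup>2 = (1 + 4 * exp (- real (N i))) *
        ((cmod (trunc_exp (N i) (\<kappa> * block_form i t f)))\<^sup>2 * (cmod (trunc_exp (N i) (block_form i u f)))\<^sup>2)"
        unfolding X_def norm_mult power_mult_distrib norm_of_real by (simp add: add_nonneg_nonneg)
      moreover have "(cmod (Y i f))\<^sup>2 = (cmod (trunc_exp (N i) (\<kappa> * block_form i t f)))\<^sup>2 *
          (120 * \<kappa> * cmod (block_form i u f) / real (N i)) ^ (2 * N i)"
        using \<kappa> by (simp add: Y_def norm_mult norm_power norm_divide power_mult_distrib power_mult[symmetric] mult.commute)
      ultimately show "(cmod (trunc_exp (M * (J - i)) (of_real \<kappa> * block_form i t f)))\<^sup>2 *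
        ((1 + 4 * exp (- real (M * (J - i)))) * (cmod (trunc_exp (M * (J - i)) (block_form i u f)))\<^sup>2 +
        (120 * \<kappa> * cmod (block_form i u f) / real (M * (J - i))) ^ (2 * (M * (J - i)))) =
        (cmod (X i f))\<^sup>2 + (cmod (Y i f))\<^sup>2"
        by (simp add: N_def ring_distribs)
    qed
    also have "\<dots> = (\<Sum>S\<in>Pow {..<J}. (\<Prod>i\<in>S. (cmod (X i f))\<^sup>2) * (\<Prod>i\<in>{..<J} - S. (cmod (Y i f))\<^sup>2))"
      by (rule prod_add) simp
    also have "\<dots> = (\<Sum>S\<in>Pow {..<J}. \<Prod>i<J. (cmod ((if i \<in> S then X i else Y i) f))\<^sup>2)"
    proof (intro sum.cong refl)
      fix S assume "S \<in> Pow {..<J}"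
      then have S: "S \<subseteq> {..<J}" by simp
      have "(\<Prod>i<J. (cmod ((if i \<in> S then X i else Y i) f))\<^sup>2) =
         (\<Prod>i\<in>{..<J} - S. (cmod ((if i \<in> S then X i else Y i) f))\<^sup>2) * (\<Prod>i\<in>S. (cmod ((if i \<in> S then X i else Y i) f))\<^sup>2)"
        by (rule prod.subset_diff[OF S]) simp
      also have "\<dots> = (\<Prod>i\<in>{..<J} - S. (cmod (Y i f))\<^sup>2) * (\<Prod>i\<in>S. (cmod (X i f))\<^sup>2)"
        by (intro arg_cong2[of _ _ _ _ "(*)"] prod.cong) auto
      finally show "(\<Prod>i\<in>S. (cmod (X i f))\<^sup>2) * (\<Prod>i\<in>{..<J} - S. (cmod (Y i f))\<^sup>2) =
          (\<Prod>i<J. (cmod ((if i \<in> S then X i else Y i) f))\<^sup>2)" by (simp only: mult.commute)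
    qed
    finally show ?thesis .
  qed
  have "char_avg q (\<lambda>\<xi>. (cmod (resonator \<kappa> M J t (\<lambda>n. \<xi> (int n))))\<^sup>2 * majorant \<kappa> M J u (\<lambda>n. \<xi> (int n)))
     = (\<Sum>S\<in>Pow {..<J}. char_avg q (\<lambda>\<xi>. \<Prod>i<J. (cmod ((if i \<in> S then X i else Y i) (\<lambda>n. \<xi> (int n))))\<^sup>2))"
    unfolding eq by (rule char_avg_sum)
  also have "\<dots> \<le> (\<Sum>S\<in>Pow {..<J}. \<Prod>i<J. if i \<in> S then A i else B i)"
  proof (intro sum_mono char_avg_prod_le[OF q(1), where T = T and P = prime_block and b = b])
    show "(\<Prod>i<J. b i) < q" by (rule prodb)
  qed (use repX repY Tb prime_block_disjoint in \<open>auto simp: T_def finite_omega_set finite_prime_block\<close>)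
  also have "\<dots> = (\<Sum>S\<in>Pow {..<J}. (\<Prod>i\<in>S. A i) * (\<Prod>i\<in>{..<J} - S. B i))"
  proof (intro sum.cong refl)
    fix S assume "S \<in> Pow {..<J}"
    then have S: "S \<subseteq> {..<J}" by simp
    have "(\<Prod>i<J. if i \<in> S then A i else B i) =
       (\<Prod>i\<in>{..<J} - S. if i \<in> S then A i else B i) * (\<Prod>i\<in>S. if i \<in> S then A i else B i)"
      by (rule prod.subset_diff[OF S]) simp
    also have "\<dots> = (\<Prod>i\<in>{..<J} - S. B i) * (\<Prod>i\<in>S. A i)"
      by (intro arg_cong2[of _ _ _ _ "(*)"] prod.cong) auto
    finally show "(\<Prod>i<J. if i \<in> S then A i else B i) = (\<Prod>i\<in>S. A i) * (\<Prod>i\<in>{..<J} - S. B i)"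
      by (simp only: mult.commute)
  qed
  also have "\<dots> = (\<Prod>i<J. A i + B i)" by (rule prod_add[symmetric]) simp
  finally show ?thesis by (simp add: A_def B_def)
qed

definition prime_mass :: "nat \<Rightarrow> real" where
  "prime_mass J = (\<Sum>i<J. \<Sum>p\<in>prime_block i. 1 / real p)"

text \<open>The value for equal shifts minus a loss. Summed over the primes, the loss is what
  \<open>sum_prime_blocks_cos_ge\<close> bounds from below.\<close>

lemma norm_npow_combination:
  assumes "p \<ge> 1"
  shows "(cmod (of_real \<kappa> * npow t p + npow u p))\<^sup>2 =
           (\<kappa> + 1)\<^sup>2 * (1 / real p) - 2 * \<kappa> * ((1 - cos ((u - t) * ln (real p))) / real p)"
proof -
  have alg: "(\<kappa> * a + b)\<^sup>2 + (\<kappa> * c + d)\<^sup>2 = \<kappa>\<^sup>2 * (c\<^sup>2 + a\<^sup>2) + (d\<^sup>2 + b\<^sup>2) + 2 * \<kappa> * (b * a + d * c)"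
    for a b c d by (simp add: power2_eq_square algebra_simps)
  define l where "l = ln (real p)"
  have "of_real \<kappa> * npow t p + npow u p = of_real (real p powr - (1 / 2)) * (of_real \<kappa> * cis (- t * l) + cis (- u * l))"
    by (simp add: npow_def l_def algebra_simps)
  moreover have "(cmod (of_real \<kappa> * cis (- t * l) + cis (- u * l)))\<^sup>2 = \<kappa>\<^sup>2 + 1 + 2 * \<kappa> * cos ((u - t) * l)"
  proof -
    have "(cmod (of_real \<kappa> * cis (- t * l) + cis (- u * l)))\<^sup>2 =
        (\<kappa> * cos (t * l) + cos (u * l))\<^sup>2 + (\<kappa> * sin (t * l) + sin (u * l))\<^sup>2"
      unfolding cmod_power2 by (simp add: power2_eq_square algebra_simps)
    also have "\<dots> = \<kappa>\<^sup>2 * ((sin (t * l))\<^sup>2 + (cos (t * l))\<^sup>2) + ((sin (u * l))\<^sup>2 + (cos (u * l))\<^sup>2) +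
        2 * \<kappa> * (cos (u * l) * cos (t * l) + sin (u * l) * sin (t * l))"
      by (rule alg)
    also have "cos (u * l) * cos (t * l) + sin (u * l) * sin (t * l) = cos ((u - t) * l)"
      by (simp add: left_diff_distrib cos_diff)
    finally show ?thesis by simp
  qed
  moreover have "(cmod (complex_of_real (real p powr - (1 / 2))))\<^sup>2 = 1 / real p"
    using norm_npow_square[OF assms, of t] by (simp add: npow_def norm_mult)
  ultimately have "(cmod (of_real \<kappa> * npow t p + npow u p))\<^sup>2 = 1 / real p * (\<kappa>\<^sup>2 + 1 + 2 * \<kappa> * cos ((u - t) * l))"
    by (simp only: norm_mult power_mult_distrib)
  also have "\<dots> = (\<kappa> + 1)\<^sup>2 * (1 / real p) - 2 * \<kappa> * ((1 - cos ((u - t) * l)) / real p)"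
    using assms by (simp add: power2_eq_square field_simps)
  finally show ?thesis by (simp only: l_def)
qed

definition upper_const :: "real \<Rightarrow> real" where
  "upper_const \<kappa> = 4 * exp (4 + 5 * exp (12 * (1 + \<kappa>)\<^sup>2) + exp (4 * \<kappa>\<^sup>2) + 2 * \<kappa> * (ln 816 + 8))"

text \<open>At distance \<open>m / 2 ^ J\<close> the loss in the exponent is at least
  \<open>2 * \<kappa> * (ln m - O(1))\<close>, a factor of order
  \<open>m powr (- 2 * \<kappa>)\<close>. As \<open>\<kappa> \<ge> 1\<close>, this is at most
  \<open>1 / m ^ 2\<close>, which is summable over the shifts.\<close>

lemma char_avg_resonator_majorant_le:
  fixes \<kappa> :: real and M J q :: nat and a b :: int
  assumes q: "prime q" "2 ^ (8 * M * 2 ^ J) < q" and \<kappa>: "\<kappa> \<ge> 1"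
    and M: "M \<ge> 1" "real M \<ge> 172800 * \<kappa>\<^sup>2" and ab: "\<bar>a - b\<bar> \<le> 2 * 2 ^ J"
  shows "char_avg q (\<lambda>\<xi>. (cmod (resonator \<kappa> M J (of_int a / 2 ^ J) (\<lambda>n. \<xi> (int n))))\<^sup>2 *
            majorant \<kappa> M J (of_int b / 2 ^ J) (\<lambda>n. \<xi> (int n)))
     \<le> upper_const \<kappa> * exp ((\<kappa> + 1)\<^sup>2 * prime_mass J) / (1 + of_int \<bar>a - b\<bar>)\<^sup>2"
proof -
  define t where "t = (of_int a / 2 ^ J :: real)"
  define u where "u = (of_int b / 2 ^ J :: real)"
  define m where "m = nat \<bar>a - b\<bar>"
  define N where "N i = M * (J - i)" for i
  \<comment> \<open>Collects the truncation errors relative to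
    \<open>exp (\<sigma> i) \<ge> 1\<close>: 4 from the prefactor, 5 = 1 + 4 times the bound for
    high degrees, and the bound for the substitute part.\<close>
  define K where "K = 4 + 5 * exp (12 * (1 + \<kappa>)\<^sup>2) + exp (4 * \<kappa>\<^sup>2)"
  define \<sigma> where "\<sigma> i = (\<Sum>p\<in>prime_block i. (cmod (\<kappa> * npow t p + npow u p))\<^sup>2)" for i
  have "char_avg q (\<lambda>\<xi>. (cmod (resonator \<kappa> M J t (\<lambda>n. \<xi> (int n))))\<^sup>2 * majorant \<kappa> M J u (\<lambda>n. \<xi> (int n)))
     \<le> (\<Prod>i<J. (1 + 4 * exp (- real (N i))) * (exp (\<sigma> i) + exp (- real (N i)) * exp (12 * (1 + \<kappa>)\<^sup>2))
          + exp (- real (N i)) * exp (4 * \<kappa>\<^sup>2))"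
    unfolding N_def \<sigma>_def by (rule char_avg_resonator_majorant_le_prod[OF q \<kappa> M])
  also have "\<dots> \<le> (\<Prod>i<J. exp (\<sigma> i) * exp (K * exp (- real (N i))))"
  proof (intro prod_mono conjI)
    fix i
    define e where "e = exp (- real (N i))"
    have e: "0 \<le> e" "e \<le> 1" by (simp_all add: e_def)
    have s1: "1 \<le> exp (\<sigma> i)" by (simp add: \<sigma>_def sum_nonneg)
    have "(1 + 4 * e) * (exp (\<sigma> i) + e * exp (12 * (1 + \<kappa>)\<^sup>2)) + e * exp (4 * \<kappa>\<^sup>2) =
       exp (\<sigma> i) * (1 + 4 * e) + (e + 4 * (e * e)) * exp (12 * (1 + \<kappa>)\<^sup>2) + e * exp (4 * \<kappa>\<^sup>2)"
      by (simp add: algebra_simps)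
    also have "\<dots> \<le> exp (\<sigma> i) * (1 + 4 * e) + exp (\<sigma> i) * (5 * e * exp (12 * (1 + \<kappa>)\<^sup>2)) + exp (\<sigma> i) * (e * exp (4 * \<kappa>\<^sup>2))"
    proof (intro add_mono order_refl)
      have "e * e \<le> e" using e by (simp add: mult_left_le)
      then have "(e + 4 * (e * e)) * exp (12 * (1 + \<kappa>)\<^sup>2) \<le> 1 * (5 * e * exp (12 * (1 + \<kappa>)\<^sup>2))"
        by (simp add: mult_right_mono)
      also have "\<dots> \<le> exp (\<sigma> i) * (5 * e * exp (12 * (1 + \<kappa>)\<^sup>2))"
        using s1 e by (intro mult_right_mono) auto
      finally show "(e + 4 * (e * e)) * exp (12 * (1 + \<kappa>)\<^sup>2) \<le> exp (\<sigma> i) * (5 * e * exp (12 * (1 + \<kappa>)\<^sup>2))" .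
      show "e * exp (4 * \<kappa>\<^sup>2) \<le> exp (\<sigma> i) * (e * exp (4 * \<kappa>\<^sup>2))"
        using mult_right_mono[OF s1, of "e * exp (4 * \<kappa>\<^sup>2)"] e by simp
    qed
    also have "\<dots> = exp (\<sigma> i) * (1 + K * e)" by (simp add: K_def algebra_simps)
    also have "\<dots> \<le> exp (\<sigma> i) * exp (K * e)" by (intro mult_left_mono exp_ge_add_one_self) auto
    finally show "(1 + 4 * exp (- real (N i))) * (exp (\<sigma> i) + exp (- real (N i)) * exp (12 * (1 + \<kappa>)\<^sup>2))
          + exp (- real (N i)) * exp (4 * \<kappa>\<^sup>2) \<le> exp (\<sigma> i) * exp (K * exp (- real (N i)))" by (simp add: e_def)
    show "0 \<le> (1 + 4 * exp (- real (N i))) * (exp (\<sigma> i) + exp (- real (N i)) * exp (12 * (1 + \<kappa>)\<^sup>2))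
          + exp (- real (N i)) * exp (4 * \<kappa>\<^sup>2)" by (intro add_nonneg_nonneg mult_nonneg_nonneg) auto
  qed
  also have "\<dots> = exp ((\<Sum>i<J. \<sigma> i) + K * (\<Sum>i<J. exp (- real (N i))))"
    by (simp add: prod.distrib exp_add exp_sum sum_distrib_left)
  also have "\<dots> \<le> exp ((\<Sum>i<J. \<sigma> i) + K * 1)"
    unfolding N_def using sum_exp_weights_le[OF M(1), of J]
    by (simp add: K_def add_nonneg_nonneg mult_left_le)
  also have "(\<Sum>i<J. \<sigma> i) = (\<kappa> + 1)\<^sup>2 * prime_mass J -
      2 * \<kappa> * (\<Sum>i<J. \<Sum>p\<in>prime_block i. (1 - cos (real m / 2 ^ J * ln (real p))) / real p)"
  proof -
    have c: "cos ((u - t) * l) = cos (real m / 2 ^ J * l)" for l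
    proof -
      have "real m = \<bar>of_int (a - b)\<bar>" by (simp add: m_def)
      then have "real m / 2 ^ J = \<bar>u - t\<bar>"
        by (simp add: u_def t_def diff_divide_distrib[symmetric] abs_minus_commute)
      then have "real m / 2 ^ J = u - t \<or> real m / 2 ^ J = - (u - t)" by linarith
      then show ?thesis by (metis cos_minus mult_minus_left)
    qed
    have "\<sigma> i = (\<Sum>p\<in>prime_block i. (\<kappa> + 1)\<^sup>2 * (1 / real p) - 2 * \<kappa> * ((1 - cos (real m / 2 ^ J * ln (real p))) / real p))" for i
      unfolding \<sigma>_def
    proof (intro sum.cong refl)
      fix p assume "p \<in> prime_block i"
      then have "p \<ge> 1" using prime_ge_1_nat by (auto simp: prime_block_def)
      then show "(cmod (\<kappa> * npow t p + npow u p))\<^sup>2 = (\<kappa> + 1)\<^sup>2 * (1 / real p) - 2 * \<kappa> * ((1 - cos (real m / 2 ^ J * ln (real p))) / real p)"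
        by (simp only: norm_npow_combination c)
    qed
    then show ?thesis by (simp only: prime_mass_def sum_subtractf sum_distrib_left)
  qed
  also have "exp ((\<kappa> + 1)\<^sup>2 * prime_mass J -
      2 * \<kappa> * (\<Sum>i<J. \<Sum>p\<in>prime_block i. (1 - cos (real m / 2 ^ J * ln (real p))) / real p) + K * 1)
      \<le> upper_const \<kappa> * exp ((\<kappa> + 1)\<^sup>2 * prime_mass J) / (1 + real m)\<^sup>2"
  proof -
    define S where "S = (\<Sum>i<J. \<Sum>p\<in>prime_block i. (1 - cos (real m / 2 ^ J * ln (real p))) / real p)"
    define C where "C = ln 816 + (8::real)"
    have C0: "C \<ge> 0" by (simp add: C_def)
    have "exp (- 2 * \<kappa> * S) \<le> exp (2 * \<kappa> * C) * (4 / (1 + real m)\<^sup>2)"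
    proof (cases "m = 0")
      case True
      then have "S = 0" by (simp add: S_def)
      moreover have "1 \<le> exp (2 * \<kappa> * C)" using C0 \<kappa> by simp
      then have "1 \<le> exp (2 * \<kappa> * C) * 4" by linarith
      ultimately show ?thesis using True by simp
    next
      case False
      then have m1: "1 \<le> m" by simp
      have "int m \<le> int (2 * 2 ^ J)" using ab by (simp add: m_def)
      then have "m \<le> 2 * 2 ^ J" by (simp only: of_nat_le_iff)
      from sum_prime_blocks_cos_ge[OF m1 this] have "ln (real m) - C \<le> S" by (simp add: S_def C_def)
      then have "2 * \<kappa> * (ln (real m) - C) \<le> 2 * \<kappa> * S" using \<kappa> by (intro mult_left_mono) auto
      moreover have "2 * ln (real m) \<le> 2 * \<kappa> * ln (real m)" using \<kappa> m1 by (intro mult_right_mono) auto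
      ultimately have "- 2 * \<kappa> * S \<le> 2 * \<kappa> * C + - (2 * ln (real m))" by (simp add: right_diff_distrib)
      then have "exp (- 2 * \<kappa> * S) \<le> exp (2 * \<kappa> * C) * exp (- (2 * ln (real m)))"
        unfolding exp_add[symmetric] exp_le_cancel_iff .
      also have "exp (- (2 * ln (real m))) = 1 / (real m)\<^sup>2"
        using m1 by (simp add: exp_minus divide_inverse exp_double)
      also have "1 / (real m)\<^sup>2 \<le> 4 / (1 + real m)\<^sup>2"
      proof -
        have "(1 + real m)\<^sup>2 \<le> (2 * real m)\<^sup>2" using m1 by (intro power_mono) auto
        then show ?thesis using m1 by (simp add: field_simps)
      qed
      finally show ?thesis by (simp add: mult_left_mono)
    qed
    then have "exp ((\<kappa> + 1)\<^sup>2 * prime_mass J) * exp K * exp (- 2 * \<kappa> * S) \<le>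
        exp ((\<kappa> + 1)\<^sup>2 * prime_mass J) * exp K * (exp (2 * \<kappa> * C) * (4 / (1 + real m)\<^sup>2))"
      by (intro mult_left_mono) auto
    also have "\<dots> = upper_const \<kappa> * exp ((\<kappa> + 1)\<^sup>2 * prime_mass J) / (1 + real m)\<^sup>2"
      by (simp add: upper_const_def K_def C_def exp_add)
    also have "exp ((\<kappa> + 1)\<^sup>2 * prime_mass J) * exp K * exp (- 2 * \<kappa> * S) =
        exp ((\<kappa> + 1)\<^sup>2 * prime_mass J - 2 * \<kappa> * S + K * 1)"
      by (simp add: exp_add[symmetric] exp_diff exp_minus field_simps)
    finally show ?thesis by (simp only: S_def)
  qed
  also have "real m = of_int \<bar>a - b\<bar>" by (simp add: m_def)
  finally show ?thesis by (simp only: t_def u_def)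
qed

subsection \<open>Coefficients of the resonator\<close>

text \<open>For \<open>n\<close> in \<open>omega_set P m\<close> this counts the ways to write
  \<open>n\<close> as an ordered product of \<open>m\<close> primes of \<open>P\<close>. The base
  case does not check \<open>n = 1\<close>, so the count has this meaning on
  \<open>omega_set P m\<close> only.\<close>

primrec ordered_factorizations :: "nat set \<Rightarrow> nat \<Rightarrow> nat \<Rightarrow> real" where
  "ordered_factorizations P 0 n = 1"
| "ordered_factorizations P (Suc m) n = (\<Sum>p\<in>{p\<in>P. p dvd n}. ordered_factorizations P m (n div p))"

lemma ordered_factorizations_nonneg: "ordered_factorizations P m n \<ge> 0"
  by (induction m arbitrary: n) (auto intro: sum_nonneg)

lemma sum_power_eq_ordered_factorizations:
  assumes P: "finite P" "\<And>p. p \<in> P \<Longrightarrow> prime p" and F: "completely_mult F"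
  shows "(\<Sum>p\<in>P. F p) ^ m = (\<Sum>n\<in>omega_set P m. of_real (ordered_factorizations P m n) * F n)"
proof (induction m)
  case 0
  then show ?case using F by (simp add: completely_mult_def)
next
  case (Suc m)
  have "(\<Sum>p\<in>P. F p) ^ Suc m = (\<Sum>p\<in>P. F p) * (\<Sum>n\<in>omega_set P m. of_real (ordered_factorizations P m n) * F n)"
    by (simp only: power_Suc Suc)
  also have "\<dots> = (\<Sum>p\<in>P. \<Sum>n\<in>omega_set P m. of_real (ordered_factorizations P m n) * F (p * n))"
    using F by (simp add: sum_product completely_mult_def mult_ac)
  also have "\<dots> = (\<Sum>n\<in>omega_set P (Suc m). \<Sum>p\<in>{p\<in>P. p dvd n}.
      of_real (ordered_factorizations P m (n div p)) * F (p * (n div p)))"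
    by (rule sum_omega_set_Suc[OF P])
  also have "\<dots> = (\<Sum>n\<in>omega_set P (Suc m). of_real (ordered_factorizations P (Suc m) n) * F n)"
    by (simp add: sum_distrib_right)
  finally show ?case .
qed

lemma prime_factorization_prod_primes: 
  assumes "finite A" "\<And>p. p \<in> A \<Longrightarrow> prime (p::nat)"
  shows "prime_factorization (\<Prod>A) = mset_set A"
  using assms
proof (induction A rule: finite_induct)
  case (insert p A)
  have "\<Prod>A \<noteq> 0" using insert.prems insert.hyps(1) by (auto dest: prime_gt_0_nat)
  moreover have "prime p" using insert.prems by blast
  moreover have "prime_factorization (\<Prod>A) = mset_set A" using insert by blast
  ultimately show ?case using insert.hyps
    by (simp add: prime_factorization_mult prime_factorization_prime)
qed simp

lemma prod_in_omega_set:
  assumes "finite P" "\<And>p. p \<in> P \<Longrightarrow> prime (p::nat)" "A \<subseteq> P"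
  shows "\<Prod>A \<in> omega_set P (card A)"
proof -
  have A: "finite A" "\<And>p. p \<in> A \<Longrightarrow> prime p" using assms finite_subset by blast+
  have "\<Prod>A > 0" using A(2) by (intro prod_pos) (auto dest: prime_gt_0_nat)
  then show ?thesis using prime_factorization_prod_primes[OF A] assms(3) A(1) by (auto simp: omega_set_def)
qed

text \<open>Any of the \<open>m\<close> distinct primes may come first. Against the
  \<open>1 / fact m\<close> of the exponential this leaves at least \<open>\<kappa> ^ m\<close> as
  coefficient of a squarefree integer.\<close>

lemma ordered_factorizations_prod_ge:
  assumes P: "finite P" "\<And>p. p \<in> P \<Longrightarrow> prime p" and A: "A \<subseteq> P" "card A = m"
  shows "fact m \<le> ordered_factorizations P m (\<Prod>A)"
  using A
proof (induction m arbitrary: A)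
  case (Suc m)
  have fin: "finite A" using Suc.prems P(1) finite_subset by blast
  have "fact (Suc m) = (\<Sum>p\<in>A. fact m :: real)" using Suc.prems by simp
  also have "\<dots> \<le> (\<Sum>p\<in>A. ordered_factorizations P m (\<Prod>A div p))"
  proof (rule sum_mono)
    fix p assume p: "p \<in> A"
    have "p > 0" using P(2) p Suc.prems prime_gt_0_nat by blast
    moreover have "\<Prod>A = p * \<Prod>(A - {p})" using fin p by (rule prod.remove)
    ultimately have "\<Prod>A div p = \<Prod>(A - {p})" by simp
    moreover have "fact m \<le> ordered_factorizations P m (\<Prod>(A - {p}))"
      using p Suc.prems fin by (intro Suc.IH) auto
    ultimately show "fact m \<le> ordered_factorizations P m (\<Prod>A div p)" by simp
  qed
  also have "\<dots> \<le> (\<Sum>p\<in>{p\<in>P. p dvd \<Prod>A}. ordered_factorizations P m (\<Prod>A div p))"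
    using Suc.prems fin P(1) by (intro sum_mono2) (auto simp: ordered_factorizations_nonneg intro: dvd_prodI)
  finally show ?case by simp
qed simp

text \<open>\<open>represents\<close> hides the coefficients behind an upper bound. The lower bound
  of the twisted moment needs them nonnegative, and bounded from below at squarefree
  integers.\<close>

lemma trunc_exp_expansion:
  fixes \<kappa> :: real
  assumes P: "finite P" "\<And>p. p \<in> P \<Longrightarrow> prime p" and \<kappa>: "\<kappa> \<ge> 0"
  obtains c :: "nat \<Rightarrow> real" where
    "\<And>n. c n \<ge> 0"
    "\<And>F. completely_mult F \<Longrightarrow>
       trunc_exp N (of_real \<kappa> * (\<Sum>p\<in>P. F p)) = (\<Sum>n\<in>(\<Union>m\<le>N. omega_set P m). of_real (c n) * F n)"
    "\<And>A. A \<subseteq> P \<Longrightarrow> card A \<le> N \<Longrightarrow> \<kappa> ^ card A \<le> c (\<Prod>A)"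
proof
  define c where "c n = (let m = size (prime_factorization n) in \<kappa> ^ m / fact m * ordered_factorizations P m n)" for n
  have c: "c n = \<kappa> ^ m / fact m * ordered_factorizations P m n" if "n \<in> omega_set P m" for m n
    using that by (auto simp: c_def omega_set_def)
  show "c n \<ge> 0" for n
    using \<kappa> by (simp add: c_def Let_def ordered_factorizations_nonneg)
  show "trunc_exp N (of_real \<kappa> * (\<Sum>p\<in>P. F p)) = (\<Sum>n\<in>(\<Union>m\<le>N. omega_set P m). of_real (c n) * F n)"
    if F: "completely_mult F" for F
  proof -
    have "trunc_exp N (of_real \<kappa> * (\<Sum>p\<in>P. F p)) = (\<Sum>m\<le>N. of_real (\<kappa> ^ m / fact m) * (\<Sum>p\<in>P. F p) ^ m)"
      by (simp add: trunc_exp_def power_mult_distrib)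
    also have "\<dots> = (\<Sum>m\<le>N. \<Sum>n\<in>omega_set P m. of_real (\<kappa> ^ m / fact m * ordered_factorizations P m n) * F n)"
      by (intro sum.cong refl, subst sum_power_eq_ordered_factorizations[OF P F])
         (simp_all add: sum_distrib_left mult_ac)
    also have "\<dots> = (\<Sum>m\<le>N. \<Sum>n\<in>omega_set P m. of_real (c n) * F n)"
      by (intro sum.cong refl) (simp add: c)
    also have "\<dots> = (\<Sum>n\<in>(\<Union>m\<le>N. omega_set P m). of_real (c n) * F n)"
      by (rule sum.UNION_disjoint[symmetric]) (auto simp: finite_omega_set[OF P(1)] omega_set_disjoint)
    finally show ?thesis .
  qed
  show "\<kappa> ^ card A \<le> c (\<Prod>A)" if A: "A \<subseteq> P" "card A \<le> N" for A
  proof -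
    have "\<kappa> ^ card A / fact (card A) * fact (card A) \<le> \<kappa> ^ card A / fact (card A) * ordered_factorizations P (card A) (\<Prod>A)"
      using \<kappa> ordered_factorizations_prod_ge[OF P A(1) refl] by (intro mult_left_mono) auto
    then show ?thesis using c[OF prod_in_omega_set[OF P A(1)]] by simp
  qed
qed

text \<open>The coefficients are the same for all shifts: \<open>t\<close> enters through
  \<open>npow\<close> alone, so that the sum over the shifts can be carried out for each pair of
  indices.\<close>

lemma resonator_expansion:
  assumes \<kappa>: "\<kappa> \<ge> 0"
  obtains r :: "nat \<Rightarrow> real" where
    "\<And>a. r a \<ge> 0"
    "\<And>a. r a \<noteq> 0 \<Longrightarrow> a \<in> {1..2 ^ (4 * M * 2 ^ J)}"
    "\<And>t f. completely_mult f \<Longrightarrow> f 0 = 0 \<Longrightarrow>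
       resonator \<kappa> M J t f = (\<Sum>a\<in>{1..2 ^ (4 * M * 2 ^ J)}. of_real (r a) * npow t a * f a)"
    "\<And>A. A \<subseteq> (\<Union>i<J. prime_block i) \<Longrightarrow> (\<And>i. i < J \<Longrightarrow> card (A \<inter> prime_block i) \<le> M * (J - i)) \<Longrightarrow>
       \<kappa> ^ card A \<le> r (\<Prod>A)"
proof -
  define N where "N i = M * (J - i)" for i
  define T where "T i = (\<Union>m\<le>N i. omega_set (prime_block i) m)" for i
  define Q where "Q i c \<longleftrightarrow> (\<forall>n. c n \<ge> 0) \<and> (\<forall>F. completely_mult F \<longrightarrow>
       trunc_exp (N i) (of_real \<kappa> * (\<Sum>p\<in>prime_block i. F p)) = (\<Sum>n\<in>T i. of_real (c n) * F n)) \<and>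
       (\<forall>A. A \<subseteq> prime_block i \<longrightarrow> card A \<le> N i \<longrightarrow> \<kappa> ^ card A \<le> c (\<Prod>A))" for i and c :: "nat \<Rightarrow> real"
  have "\<exists>c. Q i c" for i
    unfolding T_def Q_def
    by (rule trunc_exp_expansion[where P = "prime_block i" and N = "N i" and \<kappa> = \<kappa>])
       (use finite_prime_block prime_prime_block \<kappa> in blast)+
  then obtain c where "\<And>i. Q i (c i)" by metis
  then have c0: "\<And>i n. c i n \<ge> 0"
    and cF: "\<And>i F. completely_mult F \<Longrightarrow>
       trunc_exp (N i) (of_real \<kappa> * (\<Sum>p\<in>prime_block i. F p)) = (\<Sum>n\<in>T i. of_real (c i n) * F n)"
    and cA: "\<And>i A. A \<subseteq> prime_block i \<Longrightarrow> card A \<le> N i \<Longrightarrow> \<kappa> ^ card A \<le> c i (\<Prod>A)"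
    unfolding Q_def by blast+
  define E where "E = Pi\<^sub>E {..<J} T"
  have finT: "finite (T i)" for i by (simp add: T_def finite_omega_set finite_prime_block)
  have finE: "finite E" unfolding E_def using finT by (intro finite_PiE) auto
  define \<nu> where "\<nu> g = (\<Prod>i<J. g i)" for g :: "nat \<Rightarrow> nat"
  define w where "w g = (\<Prod>i<J. c i (g i))" for g
  \<comment> \<open>Summing over the fibres of \<open>\<nu>\<close> dispenses with injectivity; a
    single summand is enough for the lower bound at \<open>\<Prod>A\<close>.\<close>
  define r where "r a = (\<Sum>g\<in>{g\<in>E. \<nu> g = a}. w g)" for a
  have w0: "w g \<ge> 0" for g unfolding w_def using c0 by (intro prod_nonneg) auto
  have \<nu>: "\<nu> g \<in> {1..2 ^ (4 * M * 2 ^ J)}" if g: "g \<in> E" for g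
  proof -
    have gi: "0 < g i \<and> g i \<le> 2 ^ (2 ^ Suc i * N i)" if i: "i < J" for i
    proof -
      obtain m where m: "m \<le> N i" "g i \<in> omega_set (prime_block i) m"
        using g i by (auto simp: E_def T_def PiE_iff)
      have "g i \<le> (2 ^ 2 ^ Suc i) ^ m"
        using m(2) by (rule omega_set_bound) (auto simp: prime_block_def)
      also have "\<dots> \<le> (2 ^ 2 ^ Suc i) ^ N i" using m(1) by (intro power_increasing) auto
      also have "\<dots> = 2 ^ (2 ^ Suc i * N i)" by (simp only: power_mult)
      finally show ?thesis using m(2) by (simp add: omega_set_def)
    qed
    have pos: "\<nu> g > 0" unfolding \<nu>_def using gi by (intro prod_pos) auto
    have "\<nu> g \<le> (\<Prod>i<J. 2 ^ (2 ^ Suc i * N i))" unfolding \<nu>_def using gi by (intro prod_mono) auto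
    also have "\<dots> = 2 ^ (\<Sum>i<J. 2 ^ Suc i * N i)" by (rule power_sum[symmetric])
    also have "(\<Sum>i<J. 2 ^ Suc i * N i) = 2 * M * (\<Sum>i<J. 2 ^ i * (J - i))"
      by (simp add: N_def sum_distrib_left mult_ac)
    also have "(2::nat) ^ \<dots> \<le> 2 ^ (2 * M * (2 * 2 ^ J))"
      by (intro power_increasing mult_le_mono2 sum_pow2_weights_le) auto
    also have "2 * M * (2 * 2 ^ J) = 4 * M * 2 ^ J" by simp
    finally show ?thesis using pos by simp
  qed
  show thesis
  proof (rule that[of r])
    show "r a \<ge> 0" for a unfolding r_def using w0 by (intro sum_nonneg) auto
    show "a \<in> {1..2 ^ (4 * M * 2 ^ J)}" if "r a \<noteq> 0" for a
    proof -
      from that obtain g where "g \<in> E" "\<nu> g = a"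
        unfolding r_def by (metis (mono_tags, lifting) mem_Collect_eq sum.not_neutral_contains_not_neutral)
      then show ?thesis using \<nu> by blast
    qed
    show "resonator \<kappa> M J t f = (\<Sum>a\<in>{1..2 ^ (4 * M * 2 ^ J)}. of_real (r a) * npow t a * f a)"
      if f: "completely_mult f" "f 0 = 0" for t f
    proof -
      define F where "F n = npow t n * f n" for n
      have F: "completely_mult F" unfolding F_def using f by (intro completely_mult_npow)
      have "resonator \<kappa> M J t f = (\<Prod>i<J. \<Sum>n\<in>T i. of_real (c i n) * F n)"
        unfolding resonator_def
        by (intro prod.cong refl) (simp add: block_form_def linear_form_def F_def[symmetric] N_def[symmetric] cF[OF F])
      also have "\<dots> = (\<Sum>g\<in>E. \<Prod>i<J. of_real (c i (g i)) * F (g i))"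
        unfolding E_def using finT by (intro prod_sum_PiE) auto
      also have "\<dots> = (\<Sum>g\<in>E. of_real (w g) * F (\<nu> g))"
      proof (intro sum.cong refl)
        fix g show "(\<Prod>i<J. of_real (c i (g i)) * F (g i)) = of_real (w g) * F (\<nu> g)"
          unfolding \<nu>_def completely_mult_prod[OF F] by (simp add: w_def prod.distrib)
      qed
      also have "\<dots> = (\<Sum>a\<in>{1..2 ^ (4 * M * 2 ^ J)}. \<Sum>g\<in>{g\<in>E. \<nu> g = a}. of_real (w g) * F (\<nu> g))"
        using \<nu> by (intro sum.group[symmetric] finE) auto
      also have "\<dots> = (\<Sum>a\<in>{1..2 ^ (4 * M * 2 ^ J)}. of_real (r a) * F a)"
        by (intro sum.cong refl) (simp add: r_def sum_distrib_right)
      finally show ?thesis by (simp add: F_def mult.assoc)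
    qed
    show "\<kappa> ^ card A \<le> r (\<Prod>A)"
      if A: "A \<subseteq> (\<Union>i<J. prime_block i)" "\<And>i. i < J \<Longrightarrow> card (A \<inter> prime_block i) \<le> M * (J - i)" for A
    proof -
      have finA: "finite A" using A(1) by (rule finite_subset) (simp add: finite_prime_block)
      define g where "g = (\<lambda>i\<in>{..<J}. \<Prod>(A \<inter> prime_block i))"
      have Aeq: "A = (\<Union>i<J. A \<inter> prime_block i)" using A(1) by blast
      have disj: "\<forall>i\<in>{..<J}. \<forall>j\<in>{..<J}. i \<noteq> j \<longrightarrow> A \<inter> prime_block i \<inter> (A \<inter> prime_block j) = {}"
        using prime_block_disjoint by blast
      have "g i \<in> T i" if "i < J" for i
      proof -
        have "\<Prod>(A \<inter> prime_block i) \<in> omega_set (prime_block i) (card (A \<inter> prime_block i))"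
          by (rule prod_in_omega_set[OF finite_prime_block prime_prime_block]) auto
        then show ?thesis using that A(2)[OF that] by (auto simp: T_def g_def N_def)
      qed
      then have gE: "g \<in> E" by (auto simp: E_def g_def)
      have "\<nu> g = (\<Prod>i<J. \<Prod>(A \<inter> prime_block i))" by (simp add: \<nu>_def g_def)
      also have "\<dots> = \<Prod>(\<Union>i<J. A \<inter> prime_block i)"
        using disj finA by (subst prod.UNION_disjoint) auto
      also have "\<dots> = \<Prod>A" by (simp only: Aeq[symmetric])
      finally have \<nu>g: "\<nu> g = \<Prod>A" .
      have "card A = (\<Sum>i<J. card (A \<inter> prime_block i))"
        using disj finA by (subst Aeq, subst card_UN_disjoint) auto
      then have "\<kappa> ^ card A = (\<Prod>i<J. \<kappa> ^ card (A \<inter> prime_block i))" by (simp add: power_sum)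
      also have "\<dots> \<le> w g"
        unfolding w_def using cA A(2) \<kappa> by (intro prod_mono) (auto simp: g_def N_def)
      also have "\<dots> \<le> r (\<Prod>A)"
        unfolding r_def using gE \<nu>g w0 finE by (intro member_le_sum) auto
      finally show ?thesis .
    qed
  qed
qed

subsection \<open>Lower bound for the twisted second moment\<close>

lemma sum_sum_cis_diff:
  "(\<Sum>j<N. \<Sum>l<N. cis ((real j - real l) * \<theta>)) = of_real ((cmod (\<Sum>j<N. cis (real j * \<theta>)))\<^sup>2)"
proof -
  have "(\<Sum>j<N. \<Sum>l<N. cis ((real j - real l) * \<theta>)) = (\<Sum>j<N. cis (real j * \<theta>)) * cnj (\<Sum>l<N. cis (real l * \<theta>))"
    by (simp add: sum_product cis_cnj cis_mult left_diff_distrib)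
  then show ?thesis by (simp only: complex_norm_square)
qed

text \<open>All angles are at most 1, hence below pi / 3, so every cosine is at least 1/2.\<close>

lemma norm_sum_cis_ge:
  assumes "\<bar>real N * \<theta>\<bar> \<le> 1"
  shows "(cmod (\<Sum>j<N. cis (real j * \<theta>)))\<^sup>2 \<ge> (real N)\<^sup>2 / 4"
proof -
  have "real N / 2 = (\<Sum>j<N. 1 / 2)" by simp
  also have "\<dots> \<le> (\<Sum>j<N. cos (real j * \<theta>))"
  proof (rule sum_mono)
    fix j assume "j \<in> {..<N}"
    then have "\<bar>real j * \<theta>\<bar> \<le> \<bar>real N * \<theta>\<bar>" by (simp add: abs_mult mult_right_mono)
    then have "\<bar>real j * \<theta>\<bar> \<le> 1" using assms by linarith
    also have "1 \<le> pi / 3" using pi_gt3 by simp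
    finally have "cos (pi / 3) \<le> cos \<bar>real j * \<theta>\<bar>"
      by (intro cos_monotone_0_pi_le) auto
    then show "1 / 2 \<le> cos (real j * \<theta>)" by (simp add: cos_60)
  qed
  also have "\<dots> = Re (\<Sum>j<N. cis (real j * \<theta>))" by simp
  also have "\<dots> \<le> cmod (\<Sum>j<N. cis (real j * \<theta>))" by (rule complex_Re_le_cmod)
  finally have "(real N / 2)\<^sup>2 \<le> (cmod (\<Sum>j<N. cis (real j * \<theta>)))\<^sup>2" by (intro power_mono) auto
  then show ?thesis by (simp add: power_divide)
qed

lemma npow_mult_cnj:
  "npow t a * cnj (npow t b) = of_real ((real a * real b) powr - (1 / 2)) * cis (- t * (ln (real a) - ln (real b)))"
  by (simp add: npow_def powr_mult cis_cnj mult_ac) (simp add: cis_mult algebra_simps)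

text \<open>The sum over all shifts \<open>(j - l) / N\<close> of \<open>npow\<close> at
  \<open>a\<close> times its conjugate at \<open>b\<close>. Using differences of two indices makes
  it a squared modulus, hence nonnegative.\<close>

definition fejer_weight :: "nat \<Rightarrow> nat \<Rightarrow> nat \<Rightarrow> real" where
  "fejer_weight N a b = (real a * real b) powr - (1 / 2) *
     (cmod (\<Sum>j<N. cis (real j * (- (ln (real a) - ln (real b)) / real N))))\<^sup>2"

lemma fejer_weight_nonneg: "fejer_weight N a b \<ge> 0"
  by (simp add: fejer_weight_def)

lemma sum_sum_npow_mult_cnj:
  "(\<Sum>j<N. \<Sum>l<N. npow ((real j - real l) / real N) a * cnj (npow ((real j - real l) / real N) b)) =
     of_real (fejer_weight N a b)"
proof -
  have e: "- (x / real N) * D = x * (- D / real N)" for x D by simp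
  have "(\<Sum>j<N. \<Sum>l<N. npow ((real j - real l) / real N) a * cnj (npow ((real j - real l) / real N) b)) =
    of_real ((real a * real b) powr - (1 / 2)) *
      (\<Sum>j<N. \<Sum>l<N. cis ((real j - real l) * (- (ln (real a) - ln (real b)) / real N)))"
    unfolding npow_mult_cnj sum_distrib_left
    by (simp only: e)
  then show ?thesis unfolding sum_sum_cis_diff fejer_weight_def by simp
qed

text \<open>The ratio of \<open>a\<close> and \<open>b\<close> is at most 4, so their maximum is at
  most \<open>2 * sqrt (a * b)\<close>. The bound is written with \<open>max a b\<close> in the
  numerator in order to cancel the denominator in \<open>card_equal_multiples_ge\<close>.\<close>

lemma fejer_weight_ge:
  assumes ab: "a \<ge> 1" "b \<ge> 1" and l: "\<bar>ln (real a) - ln (real b)\<bar> \<le> 1"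
  shows "fejer_weight N a b \<ge> (real N)\<^sup>2 / 4 * (real (max a b) / (2 * (real a * real b)))"
proof -
  define m where "m = max (real a) (real b)"
  define n where "n = min (real a) (real b)"
  have pos: "real a > 0" "real b > 0" "n > 0" "m > 0" using ab by (auto simp: m_def n_def)
  have mn: "m * n = real a * real b" by (auto simp: m_def n_def max_def min_def)
  have "ln m - ln n \<le> 1" using l by (auto simp: m_def n_def max_def min_def)
  then have "ln (m / n) \<le> 1" using pos by (simp add: ln_div)
  then have "m / n \<le> exp 1" using pos by (metis divide_pos_pos exp_le_cancel_iff exp_ln)
  then have "m / n \<le> 4" using exp_le by linarith
  then have "m \<le> 4 * n" using pos by (simp add: divide_le_eq)
  then have "m * m \<le> 4 * (m * n)" using pos by simp
  then have "(m / 2)\<^sup>2 \<le> real a * real b" using mn by (simp add: power2_eq_square)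
  then have "m / 2 \<le> sqrt (real a * real b)" by (rule real_le_rsqrt)
  then have "m * sqrt (real a * real b) \<le> 2 * sqrt (real a * real b) * sqrt (real a * real b)"
    using pos by (intro mult_right_mono) auto
  also have "\<dots> = 2 * (real a * real b)" using pos by simp
  finally have "m * sqrt (real a * real b) \<le> 1 * (2 * (real a * real b))" by simp
  moreover have "sqrt (real a * real b) > 0" "2 * (real a * real b) > 0" using pos by simp_all
  ultimately have "m / (2 * (real a * real b)) \<le> 1 / sqrt (real a * real b)"
    by (subst frac_le_eq) (use pos in \<open>auto intro!: divide_nonpos_pos mult_pos_pos\<close>)
  also have "\<dots> = (real a * real b) powr - (1 / 2)" using pos by (simp add: powr_minus_divide powr_half_sqrt)
  finally have 1: "m / (2 * (real a * real b)) \<le> (real a * real b) powr - (1 / 2)" .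
  have 2: "(real N)\<^sup>2 / 4 \<le> (cmod (\<Sum>j<N. cis (real j * (- (ln (real a) - ln (real b)) / real N))))\<^sup>2"
  proof (cases "N = 0")
    case False
    then show ?thesis using l by (intro norm_sum_cis_ge) auto
  qed simp
  have "(real N)\<^sup>2 / 4 * (m / (2 * (real a * real b))) \<le> fejer_weight N a b"
    unfolding fejer_weight_def using mult_mono[OF 1 2] pos by (simp add: mult.commute)
  then show ?thesis by (simp add: m_def of_nat_max)
qed

text \<open>With \<open>a'\<close>, \<open>b'\<close> the cofactors of the greatest common divisor
  g, the pairs \<open>(l * b', l * a')\<close> are solutions for
  \<open>l \<le> X * g / max a b\<close>. This quotient is at least 1, so its integer part is at
  least half of it.\<close>

lemma card_equal_multiples_ge:
  assumes ab: "a \<ge> 1" "b \<ge> 1" and X: "max a b \<le> X"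
  shows "real (card {(m, n). m \<in> {1..X} \<and> n \<in> {1..X} \<and> m * a = n * b}) \<ge> real X * real (gcd a b) / (2 * real (max a b))"
proof -
  define g where "g = gcd a b"
  have g: "g > 0" using ab by (simp add: g_def)
  obtain a' b' where a': "a = g * a'" and b': "b = g * b'"
    unfolding g_def by (meson gcd_dvd1 gcd_dvd2 dvdE)
  define Q where "Q = X * g div max a b"
  have pos: "a' > 0" "b' > 0" using ab a' b' by (auto intro: Nat.gr0I)
  define h where "h l = (l * b', l * a')" for l :: nat
  have inj: "inj_on h {1..Q}" using pos by (auto simp: inj_on_def h_def)
  have sub: "h ` {1..Q} \<subseteq> {(m, n). m \<in> {1..X} \<and> n \<in> {1..X} \<and> m * a = n * b}"
  proof
    fix z assume "z \<in> h ` {1..Q}"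
    then obtain l where l: "1 \<le> l" "l \<le> Q" "z = h l" by auto
    have "l * max a b \<le> Q * max a b" using l by simp
    also have "\<dots> \<le> X * g" unfolding Q_def by (rule div_times_less_eq_dividend)
    finally have lm: "l * max a b \<le> X * g" .
    have "l * a \<le> X * g" by (rule order_trans[OF mult_le_mono2[OF max.cobounded1] lm])
    moreover have "l * b \<le> X * g" by (rule order_trans[OF mult_le_mono2[OF max.cobounded2] lm])
    ultimately have "l * a \<le> X * g" "l * b \<le> X * g" .
    then have "g * (l * a') \<le> g * X" "g * (l * b') \<le> g * X" using a' b' by (simp_all add: mult_ac)
    then have "l * a' \<le> X" "l * b' \<le> X" using g by simp_all
    moreover have "l * b' * a = l * a' * b" using a' b' by (simp add: mult_ac)
    ultimately show "z \<in> {(m, n). m \<in> {1..X} \<and> n \<in> {1..X} \<and> m * a = n * b}"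
      using l pos by (auto simp: h_def Suc_le_eq)
  qed
  have fin: "finite {(m, n). m \<in> {1..X} \<and> n \<in> {1..X} \<and> m * a = n * b}"
    by (rule finite_subset[of _ "{1..X} \<times> {1..X}"]) auto
  have "Q \<le> card {(m, n). m \<in> {1..X} \<and> n \<in> {1..X} \<and> m * a = n * b}"
    using card_mono[OF fin sub] card_image[OF inj] by simp
  moreover have "real X * real g / (2 * real (max a b)) \<le> real Q"
  proof -
    have m0: "max a b > 0" using ab by auto
    have "max a b * 1 \<le> X * g" using X g by (intro mult_le_mono) auto
    then have "1 \<le> Q" unfolding Q_def using m0 by (simp add: Suc_le_eq div_greater_zero_iff)
    have "X * g \<le> max a b + Q * max a b"
      unfolding Q_def using dividend_less_div_times[OF m0, of "X * g"] by (rule less_imp_le)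
    also have "\<dots> \<le> Q * max a b + Q * max a b"
      using mult_le_mono1[OF \<open>1 \<le> Q\<close>, of "max a b"] by simp
    also have "\<dots> = 2 * Q * max a b" by simp
    finally have "real (X * g) \<le> real (2 * Q * max a b)" by (simp only: of_nat_le_iff)
    then show ?thesis using m0 by (simp add: field_simps del: of_nat_max)
  qed
  ultimately show ?thesis by (simp add: g_def)
qed

text \<open>Gauss's divisor sum diagonalises the quadratic form in greatest common divisors: it
  becomes a sum over \<open>d\<close> of squares with weights \<open>totient d\<close>.\<close>

lemma gcd_eq_sum_totient:
  assumes "a \<in> {1..Y}"
  shows "real (gcd a b) = (\<Sum>d\<in>{1..Y}. if d dvd a \<and> d dvd b then real (totient d) else 0)"
proof -
  have g: "gcd a b > 0" using assms by auto
  have "{d. d dvd gcd a b} = {d\<in>{1..Y}. d dvd a \<and> d dvd b}"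
  proof -
    have "d \<in> {1..Y}" if "d dvd a" for d
      using that assms dvd_imp_le[OF that] by (auto intro: Nat.gr0I simp: Suc_le_eq)
    then show ?thesis by auto
  qed
  then have "gcd a b = (\<Sum>d\<in>{d\<in>{1..Y}. d dvd a \<and> d dvd b}. totient d)"
    using totient_divisor_sum[of "gcd a b"] by simp
  then have "real (gcd a b) = (\<Sum>d\<in>{d\<in>{1..Y}. d dvd a \<and> d dvd b}. real (totient d))" by simp
  then show ?thesis by (simp only: sum.inter_filter[OF finite_atLeastAtMost])
qed

lemma sum_swap3:
  "(\<Sum>a\<in>A. \<Sum>b\<in>B. \<Sum>c\<in>C. f a b c) = (\<Sum>c\<in>C. \<Sum>a\<in>A. \<Sum>b\<in>B. f a b c)"
proof -
  have "(\<Sum>a\<in>A. \<Sum>b\<in>B. \<Sum>c\<in>C. f a b c) = (\<Sum>a\<in>A. \<Sum>c\<in>C. \<Sum>b\<in>B. f a b c)"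
    by (rule sum.cong[OF refl], rule sum.swap)
  also have "\<dots> = (\<Sum>c\<in>C. \<Sum>a\<in>A. \<Sum>b\<in>B. f a b c)" by (rule sum.swap)
  finally show ?thesis .
qed

text \<open>Restricting a positive definite double sum to pairs in the same of \<open>B\<close> classes
  costs at most a factor \<open>B\<close>, by Cauchy's inequality applied for each divisor \<open>d\<close>.\<close>

lemma gcd_sum_same_class_ge:
  fixes v :: "nat \<Rightarrow> real" and \<beta> :: "nat \<Rightarrow> nat"
  assumes \<beta>: "\<And>a. a \<in> {1..Y} \<Longrightarrow> \<beta> a < B"
  shows "(\<Sum>a\<in>{1..Y}. \<Sum>b\<in>{1..Y}. v a * v b * real (gcd a b)) \<le>
     real B * (\<Sum>a\<in>{1..Y}. \<Sum>b\<in>{1..Y}. if \<beta> a = \<beta> b then v a * v b * real (gcd a b) else 0)"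
proof -
  define y where "y d \<beta>' = (\<Sum>a\<in>{1..Y}. if d dvd a \<and> \<beta> a = \<beta>' then v a else 0)" for d \<beta>'
  have total: "(\<Sum>\<beta>'<B. y d \<beta>') = (\<Sum>a\<in>{1..Y}. if d dvd a then v a else 0)" for d
  proof -
    have "(\<Sum>\<beta>'<B. y d \<beta>') = (\<Sum>a\<in>{1..Y}. \<Sum>\<beta>'<B. if d dvd a \<and> \<beta> a = \<beta>' then v a else 0)"
      unfolding y_def by (rule sum.swap)
    also have "\<dots> = (\<Sum>a\<in>{1..Y}. if d dvd a then v a else 0)"
    proof (intro sum.cong refl)
      fix a assume "a \<in> {1..Y}"
      then have "\<beta> a \<in> {..<B}" using \<beta> by simp
      then have "(\<Sum>\<beta>'<B. if \<beta> a = \<beta>' then v a else 0) = v a" by (subst sum.delta') auto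
      then show "(\<Sum>\<beta>'<B. if d dvd a \<and> \<beta> a = \<beta>' then v a else 0) = (if d dvd a then v a else 0)"
        by (cases "d dvd a") auto
    qed
    finally show ?thesis .
  qed
  have same: "(\<Sum>\<beta>'<B. (y d \<beta>')\<^sup>2) =
      (\<Sum>a\<in>{1..Y}. \<Sum>b\<in>{1..Y}. if \<beta> a = \<beta> b \<and> d dvd a \<and> d dvd b then v a * v b else 0)" for d
  proof -
    have "(\<Sum>\<beta>'<B. (y d \<beta>')\<^sup>2) = (\<Sum>\<beta>'<B. \<Sum>a\<in>{1..Y}. \<Sum>b\<in>{1..Y}.
        (if d dvd a \<and> \<beta> a = \<beta>' then v a else 0) * (if d dvd b \<and> \<beta> b = \<beta>' then v b else 0))"
      by (simp only: y_def power2_eq_square sum_product)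
    also have "\<dots> = (\<Sum>a\<in>{1..Y}. \<Sum>b\<in>{1..Y}. \<Sum>\<beta>'<B.
        (if d dvd a \<and> \<beta> a = \<beta>' then v a else 0) * (if d dvd b \<and> \<beta> b = \<beta>' then v b else 0))"
      by (rule sum_swap3[symmetric])
    also have "\<dots> = (\<Sum>a\<in>{1..Y}. \<Sum>b\<in>{1..Y}. if \<beta> a = \<beta> b \<and> d dvd a \<and> d dvd b then v a * v b else 0)"
    proof (intro sum.cong refl)
      fix a b assume "a \<in> {1..Y}"
      then have "\<beta> a \<in> {..<B}" using \<beta> by simp
      have "(\<Sum>\<beta>'<B. (if d dvd a \<and> \<beta> a = \<beta>' then v a else 0) * (if d dvd b \<and> \<beta> b = \<beta>' then v b else 0)) =
          (\<Sum>\<beta>'<B. if \<beta> a = \<beta>' then (if \<beta> a = \<beta> b \<and> d dvd a \<and> d dvd b then v a * v b else 0) else 0)"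
        by (intro sum.cong) auto
      also have "\<dots> = (if \<beta> a = \<beta> b \<and> d dvd a \<and> d dvd b then v a * v b else 0)"
        using \<open>\<beta> a \<in> {..<B}\<close> by (subst sum.delta') auto
      finally show "(\<Sum>\<beta>'<B. (if d dvd a \<and> \<beta> a = \<beta>' then v a else 0) * (if d dvd b \<and> \<beta> b = \<beta>' then v b else 0)) =
         (if \<beta> a = \<beta> b \<and> d dvd a \<and> d dvd b then v a * v b else 0)" .
    qed
    finally show ?thesis .
  qed
  have expand: "(\<Sum>a\<in>{1..Y}. \<Sum>b\<in>{1..Y}. if R a b then v a * v b * real (gcd a b) else 0) =
      (\<Sum>d\<in>{1..Y}. real (totient d) * (\<Sum>a\<in>{1..Y}. \<Sum>b\<in>{1..Y}. if R a b \<and> d dvd a \<and> d dvd b then v a * v b else 0))"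
    for R :: "nat \<Rightarrow> nat \<Rightarrow> bool"
  proof -
    have "(\<Sum>a\<in>{1..Y}. \<Sum>b\<in>{1..Y}. if R a b then v a * v b * real (gcd a b) else 0) =
       (\<Sum>a\<in>{1..Y}. \<Sum>b\<in>{1..Y}. \<Sum>d\<in>{1..Y}. real (totient d) * (if R a b \<and> d dvd a \<and> d dvd b then v a * v b else 0))"
    proof (intro sum.cong refl)
      fix a b assume a: "a \<in> {1..Y}"
      show "(if R a b then v a * v b * real (gcd a b) else 0) =
        (\<Sum>d\<in>{1..Y}. real (totient d) * (if R a b \<and> d dvd a \<and> d dvd b then v a * v b else 0))"
        unfolding gcd_eq_sum_totient[OF a] by (auto simp: sum_distrib_left intro!: sum.cong)
    qed
    also have "\<dots> = (\<Sum>a\<in>{1..Y}. \<Sum>d\<in>{1..Y}. \<Sum>b\<in>{1..Y}. real (totient d) * (if R a b \<and> d dvd a \<and> d dvd b then v a * v b else 0))"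
      by (rule sum.cong[OF refl], rule sum.swap)
    also have "\<dots> = (\<Sum>d\<in>{1..Y}. \<Sum>a\<in>{1..Y}. \<Sum>b\<in>{1..Y}. real (totient d) * (if R a b \<and> d dvd a \<and> d dvd b then v a * v b else 0))"
      by (rule sum.swap)
    finally show ?thesis by (simp only: sum_distrib_left)
  qed
  have "(\<Sum>a\<in>{1..Y}. \<Sum>b\<in>{1..Y}. v a * v b * real (gcd a b)) =
      (\<Sum>d\<in>{1..Y}. real (totient d) * (\<Sum>a\<in>{1..Y}. \<Sum>b\<in>{1..Y}. if d dvd a \<and> d dvd b then v a * v b else 0))"
    using expand[of "\<lambda>_ _. True"] by simp
  also have "\<dots> = (\<Sum>d\<in>{1..Y}. real (totient d) * (\<Sum>\<beta>'<B. y d \<beta>')\<^sup>2)"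
    unfolding total power2_eq_square sum_product by (intro sum.cong refl arg_cong2[of _ _ _ _ "(*)"]) auto
  also have "\<dots> \<le> (\<Sum>d\<in>{1..Y}. real (totient d) * (real B * (\<Sum>\<beta>'<B. (y d \<beta>')\<^sup>2)))"
    using sum_squared_le_sum_of_squares[of _ "{..<B}"]
    by (intro sum_mono mult_left_mono) (auto simp: mult.commute)
  also have "\<dots> = real B * (\<Sum>a\<in>{1..Y}. \<Sum>b\<in>{1..Y}. if \<beta> a = \<beta> b then v a * v b * real (gcd a b) else 0)"
    unfolding same expand by (simp add: sum_distrib_left mult_ac)
  finally show ?thesis .
qed

text \<open>After the sum over the shifts every term is nonnegative, so pairs \<open>a\<close>,
  \<open>b\<close> may be dropped. Kept are those with equal integer part of the logarithm: there
  the Fejer weight is large, and \<open>gcd_sum_same_class_ge\<close> restores the full form at the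
  cost of the number of classes, at most \<open>B\<close>.\<close>

lemma char_avg_sum_resonator_ge:
  fixes r :: "nat \<Rightarrow> real"
  assumes q: "prime q" and XY: "X * Y < q" and YX: "Y \<le> X" and N: "N \<ge> 1"
    and r: "\<And>a. r a \<ge> 0" and B: "real B \<ge> ln (real Y) + 1"
  shows "real B * (\<Sum>j<N. \<Sum>l<N. char_avg q (\<lambda>\<xi>. (cmod (\<Sum>n\<in>{1..X}. \<xi> (int n)))\<^sup>2 *
           (cmod (\<Sum>a\<in>{1..Y}. of_real (r a) * npow ((real j - real l) / real N) a * \<xi> (int a)))\<^sup>2)) \<ge>
     (real N)\<^sup>2 * real X / 16 * (\<Sum>a\<in>{1..Y}. \<Sum>b\<in>{1..Y}. (r a / real a) * (r b / real b) * real (gcd a b))"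
proof -
  define I where "I = {1..X} \<times> {1..Y}"
  define \<nu> where "\<nu> z = fst z * snd z" for z :: "nat \<times> nat"
  have finI: "finite I" by (simp add: I_def)
  have \<nu>: "0 < \<nu> z \<and> \<nu> z < q" if "z \<in> I" for z
  proof
    show "0 < \<nu> z" using that by (auto simp: I_def \<nu>_def)
    have "\<nu> z \<le> X * Y" unfolding \<nu>_def using that by (intro mult_le_mono) (auto simp: I_def)
    then show "\<nu> z < q" using XY by simp
  qed
  define S where "S j l = char_avg q (\<lambda>\<xi>. (cmod (\<Sum>n\<in>{1..X}. \<xi> (int n)))\<^sup>2 *
           (cmod (\<Sum>a\<in>{1..Y}. of_real (r a) * npow ((real j - real l) / real N) a * \<xi> (int a)))\<^sup>2)" for j l :: nat
  define t where "t j l = (real j - real l) / real N" for j l :: nat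
  define w where "w j l z = of_real (r (snd z)) * npow (t j l) (snd z)" for j l and z :: "nat \<times> nat"
  have S: "complex_of_real (S j l) = (\<Sum>z\<in>I. \<Sum>z'\<in>I. if \<nu> z = \<nu> z' then w j l z * cnj (w j l z') else 0)" for j l
  proof -
    have "S j l = char_avg q (\<lambda>\<xi>. (cmod (\<Sum>z\<in>I. w j l z * \<xi> (int (\<nu> z))))\<^sup>2)"
      unfolding S_def char_avg_def
    proof (intro arg_cong2[of _ _ _ _ "(/)"] sum.cong refl)
      fix \<xi> assume "\<xi> \<in> {\<xi>. dirichlet_character q \<xi>}"
      then have c: "dirichlet_character q \<xi>" by simp
      have "(\<Sum>n\<in>{1..X}. \<xi> (int n)) * (\<Sum>a\<in>{1..Y}. of_real (r a) * npow (t j l) a * \<xi> (int a)) =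
        (\<Sum>z\<in>I. w j l z * \<xi> (int (\<nu> z)))"
        unfolding sum_product I_def sum.cartesian_product
        by (intro sum.cong refl) (auto simp: w_def \<nu>_def dirichlet_character_mult[OF c] mult_ac)
      then show "(cmod (\<Sum>n\<in>{1..X}. \<xi> (int n)))\<^sup>2 *
           (cmod (\<Sum>a\<in>{1..Y}. of_real (r a) * npow ((real j - real l) / real N) a * \<xi> (int a)))\<^sup>2 =
           (cmod (\<Sum>z\<in>I. w j l z * \<xi> (int (\<nu> z))))\<^sup>2"
        by (simp add: t_def flip: norm_mult power_mult_distrib)
    qed
    then show ?thesis by (simp only: char_avg_norm_sum_sq[OF q finI \<nu>])
  qed
  have "complex_of_real (\<Sum>j<N. \<Sum>l<N. S j l) =
    (\<Sum>j<N. \<Sum>l<N. \<Sum>z\<in>I. \<Sum>z'\<in>I. if \<nu> z = \<nu> z' then w j l z * cnj (w j l z') else 0)"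
    by (simp add: S)
  also have "\<dots> = (\<Sum>z\<in>I. \<Sum>z'\<in>I. \<Sum>j<N. \<Sum>l<N. if \<nu> z = \<nu> z' then w j l z * cnj (w j l z') else 0)"
  proof -
    have "(\<Sum>j<N. \<Sum>l<N. \<Sum>z\<in>I. \<Sum>z'\<in>I. F j l z z') = (\<Sum>z\<in>I. \<Sum>z'\<in>I. \<Sum>j<N. \<Sum>l<N. F j l z z')"
      for F :: "nat \<Rightarrow> nat \<Rightarrow> nat \<times> nat \<Rightarrow> nat \<times> nat \<Rightarrow> complex"
      by (subst sum_swap3, rule sum.cong[OF refl], rule sum_swap3)
    then show ?thesis .
  qed
  also have "\<dots> = (\<Sum>z\<in>I. \<Sum>z'\<in>I. of_real (if \<nu> z = \<nu> z' then r (snd z) * r (snd z') * fejer_weight N (snd z) (snd z') else 0))"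
  proof (intro sum.cong refl)
    fix z z'
    have "(\<Sum>j<N. \<Sum>l<N. w j l z * cnj (w j l z')) =
      of_real (r (snd z) * r (snd z')) * (\<Sum>j<N. \<Sum>l<N. npow (t j l) (snd z) * cnj (npow (t j l) (snd z')))"
      by (simp add: w_def sum_distrib_left mult_ac)
    also have "\<dots> = of_real (r (snd z) * r (snd z') * fejer_weight N (snd z) (snd z'))"
      unfolding t_def sum_sum_npow_mult_cnj by simp
    finally show "(\<Sum>j<N. \<Sum>l<N. if \<nu> z = \<nu> z' then w j l z * cnj (w j l z') else 0) =
      of_real (if \<nu> z = \<nu> z' then r (snd z) * r (snd z') * fejer_weight N (snd z) (snd z') else 0)" by simp
  qed
  finally have SS: "(\<Sum>j<N. \<Sum>l<N. S j l) =
     (\<Sum>z\<in>I. \<Sum>z'\<in>I. if \<nu> z = \<nu> z' then r (snd z) * r (snd z') * fejer_weight N (snd z) (snd z') else 0)"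
    by (simp only: of_real_sum[symmetric] of_real_eq_iff)
  also have "\<dots> = (\<Sum>a\<in>{1..Y}. \<Sum>b\<in>{1..Y}. \<Sum>m\<in>{1..X}. \<Sum>n\<in>{1..X}.
      if m * a = n * b then r a * r b * fejer_weight N a b else 0)"
  proof -
    have "(\<Sum>z\<in>I. \<Sum>z'\<in>I. if \<nu> z = \<nu> z' then r (snd z) * r (snd z') * fejer_weight N (snd z) (snd z') else 0) =
      (\<Sum>m\<in>{1..X}. \<Sum>a\<in>{1..Y}. \<Sum>n\<in>{1..X}. \<Sum>b\<in>{1..Y}. if m * a = n * b then r a * r b * fejer_weight N a b else 0)"
      by (simp add: I_def sum.cartesian_product' \<nu>_def cong: if_cong)
    also have "\<dots> = (\<Sum>a\<in>{1..Y}. \<Sum>m\<in>{1..X}. \<Sum>n\<in>{1..X}. \<Sum>b\<in>{1..Y}. if m * a = n * b then r a * r b * fejer_weight N a b else 0)"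
      by (rule sum.swap)
    also have "\<dots> = (\<Sum>a\<in>{1..Y}. \<Sum>m\<in>{1..X}. \<Sum>b\<in>{1..Y}. \<Sum>n\<in>{1..X}. if m * a = n * b then r a * r b * fejer_weight N a b else 0)"
      by (rule sum.cong[OF refl], rule sum.cong[OF refl], rule sum.swap)
    also have "\<dots> = (\<Sum>a\<in>{1..Y}. \<Sum>b\<in>{1..Y}. \<Sum>m\<in>{1..X}. \<Sum>n\<in>{1..X}. if m * a = n * b then r a * r b * fejer_weight N a b else 0)"
      by (rule sum.cong[OF refl], rule sum.swap)
    finally show ?thesis .
  qed
  also have "\<dots> = (\<Sum>a\<in>{1..Y}. \<Sum>b\<in>{1..Y}. r a * r b * fejer_weight N a b *
      real (card {(m, n). m \<in> {1..X} \<and> n \<in> {1..X} \<and> m * a = n * b}))"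
  proof (intro sum.cong refl)
    fix a b
    have "(\<Sum>m\<in>{1..X}. \<Sum>n\<in>{1..X}. if m * a = n * b then r a * r b * fejer_weight N a b else 0) =
      (\<Sum>z\<in>{1..X} \<times> {1..X}. if fst z * a = snd z * b then r a * r b * fejer_weight N a b else 0)"
      by (simp add: sum.cartesian_product')
    also have "\<dots> = (\<Sum>z\<in>{z\<in>{1..X} \<times> {1..X}. fst z * a = snd z * b}. r a * r b * fejer_weight N a b)"
      by (rule sum.inter_filter[symmetric]) simp
    also have "{z\<in>{1..X} \<times> {1..X}. fst z * a = snd z * b} = {(m, n). m \<in> {1..X} \<and> n \<in> {1..X} \<and> m * a = n * b}"
      by auto
    finally show "(\<Sum>m\<in>{1..X}. \<Sum>n\<in>{1..X}. if m * a = n * b then r a * r b * fejer_weight N a b else 0) =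
       r a * r b * fejer_weight N a b * real (card {(m, n). m \<in> {1..X} \<and> n \<in> {1..X} \<and> m * a = n * b})"
      by (simp add: mult.commute)
  qed
  finally have SS': "(\<Sum>j<N. \<Sum>l<N. S j l) = (\<Sum>a\<in>{1..Y}. \<Sum>b\<in>{1..Y}. r a * r b * fejer_weight N a b *
      real (card {(m, n). m \<in> {1..X} \<and> n \<in> {1..X} \<and> m * a = n * b}))" .
  define \<beta> where "\<beta> a = nat \<lfloor>ln (real a)\<rfloor>" for a :: nat
  have \<beta>B: "\<beta> a < B" if "a \<in> {1..Y}" for a
  proof -
    have "ln (real a) \<le> ln (real Y)" using that by simp
    then have "ln (real a) < real B" using B by linarith
    moreover have "0 \<le> ln (real a)" using that by simp
    ultimately show ?thesis unfolding \<beta>_def by (simp add: floor_less_iff nat_less_iff)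
  qed
  have key: "(if \<beta> a = \<beta> b then (r a / real a) * (r b / real b) * real (gcd a b) else 0) * ((real N)\<^sup>2 * real X / 16) \<le>
      r a * r b * fejer_weight N a b * real (card {(m, n). m \<in> {1..X} \<and> n \<in> {1..X} \<and> m * a = n * b})"
    if ab: "a \<in> {1..Y}" "b \<in> {1..Y}" for a b
  proof (cases "\<beta> a = \<beta> b")
    case False
    then show ?thesis using r fejer_weight_nonneg by simp
  next
    case True
    have ab1: "a \<ge> 1" "b \<ge> 1" "max a b \<le> X" using ab YX by auto
    have "0 \<le> ln (real a)" "0 \<le> ln (real b)" using ab1 by auto
    then have "\<lfloor>ln (real a)\<rfloor> = \<lfloor>ln (real b)\<rfloor>" using True by (simp add: \<beta>_def nat_eq_iff)
    then have "\<bar>ln (real a) - ln (real b)\<bar> \<le> 1"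
      using floor_correct[of "ln (real a)"] floor_correct[of "ln (real b)"] by linarith
    then have "(real N)\<^sup>2 / 4 * (real (max a b) / (2 * (real a * real b))) * (real X * real (gcd a b) / (2 * real (max a b))) \<le>
      fejer_weight N a b * real (card {(m, n). m \<in> {1..X} \<and> n \<in> {1..X} \<and> m * a = n * b})"
      using ab1 by (intro mult_mono fejer_weight_ge card_equal_multiples_ge fejer_weight_nonneg) auto
    \<comment> \<open>The two maxima cancel, and 16 = 4 * 2 * 2.\<close>
    moreover have "(real N)\<^sup>2 / 4 * (real (max a b) / (2 * (real a * real b))) * (real X * real (gcd a b) / (2 * real (max a b))) =
      (1 / real a) * (1 / real b) * real (gcd a b) * ((real N)\<^sup>2 * real X / 16)"
    proof -
      have "real (max a b) > 0" using ab1 by auto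
      then show ?thesis by (simp add: field_simps del: of_nat_max)
    qed
    ultimately have "(1 / real a) * (1 / real b) * real (gcd a b) * ((real N)\<^sup>2 * real X / 16) \<le>
       fejer_weight N a b * real (card {(m, n). m \<in> {1..X} \<and> n \<in> {1..X} \<and> m * a = n * b})" by linarith
    from mult_left_mono[OF this, of "r a * r b"] show ?thesis using True r
      by (simp add: mult_ac)
  qed
  have "(real N)\<^sup>2 * real X / 16 * (\<Sum>a\<in>{1..Y}. \<Sum>b\<in>{1..Y}. (r a / real a) * (r b / real b) * real (gcd a b)) \<le>
     (real N)\<^sup>2 * real X / 16 * (real B * (\<Sum>a\<in>{1..Y}. \<Sum>b\<in>{1..Y}. if \<beta> a = \<beta> b then (r a / real a) * (r b / real b) * real (gcd a b) else 0))"
    using \<beta>B by (intro mult_left_mono gcd_sum_same_class_ge) auto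
  also have "\<dots> = real B * (\<Sum>a\<in>{1..Y}. \<Sum>b\<in>{1..Y}. (if \<beta> a = \<beta> b then (r a / real a) * (r b / real b) * real (gcd a b) else 0) * ((real N)\<^sup>2 * real X / 16))"
    by (simp only: sum_distrib_right[symmetric]) (simp only: mult_ac)
  also have "\<dots> \<le> real B * (\<Sum>j<N. \<Sum>l<N. S j l)"
    unfolding SS' using key by (intro mult_left_mono sum_mono) auto
  finally show ?thesis by (simp only: S_def)
qed

section \<open>The greatest common divisor form on squarefree integers\<close>

lemma prod_add_Pow:
  fixes f :: "'a \<Rightarrow> bool \<Rightarrow> 'b::comm_ring_1"
  assumes "finite U"
  shows "(\<Prod>p\<in>U. f p True + f p False) = (\<Sum>A\<in>Pow U. \<Prod>p\<in>U. f p (p \<in> A))"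
proof -
  have "(\<Prod>p\<in>U. f p True + f p False) = (\<Sum>A\<in>Pow U. (\<Prod>p\<in>A. f p True) * (\<Prod>p\<in>U - A. f p False))"
    by (rule prod_add[OF assms])
  also have "\<dots> = (\<Sum>A\<in>Pow U. \<Prod>p\<in>U. f p (p \<in> A))"
  proof (intro sum.cong refl)
    fix A assume "A \<in> Pow U"
    then have A: "A \<subseteq> U" by simp
    have "(\<Prod>p\<in>U. f p (p \<in> A)) = (\<Prod>p\<in>U - A. f p (p \<in> A)) * (\<Prod>p\<in>A. f p (p \<in> A))"
      by (rule prod.subset_diff[OF A assms])
    also have "\<dots> = (\<Prod>p\<in>U - A. f p False) * (\<Prod>p\<in>A. f p True)"
      by (intro arg_cong2[of _ _ _ _ "(*)"] prod.cong) auto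
    finally show "(\<Prod>p\<in>A. f p True) * (\<Prod>p\<in>U - A. f p False) = (\<Prod>p\<in>U. f p (p \<in> A))"
      by (simp only: mult.commute)
  qed
  finally show ?thesis .
qed

text \<open>A pair of subsets is an independent choice, at each element, among four cases.\<close>

lemma sum_Pow_Pow_prod:
  fixes h :: "'a \<Rightarrow> bool \<Rightarrow> bool \<Rightarrow> 'b::comm_ring_1"
  assumes "finite U"
  shows "(\<Sum>A\<in>Pow U. \<Sum>B\<in>Pow U. \<Prod>p\<in>U. h p (p \<in> A) (p \<in> B)) =
           (\<Prod>p\<in>U. (h p True True + h p True False) + (h p False True + h p False False))"
proof -
  have "(\<Sum>A\<in>Pow U. \<Sum>B\<in>Pow U. \<Prod>p\<in>U. h p (p \<in> A) (p \<in> B)) =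
      (\<Sum>A\<in>Pow U. \<Prod>p\<in>U. h p (p \<in> A) True + h p (p \<in> A) False)"
    by (intro sum.cong refl prod_add_Pow[OF assms, symmetric])
  also have "\<dots> = (\<Prod>p\<in>U. (h p True True + h p True False) + (h p False True + h p False False))"
    by (rule prod_add_Pow[OF assms, of "\<lambda>p a. h p a True + h p a False", symmetric])
  finally show ?thesis .
qed

lemma one_plus_ge_exp:
  fixes u :: real
  assumes "u \<ge> 0"
  shows "exp (u - u\<^sup>2) \<le> 1 + u"
proof (cases "u \<le> 1")
  case True
  then have "u - u\<^sup>2 \<le> ln (1 + u)" using assms by (intro ln_one_plus_pos_lower_bound)
  then have "exp (u - u\<^sup>2) \<le> exp (ln (1 + u))" by (simp only: exp_le_cancel_iff)
  then show ?thesis using assms by simp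
next
  case False
  then have "u * 1 \<le> u * u" by (intro mult_left_mono) auto
  then have "exp (u - u\<^sup>2) \<le> exp 0" by (simp only: exp_le_cancel_iff) (simp add: power2_eq_square)
  then show ?thesis using assms unfolding exp_zero by linarith
qed

lemma prime_mass_eq: "prime_mass J = (\<Sum>p\<in>(\<Union>i<J. prime_block i). 1 / real p)"
  unfolding prime_mass_def
  by (rule sum.UNION_disjoint[symmetric]) (auto simp: finite_prime_block dest: prime_block_disjoint)

lemma prime_mass_nonneg: "prime_mass J \<ge> 0"
  unfolding prime_mass_def by (intro sum_nonneg) auto

text \<open>Only squarefree indices \<open>\<Prod>A\<close>, \<open>\<Prod>B\<close> are kept.
  Without degree restrictions the form factorises: a prime in one of the sets contributes
  \<open>\<kappa> / p\<close>, a prime in both \<open>\<kappa> ^ 2 / p ^ 2 * p\<close>, which gives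
  the Euler factor \<open>1 + c / p\<close>. Pairs that violate a degree restriction are removed by
  Rankin's trick with base 3; for \<open>M\<close> as large as assumed they make up at most half of
  the product.\<close>

lemma gcd_form_ge:
  fixes \<kappa> :: real and r :: "nat \<Rightarrow> real"
  defines "c \<equiv> \<kappa>\<^sup>2 + 2 * \<kappa>"
  assumes \<kappa>0: "\<kappa> > 0" and M: "real M \<ge> 3 + 8 * \<kappa> + 6 * \<kappa>\<^sup>2"
    and r0: "\<And>a. r a \<ge> 0" and rY: "\<And>a. r a \<noteq> 0 \<Longrightarrow> a \<in> {1..Y}"
    and rA: "\<And>A. A \<subseteq> (\<Union>i<J. prime_block i) \<Longrightarrow> (\<And>i. i < J \<Longrightarrow> card (A \<inter> prime_block i) \<le> M * (J - i)) \<Longrightarrow>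
       \<kappa> ^ card A \<le> r (\<Prod>A)"
  shows "(\<Sum>a\<in>{1..Y}. \<Sum>b\<in>{1..Y}. (r a / real a) * (r b / real b) * real (gcd a b)) \<ge>
           exp (c * prime_mass J - c\<^sup>2) / 2"
proof -
  have \<kappa>: "\<kappa> \<ge> 0" using \<kappa>0 by simp
  define U where "U = (\<Union>i<J. prime_block i)"
  have finU: "finite U" by (simp add: U_def finite_prime_block)
  have prU: "prime p" if "p \<in> U" for p using that by (auto simp: U_def prime_block_def)
  have p1: "real p \<ge> 1" if "p \<in> U" for p using prime_ge_1_nat[OF prU[OF that]] by simp
  define N where "N i = M * (J - i)" for i
  define good where "good = {A. A \<subseteq> U \<and> (\<forall>i<J. card (A \<inter> prime_block i) \<le> N i)}"
  have goodU: "good \<subseteq> Pow U" by (auto simp: good_def)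
  have fing: "finite good" using goodU finU by (meson finite_Pow_iff finite_subset)
  have finA: "finite A" if "A \<subseteq> U" for A using that finU finite_subset by blast
  have prime_fact: "prime_factorization (\<Prod>A) = mset_set A" if "A \<subseteq> U" for A
    using prime_factorization_prod_primes[OF finA[OF that]] that prU by blast
  have inj: "inj_on Prod (Pow U)"
  proof (rule inj_onI)
    fix A B assume AB: "A \<in> Pow U" "B \<in> Pow U" "\<Prod>A = \<Prod>B"
    then have "mset_set A = mset_set B" using prime_fact[of A] prime_fact[of B] by simp
    then show "A = B" using finA AB by (metis PowD finite_set_mset_mset_set)
  qed
  have prodpos: "\<Prod>A > 0" if "A \<subseteq> U" for A
    using that prU by (intro prod_pos) (auto dest!: subsetD prime_gt_0_nat)
  \<comment> \<open>Local factor at \<open>p\<close>; its last component is the contribution of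
    \<open>p\<close> to the greatest common divisor.\<close>
  define h where "h p a b = (if a then \<kappa> / real p else 1) * (if b then \<kappa> / real p else 1) * (if a \<and> b then real p else 1)"
    for p :: nat and a b
  define \<theta> where "\<theta> A B = (\<Prod>p\<in>U. h p (p \<in> A) (p \<in> B))" for A B
  have h0: "h p a b \<ge> 0" for p a b using \<kappa> by (simp add: h_def)
  have \<theta>0: "\<theta> A B \<ge> 0" for A B unfolding \<theta>_def using h0 by (intro prod_nonneg) auto
  define F where "F a b = (r a / real a) * (r b / real b) * real (gcd a b)" for a b :: nat
  have F0: "F a b \<ge> 0" for a b using r0 by (simp add: F_def)
  have \<theta>F: "\<theta> A B \<le> F (\<Prod>A) (\<Prod>B)" if AB: "A \<in> good" "B \<in> good" for A B
  proof -
    have sub: "A \<subseteq> U" "B \<subseteq> U" using AB goodU by auto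
    have restrict: "(\<Prod>p\<in>U. if p \<in> C then g p else 1) = (\<Prod>p\<in>C. g p)" if "C \<subseteq> U" for C and g :: "nat \<Rightarrow> real"
      using that finU by (subst prod.inter_restrict[symmetric]) (auto simp: Int_absorb1)
    have pw: "(\<Prod>p\<in>C. \<kappa> / real p) = \<kappa> ^ card C / real (\<Prod>C)" for C
      by (simp add: prod_dividef)
    have "\<theta> A B = (\<Prod>p\<in>A. \<kappa> / real p) * (\<Prod>p\<in>B. \<kappa> / real p) * (\<Prod>p\<in>A \<inter> B. real p)"
      unfolding \<theta>_def h_def prod.distrib
      using restrict[OF sub(1), of "\<lambda>p. \<kappa> / real p"] restrict[OF sub(2), of "\<lambda>p. \<kappa> / real p"]
        restrict[of "A \<inter> B" real] sub by auto
    also have "\<dots> = (\<kappa> ^ card A / real (\<Prod>A)) * (\<kappa> ^ card B / real (\<Prod>B)) * real (\<Prod>(A \<inter> B))"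
      by (simp only: pw of_nat_prod)
    also have "\<dots> \<le> F (\<Prod>A) (\<Prod>B)"
      unfolding F_def
    proof (intro mult_mono divide_right_mono)
      show "\<kappa> ^ card A \<le> r (\<Prod>A)" "\<kappa> ^ card B \<le> r (\<Prod>B)"
        using AB by (auto intro!: rA simp: good_def U_def N_def)
      have "\<Prod>(A \<inter> B) dvd gcd (\<Prod>A) (\<Prod>B)"
        using finA sub by (intro gcd_greatest prod_dvd_prod_subset) auto
      moreover have "gcd (\<Prod>A) (\<Prod>B) > 0" using prodpos[OF sub(1)] by simp
      ultimately show "real (\<Prod>(A \<inter> B)) \<le> real (gcd (\<Prod>A) (\<Prod>B))"
        by (simp only: of_nat_le_iff dvd_imp_le)
    qed (use \<kappa> r0 in \<open>auto simp del: of_nat_prod intro!: mult_nonneg_nonneg divide_nonneg_nonneg\<close>)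
    finally show ?thesis .
  qed
  have "(\<Sum>A\<in>good. \<Sum>B\<in>good. \<theta> A B) \<le> (\<Sum>A\<in>good. \<Sum>B\<in>good. F (\<Prod>A) (\<Prod>B))"
    using \<theta>F by (intro sum_mono) auto
  also have "\<dots> = (\<Sum>a\<in>Prod ` good. \<Sum>b\<in>Prod ` good. F a b)"
    using inj_on_subset[OF inj goodU] by (simp add: sum.reindex)
  also have "\<dots> \<le> (\<Sum>a\<in>{1..Y}. \<Sum>b\<in>{1..Y}. F a b)"
  proof -
    have "Prod ` good \<subseteq> {1..Y}"
    proof
      fix a assume "a \<in> Prod ` good"
      then obtain A where A: "A \<in> good" "a = \<Prod>A" by blast
      then have "\<kappa> ^ card A \<le> r a" by (auto intro!: rA simp: good_def U_def N_def)
      moreover have "\<kappa> ^ card A > 0" using \<kappa>0 by simp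
      ultimately have "r a \<noteq> 0" by linarith
      then show "a \<in> {1..Y}" by (rule rY)
    qed
    then have "(\<Sum>a\<in>Prod ` good. \<Sum>b\<in>Prod ` good. F a b) \<le> (\<Sum>a\<in>Prod ` good. \<Sum>b\<in>{1..Y}. F a b)"
      using F0 by (intro sum_mono sum_mono2) auto
    also have "\<dots> \<le> (\<Sum>a\<in>{1..Y}. \<Sum>b\<in>{1..Y}. F a b)"
      using F0 \<open>Prod ` good \<subseteq> {1..Y}\<close> by (intro sum_mono2 sum_nonneg) auto
    finally show ?thesis .
  qed
  finally have low: "(\<Sum>A\<in>good. \<Sum>B\<in>good. \<theta> A B) \<le> (\<Sum>a\<in>{1..Y}. \<Sum>b\<in>{1..Y}. F a b)" .
  define Full where "Full = (\<Prod>p\<in>U. 1 + c / real p)"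
  have full: "(\<Sum>A\<in>Pow U. \<Sum>B\<in>Pow U. \<theta> A B) = Full"
    unfolding \<theta>_def sum_Pow_Pow_prod[OF finU] Full_def
    by (intro prod.cong refl) (use p1 in \<open>force simp: h_def c_def power2_eq_square field_simps\<close>)
  have c0: "c \<ge> 0" using \<kappa> by (simp add: c_def)
  have Full0: "Full \<ge> 0" unfolding Full_def using c0 by (intro prod_nonneg) auto
  \<comment> \<open>With the weight 3 for primes of \<open>A\<close>, the Euler factor on block
    \<open>i\<close> is \<open>1 + (\<kappa> + 3 * \<kappa> + 3 * \<kappa> ^ 2) / p\<close>. The
    block has mass at most 2, hence \<open>exp (2 * D)\<close>; the hypothesis on \<open>M\<close>
    is \<open>M \<ge> 3 + 2 * D\<close>.\<close>
  define D where "D = 4 * \<kappa> + 3 * \<kappa>\<^sup>2"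
  have D0: "D \<ge> 0" using \<kappa> by (simp add: D_def)
  have tail: "(\<Sum>A\<in>Pow U. \<Sum>B\<in>Pow U. \<theta> A B * 3 ^ card (A \<inter> prime_block i)) \<le> Full * exp (2 * D)"
    if i: "i < J" for i
  proof -
    have PiU: "prime_block i \<subseteq> U" using i by (auto simp: U_def)
    have pw: "(3::real) ^ card (A \<inter> prime_block i) = (\<Prod>p\<in>U. if p \<in> A \<and> p \<in> prime_block i then 3 else 1)" if "A \<subseteq> U" for A
    proof -
      have "(\<Prod>p\<in>U. if p \<in> A \<inter> prime_block i then 3 else 1 :: real) = (\<Prod>p\<in>U \<inter> (A \<inter> prime_block i). 3)"
        using finU by (rule prod.inter_restrict[symmetric])
      also have "U \<inter> (A \<inter> prime_block i) = A \<inter> prime_block i" using that by blast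
      finally show ?thesis by simp
    qed
    define h' where "h' p a b = h p a b * (if a \<and> p \<in> prime_block i then 3 else 1)" for p a b
    have "(\<Sum>A\<in>Pow U. \<Sum>B\<in>Pow U. \<theta> A B * 3 ^ card (A \<inter> prime_block i)) =
       (\<Sum>A\<in>Pow U. \<Sum>B\<in>Pow U. \<Prod>p\<in>U. h' p (p \<in> A) (p \<in> B))"
      by (intro sum.cong refl) (simp add: \<theta>_def h'_def pw prod.distrib)
    also have "\<dots> = (\<Prod>p\<in>U. (h' p True True + h' p True False) + (h' p False True + h' p False False))"
      by (rule sum_Pow_Pow_prod[OF finU])
    also have "\<dots> \<le> (\<Prod>p\<in>U. (1 + c / real p) * (if p \<in> prime_block i then 1 + D / real p else 1))"
    proof (intro prod_mono conjI)
      fix p assume p: "p \<in> U"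
      show "0 \<le> (h' p True True + h' p True False) + (h' p False True + h' p False False)"
        using h0 by (auto simp: h'_def intro!: add_nonneg_nonneg mult_nonneg_nonneg)
      show "(h' p True True + h' p True False) + (h' p False True + h' p False False) \<le>
          (1 + c / real p) * (if p \<in> prime_block i then 1 + D / real p else 1)"
      proof (cases "p \<in> prime_block i")
        case True
        have "(h' p True True + h' p True False) + (h' p False True + h' p False False) = 1 + D / real p"
          using True p1[OF p] by (simp add: h'_def h_def D_def power2_eq_square field_simps)
        also have "\<dots> \<le> (1 + c / real p) * (1 + D / real p)"
          using mult_right_mono[of 1 "1 + c / real p" "1 + D / real p"] c0 D0 by simp
        finally show ?thesis using True by simp
      next
        case False
        then show ?thesis
          using p1[OF p] by (simp add: h'_def h_def c_def power2_eq_square field_simps)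
      qed
    qed
    also have "\<dots> = Full * (\<Prod>p\<in>U. if p \<in> prime_block i then 1 + D / real p else 1)"
      by (simp add: Full_def prod.distrib)
    also have "(\<Prod>p\<in>U. if p \<in> prime_block i then 1 + D / real p else 1) = (\<Prod>p\<in>prime_block i. 1 + D / real p)"
      using finU PiU by (subst prod.inter_restrict[symmetric]) (auto simp: Int_absorb1)
    also have "\<dots> \<le> (\<Prod>p\<in>prime_block i. exp (D * (1 / real p)))"
      using D0 by (intro prod_mono) (auto intro: add_nonneg_nonneg)
    also have "\<dots> = exp (D * (\<Sum>p\<in>prime_block i. 1 / real p))"
      by (simp add: exp_sum finite_prime_block sum_distrib_left)
    also have "\<dots> \<le> exp (2 * D)"
      using mult_left_mono[OF sum_prime_block_le[of i] D0] by (simp add: mult.commute)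
    finally show ?thesis using Full0 by (simp add: mult_left_mono)
  qed
  have tail': "(\<Sum>A\<in>Pow U. \<Sum>B\<in>Pow U. \<theta> A B * 3 ^ card (B \<inter> prime_block i)) \<le> Full * exp (2 * D)"
    if i: "i < J" for i
  proof -
    have sym: "\<theta> A B = \<theta> B A" for A B
      unfolding \<theta>_def by (intro prod.cong refl) (auto simp: h_def)
    have "(\<Sum>A\<in>Pow U. \<Sum>B\<in>Pow U. \<theta> A B * 3 ^ card (B \<inter> prime_block i)) =
      (\<Sum>B\<in>Pow U. \<Sum>A\<in>Pow U. \<theta> A B * 3 ^ card (B \<inter> prime_block i))" by (rule sum.swap)
    also have "\<dots> = (\<Sum>B\<in>Pow U. \<Sum>A\<in>Pow U. \<theta> B A * 3 ^ card (B \<inter> prime_block i))"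
      by (intro sum.cong refl arg_cong2[of _ _ _ _ "(*)"] sym)
    finally show ?thesis using tail[OF i] by simp
  qed
  have bad: "\<theta> A B \<le> (if A \<in> good \<and> B \<in> good then \<theta> A B else 0) +
      (\<Sum>i<J. exp (- real (N i)) * (\<theta> A B * 3 ^ card (A \<inter> prime_block i) + \<theta> A B * 3 ^ card (B \<inter> prime_block i)))"
    if AB: "A \<in> Pow U" "B \<in> Pow U" for A B
  proof -
    have nn: "exp (- real (N i)) * (\<theta> A B * 3 ^ card (A \<inter> prime_block i) + \<theta> A B * 3 ^ card (B \<inter> prime_block i)) \<ge> 0" for i
      using \<theta>0 by simp
    show ?thesis
    proof (cases "A \<in> good \<and> B \<in> good")
      case True
      then show ?thesis using sum_nonneg[of "{..<J}", OF nn] by simp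
    next
      case False
      then obtain i where i: "i < J" "card (A \<inter> prime_block i) > N i \<or> card (B \<inter> prime_block i) > N i"
        using AB by (auto simp: good_def not_le)
      have e3: "1 \<le> exp (- real (N i)) * 3 ^ m" if "m > N i" for m
      proof -
        have "exp (real (N i)) = exp 1 ^ N i" by (simp add: exp_of_nat_mult[symmetric])
        also have "\<dots> \<le> 3 ^ N i" using exp_le by (intro power_mono) auto
        also have "\<dots> \<le> 3 ^ m" using that by (intro power_increasing) auto
        finally show ?thesis by (simp add: exp_minus field_simps)
      qed
      have "1 \<le> exp (- real (N i)) * (3 ^ card (A \<inter> prime_block i) + 3 ^ card (B \<inter> prime_block i))"
        using i(2)
      proof
        assume "card (A \<inter> prime_block i) > N i"
        from e3[OF this] show ?thesis by (simp add: distrib_left add_increasing2)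
      next
        assume "card (B \<inter> prime_block i) > N i"
        from e3[OF this] show ?thesis by (simp add: distrib_left add_increasing)
      qed
      from mult_left_mono[OF this \<theta>0[of A B]]
      have "\<theta> A B \<le> exp (- real (N i)) * (\<theta> A B * 3 ^ card (A \<inter> prime_block i) + \<theta> A B * 3 ^ card (B \<inter> prime_block i))"
        by (simp add: algebra_simps)
      also have "\<dots> \<le> (\<Sum>i<J. exp (- real (N i)) * (\<theta> A B * 3 ^ card (A \<inter> prime_block i) + \<theta> A B * 3 ^ card (B \<inter> prime_block i)))"
        using i(1) nn by (intro member_le_sum) auto
      finally show ?thesis using False unfolding if_not_P[OF False] by linarith
    qed
  qed
  have "Full \<le> (\<Sum>A\<in>Pow U. \<Sum>B\<in>Pow U. (if A \<in> good \<and> B \<in> good then \<theta> A B else 0) +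
      (\<Sum>i<J. exp (- real (N i)) * (\<theta> A B * 3 ^ card (A \<inter> prime_block i) + \<theta> A B * 3 ^ card (B \<inter> prime_block i))))"
    unfolding full[symmetric] by (intro sum_mono bad)
  also have "\<dots> = (\<Sum>A\<in>Pow U. \<Sum>B\<in>Pow U. if A \<in> good \<and> B \<in> good then \<theta> A B else 0) +
      (\<Sum>i<J. exp (- real (N i)) * ((\<Sum>A\<in>Pow U. \<Sum>B\<in>Pow U. \<theta> A B * 3 ^ card (A \<inter> prime_block i)) +
         (\<Sum>A\<in>Pow U. \<Sum>B\<in>Pow U. \<theta> A B * 3 ^ card (B \<inter> prime_block i))))"
    unfolding sum.distrib
    by (subst sum_swap3) (simp add: sum_distrib_left sum.distrib distrib_left)
  also have "(\<Sum>A\<in>Pow U. \<Sum>B\<in>Pow U. if A \<in> good \<and> B \<in> good then \<theta> A B else 0) = (\<Sum>A\<in>good. \<Sum>B\<in>good. \<theta> A B)"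
  proof -
    have "(\<Sum>B\<in>Pow U. if A \<in> good \<and> B \<in> good then \<theta> A B else 0) = (if A \<in> good then \<Sum>B\<in>good. \<theta> A B else 0)" for A
    proof (cases "A \<in> good")
      case True
      then show ?thesis using goodU finU by (simp add: sum.inter_restrict[symmetric] Int_absorb1)
    qed simp
    then show ?thesis using goodU finU by (simp add: sum.inter_restrict[symmetric] Int_absorb1)
  qed
  also have "(\<Sum>i<J. exp (- real (N i)) * ((\<Sum>A\<in>Pow U. \<Sum>B\<in>Pow U. \<theta> A B * 3 ^ card (A \<inter> prime_block i)) +
         (\<Sum>A\<in>Pow U. \<Sum>B\<in>Pow U. \<theta> A B * 3 ^ card (B \<inter> prime_block i)))) \<le> (\<Sum>i<J. exp (- real (N i)) * (Full * exp (2 * D) + Full * exp (2 * D)))"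
    using tail tail' by (intro sum_mono mult_left_mono add_mono) auto
  also have "\<dots> = (\<Sum>i<J. exp (- real (N i))) * (2 * exp (2 * D)) * Full"
    by (simp add: sum_distrib_right sum_distrib_left mult_ac)
  also have "(\<Sum>i<J. exp (- real (N i))) * (2 * exp (2 * D)) * Full \<le> 1 / 2 * Full"
  proof (rule mult_right_mono[OF _ Full0])
    \<comment> \<open>As \<open>J - i \<ge> 1\<close>, the degree \<open>M * (J - i)\<close> is at
      least \<open>(M - 1) + (J - i)\<close>: the first part gives smallness, the second
      convergence.\<close>
    have "(\<Sum>i<J. exp (- real (N i))) \<le> (\<Sum>i<J. exp (1 - real M) * exp (- real (1 * (J - i))))"
    proof (rule sum_mono)
      fix i assume "i \<in> {..<J}"
      then have ji: "real (J - i) \<ge> 1" by simp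
      have "M \<ge> 1"
      proof -
        have "real M \<ge> 3" using M \<kappa> by (smt (verit) mult_nonneg_nonneg zero_le_power2)
        then show ?thesis by simp
      qed
      then have "0 \<le> (real M - 1) * (real (J - i) - 1)" using ji by (intro mult_nonneg_nonneg) auto
      also have "\<dots> = real M * real (J - i) - real M - real (J - i) + 1"
        by (simp only: left_diff_distrib right_diff_distrib mult_1 mult_1_right)
      finally have "- real (N i) \<le> (1 - real M) + - real (1 * (J - i))"
        unfolding N_def of_nat_mult by simp
      then show "exp (- real (N i)) \<le> exp (1 - real M) * exp (- real (1 * (J - i)))"
        unfolding exp_add[symmetric] exp_le_cancel_iff .
    qed
    also have "\<dots> = exp (1 - real M) * (\<Sum>i<J. exp (- real (1 * (J - i))))" by (simp only: sum_distrib_left)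
    also have "\<dots> \<le> exp (1 - real M) * 1" by (intro mult_left_mono sum_exp_weights_le) auto
    finally have "(\<Sum>i<J. exp (- real (N i))) * (2 * exp (2 * D)) \<le> exp (1 - real M) * (2 * exp (2 * D))"
      by (intro mult_right_mono) auto
    also have "\<dots> = 2 * exp (1 - real M + 2 * D)" by (simp add: exp_add)
    also have "\<dots> \<le> 2 * exp (- 2)" using M by (simp add: D_def)
    also have "\<dots> \<le> 1 / 2"
    proof -
      have "exp (2::real) = exp 1 * exp 1" by (simp flip: exp_add)
      moreover have "exp 1 * exp 1 \<ge> (2::real) * 2" using exp_ge_add_one_self[of 1] by (intro mult_mono) auto
      ultimately show ?thesis by (simp add: exp_minus field_simps)
    qed
    finally show "(\<Sum>i<J. exp (- real (N i))) * (2 * exp (2 * D)) \<le> 1 / 2" .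
  qed
  finally have "Full / 2 \<le> (\<Sum>A\<in>good. \<Sum>B\<in>good. \<theta> A B)" by simp
  then have "Full / 2 \<le> (\<Sum>a\<in>{1..Y}. \<Sum>b\<in>{1..Y}. F a b)" using low by linarith
  moreover have "exp (c * prime_mass J - c\<^sup>2) \<le> Full"
  proof -
    have "c\<^sup>2 * (\<Sum>p\<in>U. 1 / (real p)\<^sup>2) \<le> c\<^sup>2 * 1"
      using prU finU by (intro mult_left_mono sum_prime_inverse_squares_le) auto
    then have "exp (c * prime_mass J - c\<^sup>2) \<le> exp (c * (\<Sum>p\<in>U. 1 / real p) - c\<^sup>2 * (\<Sum>p\<in>U. 1 / (real p)\<^sup>2))"
      by (simp add: prime_mass_eq U_def)
    also have "\<dots> = (\<Prod>p\<in>U. exp (c / real p - (c / real p)\<^sup>2))"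
      using finU by (simp add: exp_sum[symmetric] sum_subtractf sum_distrib_left power_divide)
    also have "\<dots> \<le> Full"
      unfolding Full_def using c0 by (intro prod_mono conjI one_plus_ge_exp) auto
    finally show ?thesis .
  qed
  ultimately show ?thesis by (simp add: F_def)
qed

text \<open>Meant for the principal character. Each block form is bounded by the number of integers
  up to \<open>2 ^ 2 ^ Suc i\<close>; the result is still only a power of \<open>2 ^ 2 ^ J\<close>,
  which is small against \<open>y\<close>.\<close>

lemma norm_resonator_le:
  fixes \<kappa> :: real
  assumes \<kappa>: "\<kappa> \<ge> 1" and M: "M \<ge> 1" and f: "\<And>n. cmod (f n) \<le> 1" and A: "3 * \<kappa> \<le> 2 ^ A"
  shows "cmod (resonator \<kappa> M J t f) \<le> 2 ^ (4 * M * (A + 1) * 2 ^ J)"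
proof -
  have bound: "cmod (trunc_exp N (of_real \<kappa> * block_form i t f)) \<le> 2 ^ ((A + 1) * (2 ^ Suc i * N))"
    if N: "N \<ge> 1" for N i
  proof -
    define z :: real where "z = 2 ^ 2 ^ Suc i"
    have z: "z \<ge> 1" by (simp add: z_def)
    have "cmod (block_form i t f) \<le> (\<Sum>p\<in>prime_block i. 1)"
      unfolding block_form_def linear_form_def
    proof (rule sum_norm_le)
      fix p assume "p \<in> prime_block i"
      then have p1: "p \<ge> 1" using prime_ge_1_nat by (auto simp: prime_block_def)
      then have "real p powr - (1 / 2) \<le> real p powr 0" by (intro powr_mono) auto
      then have "cmod (npow t p) \<le> 1" using p1 by (simp add: npow_def norm_mult)
      then show "cmod (npow t p * f p) \<le> 1" using f[of p] by (simp add: norm_mult mult_le_one)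
    qed
    also have "\<dots> = real (card (prime_block i))" by simp
    also have "card (prime_block i) \<le> card {1..2 ^ 2 ^ Suc i :: nat}"
      using prime_ge_1_nat by (intro card_mono) (auto simp: prime_block_def)
    then have "real (card (prime_block i)) \<le> real (2 ^ 2 ^ Suc i)" by (simp only: card_atLeastAtMost of_nat_le_iff)
    also have "\<dots> = z" by (simp add: z_def)
    finally have bz: "cmod (of_real \<kappa> * block_form i t f) \<le> \<kappa> * z" using \<kappa> by (simp add: norm_mult)
    have kz: "1 \<le> \<kappa> * z" using mult_mono[OF \<kappa> z] \<kappa> by simp
    have "cmod (trunc_exp N (of_real \<kappa> * block_form i t f)) \<le> (\<Sum>m\<le>N. (\<kappa> * z) ^ N * (1 ^ m / fact m))"
    proof (rule order_trans[OF norm_trunc_exp_le], rule sum_mono)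
      fix m assume m: "m \<in> {..N}"
      have "cmod (of_real \<kappa> * block_form i t f) ^ m \<le> (\<kappa> * z) ^ m" using bz by (intro power_mono) auto
      also have "\<dots> \<le> (\<kappa> * z) ^ N" using kz m by (intro power_increasing) auto
      finally show "cmod (of_real \<kappa> * block_form i t f) ^ m / fact m \<le> (\<kappa> * z) ^ N * (1 ^ m / fact m)"
        by (simp add: divide_right_mono)
    qed
    also have "\<dots> = (\<kappa> * z) ^ N * (\<Sum>m\<le>N. 1 ^ m / fact m)" by (simp only: sum_distrib_left)
    also have "\<dots> \<le> (\<kappa> * z) ^ N * exp 1"
      using kz by (intro mult_left_mono sum_power_fact_le_exp) auto
    also have "\<dots> \<le> (\<kappa> * z) ^ N * 3 ^ N"
    proof (rule mult_left_mono)
      have "exp 1 \<le> (3::real)" by (rule exp_le)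
      also have "\<dots> \<le> 3 ^ N" using N self_le_power[of "3::real" N] by simp
      finally show "exp 1 \<le> (3::real) ^ N" .
    qed (use kz in auto)
    also have "\<dots> = (3 * \<kappa>) ^ N * z ^ N" by (simp add: power_mult_distrib)
    also have "\<dots> \<le> (2 ^ A) ^ N * z ^ N" using A \<kappa> z by (intro mult_right_mono power_mono) auto
    also have "\<dots> = 2 ^ (A * N + 2 ^ Suc i * N)" by (simp only: z_def power_add power_mult)
    also have "\<dots> \<le> 2 ^ ((A + 1) * (2 ^ Suc i * N))"
    proof (rule power_increasing)
      have "A * N * 1 \<le> A * N * 2 ^ Suc i" by (intro mult_le_mono2) simp
      then show "A * N + 2 ^ Suc i * N \<le> (A + 1) * (2 ^ Suc i * N)" by (simp add: algebra_simps)
    qed simp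
    finally show ?thesis .
  qed
  have "cmod (resonator \<kappa> M J t f) \<le> (\<Prod>i<J. 2 ^ ((A + 1) * (2 ^ Suc i * (M * (J - i)))))"
    unfolding resonator_def prod_norm[symmetric]
  proof (intro prod_mono conjI bound)
    fix i assume "i \<in> {..<J}"
    then have "1 * 1 \<le> M * (J - i)" using M by (intro mult_le_mono) auto
    then show "1 \<le> M * (J - i)" by simp
  qed auto
  also have "\<dots> = 2 ^ (\<Sum>i<J. (A + 1) * (2 ^ Suc i * (M * (J - i))))" by (rule power_sum[symmetric])
  also have "(\<Sum>i<J. (A + 1) * (2 ^ Suc i * (M * (J - i)))) = 2 * M * (A + 1) * (\<Sum>i<J. 2 ^ i * (J - i))"
  proof -
    have "(A + 1) * (2 ^ Suc i * (M * d)) = 2 * M * (A + 1) * (2 ^ i * d)" for i d by (simp add: algebra_simps)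
    then show ?thesis by (simp only: sum_distrib_left)
  qed
  also have "(2::real) ^ \<dots> \<le> 2 ^ (2 * M * (A + 1) * (2 * 2 ^ J))"
    by (intro power_increasing mult_le_mono2 sum_pow2_weights_le) auto
  also have "2 * M * (A + 1) * (2 * 2 ^ J) = 4 * M * (A + 1) * 2 ^ J" by simp
  finally show ?thesis .
qed

subsection \<open>Averages over shifts\<close>

text \<open>The difference \<open>d = j - l\<close> occurs \<open>2 ^ J - \<bar>d\<bar>\<close>
  times, so the square at shift \<open>d / 2 ^ J\<close> carries the triangular weight
  \<open>1 - \<bar>d\<bar> / 2 ^ J\<close>, at most 1.\<close>

definition weight :: "real \<Rightarrow> nat \<Rightarrow> nat \<Rightarrow> (nat \<Rightarrow> complex) \<Rightarrow> real" where
  "weight \<kappa> M J f =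
     (\<Sum>j<2 ^ J. \<Sum>l<2 ^ J. (cmod (resonator \<kappa> M J ((real j - real l) / real (2 ^ J)) f))\<^sup>2) / 2 ^ J"

lemma weight_nonneg: "weight \<kappa> M J f \<ge> 0"
  by (auto simp: weight_def intro!: divide_nonneg_nonneg sum_nonneg)

lemma weight_le:
  "weight \<kappa> M J f \<le> (\<Sum>d\<in>{- (2 ^ J)..2 ^ J :: int}. (cmod (resonator \<kappa> M J (of_int d / 2 ^ J) f))\<^sup>2)"
proof -
  define g where "g d = (cmod (resonator \<kappa> M J (of_int d / 2 ^ J) f))\<^sup>2" for d :: int
  have "(\<Sum>l<2 ^ J. (cmod (resonator \<kappa> M J ((real j - real l) / real (2 ^ J)) f))\<^sup>2) \<le> (\<Sum>d\<in>{- (2 ^ J)..2 ^ J}. g d)"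
    if j: "j < 2 ^ J" for j :: nat
  proof -
    have inj: "inj_on (\<lambda>l. int j - int l) {..<2 ^ J}" by (auto simp: inj_on_def)
    have "int j < int (2 ^ J)" using j by (simp only: of_nat_less_iff)
    moreover have "int l < int (2 ^ J)" if "l < 2 ^ J" for l using that by (simp only: of_nat_less_iff)
    ultimately have sub: "(\<lambda>l. int j - int l) ` {..<2 ^ J} \<subseteq> {- (2 ^ J)..2 ^ J}"
    proof (intro image_subsetI)
      fix l :: nat assume jl: "int j < int (2 ^ J)" "\<And>l. l < 2 ^ J \<Longrightarrow> int l < int (2 ^ J)" "l \<in> {..<2 ^ J}"
      then have "int l < int (2 ^ J)" by blast
      moreover have "int (2 ^ J) = 2 ^ J" by simp
      ultimately show "int j - int l \<in> {- (2 ^ J)..2 ^ J}" using jl(1) unfolding atLeastAtMost_iff by linarith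
    qed
    have "(\<Sum>l<2 ^ J. (cmod (resonator \<kappa> M J ((real j - real l) / real (2 ^ J)) f))\<^sup>2) = (\<Sum>l<2 ^ J. g (int j - int l))"
      by (simp add: g_def)
    also have "\<dots> = (\<Sum>d\<in>(\<lambda>l. int j - int l) ` {..<2 ^ J}. g d)" by (simp add: sum.reindex[OF inj])
    also have "\<dots> \<le> (\<Sum>d\<in>{- (2 ^ J)..2 ^ J}. g d)" using sub by (intro sum_mono2) (auto simp: g_def)
    finally show ?thesis .
  qed
  then have "(\<Sum>j<2 ^ J. \<Sum>l<2 ^ J. (cmod (resonator \<kappa> M J ((real j - real l) / real (2 ^ J)) f))\<^sup>2) \<le>
      (\<Sum>j<(2::nat) ^ J. \<Sum>d\<in>{- (2 ^ J)..2 ^ J}. g d)" by (intro sum_mono) auto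
  also have "\<dots> = 2 ^ J * (\<Sum>d\<in>{- (2 ^ J)..2 ^ J}. g d)" by simp
  finally show ?thesis by (simp add: weight_def g_def field_simps)
qed

text \<open>Once the sum is normalised to 1, every term lies in [0, 1], where
  \<open>u \<le> u powr p\<close>.\<close>

lemma sum_powr_le:
  fixes a :: "'i \<Rightarrow> real"
  assumes p: "0 < p" "p \<le> 1" and I: "finite I" and a: "\<And>i. i \<in> I \<Longrightarrow> a i \<ge> 0"
  shows "(\<Sum>i\<in>I. a i) powr p \<le> (\<Sum>i\<in>I. a i powr p)"
proof (cases "(\<Sum>i\<in>I. a i) = 0")
  case True
  then show ?thesis by (simp add: sum_nonneg)
next
  case False
  define S where "S = (\<Sum>i\<in>I. a i)"
  have S: "S > 0" using False a by (simp add: S_def order_less_le sum_nonneg)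
  have "1 = (\<Sum>i\<in>I. a i / S)" using S by (simp add: S_def sum_divide_distrib[symmetric])
  also have "\<dots> \<le> (\<Sum>i\<in>I. (a i / S) powr p)"
  proof (rule sum_mono)
    fix i assume i: "i \<in> I"
    have le: "a i \<le> S" unfolding S_def using i I a by (intro member_le_sum) auto
    show "a i / S \<le> (a i / S) powr p"
    proof (cases "a i = 0")
      case False
      then have "0 < a i / S" "a i / S \<le> 1" using a[OF i] S le by auto
      then have "(a i / S) powr 1 \<le> (a i / S) powr p" using p by (intro powr_mono') auto
      then show ?thesis using \<open>0 < a i / S\<close> by (simp only: powr_one less_imp_le)
    qed simp
  qed
  also have "\<dots> = (\<Sum>i\<in>I. a i powr p) / S powr p"
    using a S by (simp add: powr_divide sum_divide_distrib)
  finally show ?thesis using S by (simp add: S_def field_simps)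
qed

lemma weight_powr_le:
  assumes \<kappa>: "\<kappa> \<ge> 1" and M: "M \<ge> 1"
  shows "weight \<kappa> M J f powr (1 + 1 / \<kappa>) \<le>
     (\<Sum>d\<in>{- (2 ^ J)..2 ^ J :: int}. \<Sum>d'\<in>{- (2 ^ J)..2 ^ J :: int}.
        (cmod (resonator \<kappa> M J (of_int d / 2 ^ J) f))\<^sup>2 * majorant \<kappa> M J (of_int d' / 2 ^ J) f)"
proof -
  define g where "g d = cmod (resonator \<kappa> M J (of_int d / 2 ^ J) f)" for d :: int
  define I where "I = {- (2 ^ J)..2 ^ J :: int}"
  have le: "weight \<kappa> M J f \<le> (\<Sum>d\<in>I. (g d)\<^sup>2)" unfolding g_def I_def by (rule weight_le)
  have "weight \<kappa> M J f powr (1 / \<kappa>) \<le> (\<Sum>d\<in>I. (g d)\<^sup>2) powr (1 / \<kappa>)"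
    using le weight_nonneg \<kappa> by (intro powr_mono2) auto
  also have "\<dots> \<le> (\<Sum>d\<in>I. (g d)\<^sup>2 powr (1 / \<kappa>))"
    using \<kappa> by (intro sum_powr_le) (auto simp: I_def)
  also have "\<dots> = (\<Sum>d\<in>I. g d powr (2 / \<kappa>))"
  proof (intro sum.cong refl)
    fix d
    have "g d \<ge> 0" by (simp add: g_def)
    then have "(g d)\<^sup>2 = g d powr 2" by (cases "g d = 0") (auto simp: powr_numeral)
    then show "(g d)\<^sup>2 powr (1 / \<kappa>) = g d powr (2 / \<kappa>)" by (simp add: powr_powr)
  qed
  also have "\<dots> \<le> (\<Sum>d\<in>I. majorant \<kappa> M J (of_int d / 2 ^ J) f)"
    unfolding g_def using resonator_powr_le_majorant[OF \<kappa> M] by (intro sum_mono)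
  finally have 2: "weight \<kappa> M J f powr (1 / \<kappa>) \<le> (\<Sum>d\<in>I. majorant \<kappa> M J (of_int d / 2 ^ J) f)" .
  have "weight \<kappa> M J f powr (1 + 1 / \<kappa>) = weight \<kappa> M J f * weight \<kappa> M J f powr (1 / \<kappa>)"
    using weight_nonneg by (simp add: powr_mult_base)
  also have "\<dots> \<le> (\<Sum>d\<in>I. (g d)\<^sup>2) * (\<Sum>d\<in>I. majorant \<kappa> M J (of_int d / 2 ^ J) f)"
    using le 2 by (intro mult_mono) (auto intro: sum_nonneg)
  finally show ?thesis by (simp add: sum_product g_def I_def)
qed

lemma sum_int_inverse_squares_le:
  fixes d :: int
  assumes "finite I"
  shows "(\<Sum>d'\<in>I. 1 / (1 + real_of_int \<bar>d - d'\<bar>)\<^sup>2) \<le> 4"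
proof -
  have half: "(\<Sum>d'\<in>S. 1 / (1 + real_of_int \<bar>d - d'\<bar>)\<^sup>2) \<le> 2"
    if S: "finite S" "inj_on (\<lambda>d'. nat (1 + \<bar>d - d'\<bar>)) S" for S
  proof -
    define m where "m = Max (insert 1 ((\<lambda>d'. nat (1 + \<bar>d - d'\<bar>)) ` S))"
    have sub: "(\<lambda>d'. nat (1 + \<bar>d - d'\<bar>)) ` S \<subseteq> {1..m}"
    proof
      fix n assume n: "n \<in> (\<lambda>d'. nat (1 + \<bar>d - d'\<bar>)) ` S"
      then have "n \<le> m" unfolding m_def using S(1) by (intro Max_ge) auto
      moreover have "1 \<le> n" using n by auto
      ultimately show "n \<in> {1..m}" by simp
    qed
    have "(\<Sum>d'\<in>S. 1 / (1 + real_of_int \<bar>d - d'\<bar>)\<^sup>2) = (\<Sum>d'\<in>S. 1 / (real (nat (1 + \<bar>d - d'\<bar>)))\<^sup>2)"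
      by (intro sum.cong refl) simp
    also have "\<dots> = (\<Sum>n\<in>(\<lambda>d'. nat (1 + \<bar>d - d'\<bar>)) ` S. 1 / (real n)\<^sup>2)"
      by (simp add: sum.reindex[OF S(2)])
    also have "\<dots> \<le> (\<Sum>n\<in>{1..m}. 1 / (real n)\<^sup>2)" using sub by (intro sum_mono2) auto
    also have "\<dots> \<le> 2" by (rule sum_inverse_squares_le)
    finally show ?thesis .
  qed
  have "I = {d'\<in>I. d' \<le> d} \<union> {d'\<in>I. d < d'}" by auto
  then have "(\<Sum>d'\<in>I. 1 / (1 + real_of_int \<bar>d - d'\<bar>)\<^sup>2) =
      (\<Sum>d'\<in>{d'\<in>I. d' \<le> d}. 1 / (1 + real_of_int \<bar>d - d'\<bar>)\<^sup>2) + (\<Sum>d'\<in>{d'\<in>I. d < d'}. 1 / (1 + real_of_int \<bar>d - d'\<bar>)\<^sup>2)"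
    using assms by (subst sum.union_disjoint[symmetric]) auto
  also have "\<dots> \<le> 2 + 2"
    using assms by (intro add_mono half) (auto simp: inj_on_def)
  finally show ?thesis by simp
qed

text \<open>For each fixed shift the decay in the distance sums to at most 4, and there are at most
  \<open>3 * 2 ^ J\<close> shifts, whence 12.\<close>

lemma char_avg_weight_powr_le:
  fixes \<kappa> :: real
  assumes q: "prime q" "2 ^ (8 * M * 2 ^ J) < q" and \<kappa>: "\<kappa> \<ge> 1"
    and M: "M \<ge> 1" "real M \<ge> 172800 * \<kappa>\<^sup>2"
  shows "char_avg q (\<lambda>\<xi>. weight \<kappa> M J (\<lambda>n. \<xi> (int n)) powr (1 + 1 / \<kappa>)) \<le>
     12 * 2 ^ J * (upper_const \<kappa> * exp ((\<kappa> + 1)\<^sup>2 * prime_mass J))"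
proof -
  define I where "I = {- (2 ^ J)..2 ^ J :: int}"
  define U where "U = upper_const \<kappa> * exp ((\<kappa> + 1)\<^sup>2 * prime_mass J)"
  have U0: "U \<ge> 0" by (simp add: U_def upper_const_def)
  have "char_avg q (\<lambda>\<xi>. weight \<kappa> M J (\<lambda>n. \<xi> (int n)) powr (1 + 1 / \<kappa>)) \<le>
    char_avg q (\<lambda>\<xi>. \<Sum>d\<in>I. \<Sum>d'\<in>I. (cmod (resonator \<kappa> M J (of_int d / 2 ^ J) (\<lambda>n. \<xi> (int n))))\<^sup>2 *
        majorant \<kappa> M J (of_int d' / 2 ^ J) (\<lambda>n. \<xi> (int n)))"
    unfolding I_def by (intro char_avg_mono weight_powr_le \<kappa> M)
  also have "\<dots> = (\<Sum>d\<in>I. \<Sum>d'\<in>I. char_avg q (\<lambda>\<xi>. (cmod (resonator \<kappa> M J (of_int d / 2 ^ J) (\<lambda>n. \<xi> (int n))))\<^sup>2 *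
        majorant \<kappa> M J (of_int d' / 2 ^ J) (\<lambda>n. \<xi> (int n))))"
    by (simp only: char_avg_sum)
  also have "\<dots> \<le> (\<Sum>d\<in>I. \<Sum>d'\<in>I. U * (1 / (1 + real_of_int \<bar>d - d'\<bar>)\<^sup>2))"
  proof (intro sum_mono)
    fix d d' assume "d \<in> I" "d' \<in> I"
    then have "\<bar>d - d'\<bar> \<le> 2 * 2 ^ J" by (auto simp: I_def)
    from char_avg_resonator_majorant_le[OF q \<kappa> M this]
    show "char_avg q (\<lambda>\<xi>. (cmod (resonator \<kappa> M J (of_int d / 2 ^ J) (\<lambda>n. \<xi> (int n))))\<^sup>2 *
        majorant \<kappa> M J (of_int d' / 2 ^ J) (\<lambda>n. \<xi> (int n))) \<le> U * (1 / (1 + real_of_int \<bar>d - d'\<bar>)\<^sup>2)"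
      by (simp add: U_def)
  qed
  also have "\<dots> = (\<Sum>d\<in>I. U * (\<Sum>d'\<in>I. 1 / (1 + real_of_int \<bar>d - d'\<bar>)\<^sup>2))"
    by (simp only: sum_distrib_left)
  also have "\<dots> \<le> (\<Sum>d\<in>I. U * 4)"
    using U0 by (intro sum_mono mult_left_mono sum_int_inverse_squares_le) (auto simp: I_def)
  also have "\<dots> = real (card I) * (U * 4)" by simp
  also have "\<dots> \<le> (3 * 2 ^ J) * (U * 4)"
  proof (rule mult_right_mono)
    have "card I = nat (2 * 2 ^ J + 1)" by (simp add: I_def)
    then have "real (card I) = 2 * 2 ^ J + 1" by (simp add: of_nat_nat)
    also have "\<dots> \<le> 3 * 2 ^ J" by simp
    finally show "real (card I) \<le> 3 * 2 ^ J" .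
  qed (use U0 in simp)
  finally show ?thesis by (simp add: U_def mult_ac)
qed

section \<open>Hoelder's inequality and the principal character\<close>

text \<open>Young's inequality, term by term, after scaling by \<open>\<tau>\<close>. With
  \<open>k'\<close> the conjugate exponent, \<open>\<tau>\<close> is chosen such that
  \<open>\<tau> powr k' * B = A\<close>: the dual part is then at most \<open>A / k'\<close>, and
  \<open>A / k\<close> remains for the moment. Only bounds for the two averages enter, not their
  values.\<close>

lemma holder_lower_bound:
  fixes s w :: "'a \<Rightarrow> real"
  assumes k: "k > 1" and c: "c \<ge> 0" and A: "A > 0" and B: "B > 0"
    and s: "\<And>i. i \<in> I \<Longrightarrow> s i \<ge> 0" and w: "\<And>i. i \<in> I \<Longrightarrow> w i \<ge> 0"
    and low: "A \<le> c * (\<Sum>i\<in>I. s i * w i)" and up: "c * (\<Sum>i\<in>I. w i powr (1 + 1 / (k - 1))) \<le> B"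
  shows "A powr k / B powr (k - 1) \<le> c * (\<Sum>i\<in>I. s i powr k)"
proof -
  define k' where "k' = 1 + 1 / (k - 1)"
  have k': "k' > 1" "1 / k + 1 / k' = 1" using k by (simp_all add: k'_def field_simps)
  define \<tau> where "\<tau> = (A / B) powr (1 / k')"
  have \<tau>: "\<tau> > 0" using A B by (simp add: \<tau>_def)
  have \<tau>k': "\<tau> powr k' = A / B" using A B k' by (simp add: \<tau>_def powr_powr)
  have \<tau>k: "\<tau> powr k = (A / B) powr (k - 1)"
  proof -
    have "1 / k' * k = k - 1" using k by (simp add: k'_def field_simps)
    then show ?thesis by (simp add: \<tau>_def powr_powr)
  qed
  have young: "s i * w i \<le> (s i powr k / \<tau> powr k) / k + (\<tau> powr k' * w i powr k') / k'" if i: "i \<in> I" for i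
  proof -
    have "(s i / \<tau>) * (\<tau> * w i) \<le> (s i / \<tau>) powr k / k + (\<tau> * w i) powr k' / k'"
      using k k' s[OF i] w[OF i] \<tau> by (intro Youngs_inequality) auto
    then show ?thesis using \<tau> s[OF i] w[OF i] by (simp add: powr_divide powr_mult)
  qed
  have "A \<le> c * (\<Sum>i\<in>I. s i * w i)" by (rule low)
  also have "\<dots> \<le> c * (\<Sum>i\<in>I. (s i powr k / \<tau> powr k) / k + (\<tau> powr k' * w i powr k') / k')"
    using c by (intro mult_left_mono sum_mono young) auto
  also have "\<dots> = (c * (\<Sum>i\<in>I. s i powr k)) / (\<tau> powr k * k) + \<tau> powr k' / k' * (c * (\<Sum>i\<in>I. w i powr k'))"
    by (simp add: sum.distrib sum_distrib_left sum_divide_distrib field_simps)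
  also have "\<dots> \<le> (c * (\<Sum>i\<in>I. s i powr k)) / (\<tau> powr k * k) + \<tau> powr k' / k' * B"
    using up k' unfolding k'_def[symmetric] by (intro add_mono mult_left_mono) auto
  also have "\<tau> powr k' / k' * B = A / k'" using B \<tau>k' by simp
  also have "A / k' = A - A / k"
  proof -
    have "1 / k' = 1 - 1 / k" using k' by simp
    then have "A * (1 / k') = A * (1 - 1 / k)" by simp
    then show ?thesis by (simp add: right_diff_distrib)
  qed
  finally have "A / k \<le> (c * (\<Sum>i\<in>I. s i powr k)) / (\<tau> powr k * k)" by simp
  then have "A * \<tau> powr k \<le> c * (\<Sum>i\<in>I. s i powr k)" using k \<tau> by (simp add: field_simps)
  also have "A * \<tau> powr k = A powr k / B powr (k - 1)"
    unfolding \<tau>k using A B by (simp add: powr_divide powr_diff)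
  finally show ?thesis .
qed

lemma char_avg_split_principal:
  assumes "q > 0"
  shows "char_avg q F = (\<Sum>\<xi> | dirichlet_character q \<xi> \<and> \<xi> \<noteq> principal_character q. F \<xi>) / of_nat (totient q)
           + F (principal_character q) / of_nat (totient q)"
proof -
  have "(\<Sum>\<xi> | dirichlet_character q \<xi>. F \<xi>) =
     F (principal_character q) + (\<Sum>\<xi>\<in>{\<xi>. dirichlet_character q \<xi>} - {principal_character q}. F \<xi>)"
    using finite_dirichlet_characters[OF assms] dirichlet_character_principal by (intro sum.remove) auto
  moreover have "{\<xi>. dirichlet_character q \<xi>} - {principal_character q} =
      {\<xi>. dirichlet_character q \<xi> \<and> \<xi> \<noteq> principal_character q}" by auto
  ultimately show ?thesis by (simp add: char_avg_def add_divide_distrib add.commute)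
qed

lemma char_avg_weight_ge:
  fixes \<kappa> :: real
  defines "c \<equiv> \<kappa>\<^sup>2 + 2 * \<kappa>"
  assumes q: "prime q" and \<kappa>: "\<kappa> \<ge> 1" and M: "M \<ge> 1" "real M \<ge> 3 + 8 * \<kappa> + 6 * \<kappa>\<^sup>2"
    and X: "X * 2 ^ (4 * M * 2 ^ J) < q" "2 ^ (4 * M * 2 ^ J) \<le> X"
  shows "char_avg q (\<lambda>\<xi>. (cmod (\<Sum>n\<in>{1..X}. \<xi> (int n)))\<^sup>2 * weight \<kappa> M J (\<lambda>n. \<xi> (int n))) \<ge>
     real X / (160 * real M) * exp (c * prime_mass J - c\<^sup>2)"
proof -
  define Y :: nat where "Y = 2 ^ (4 * M * 2 ^ J)"
  define N :: nat where "N = 2 ^ J"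
  \<comment> \<open>\<open>ln Y \<le> 4 * M * N\<close> because \<open>ln 2 \<le> 1\<close>, and one
    more \<open>M * N\<close> pays for the added 1. Since \<open>B\<close> is proportional to the
    number of shifts, the loss from the classes is offset by the sum over the shifts.\<close>
  define B where "B = 5 * M * N"
  obtain r :: "nat \<Rightarrow> real" where r0: "\<And>a. r a \<ge> 0"
    and rY: "\<And>a. r a \<noteq> 0 \<Longrightarrow> a \<in> {1..2 ^ (4 * M * 2 ^ J)}"
    and rR: "\<And>t f. completely_mult f \<Longrightarrow> f 0 = 0 \<Longrightarrow>
       resonator \<kappa> M J t f = (\<Sum>a\<in>{1..2 ^ (4 * M * 2 ^ J)}. of_real (r a) * npow t a * f a)"
    and rA: "\<And>A. A \<subseteq> (\<Union>i<J. prime_block i) \<Longrightarrow> (\<And>i. i < J \<Longrightarrow> card (A \<inter> prime_block i) \<le> M * (J - i)) \<Longrightarrow>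
       \<kappa> ^ card A \<le> r (\<Prod>A)"
    using resonator_expansion[of \<kappa> M J] \<kappa> by (smt (verit, best))
  have N1: "N \<ge> 1" by (simp add: N_def)
  have Bln: "real B \<ge> ln (real Y) + 1"
  proof -
    have "ln (real Y) = real (4 * M * N) * ln 2" by (simp add: Y_def N_def ln_realpow)
    also have "\<dots> \<le> real (4 * M * N) * 1" using ln_le_minus_one[of 2] by (intro mult_left_mono) auto
    finally have "ln (real Y) \<le> real (4 * M * N)" by simp
    moreover have "1 * 1 \<le> M * N" using M(1) N1 by (intro mult_le_mono) auto
    then have "real 1 \<le> real (M * N)" by (simp only: of_nat_le_iff)
    ultimately show ?thesis by (simp add: B_def)
  qed
  define S where "S j l = char_avg q (\<lambda>\<xi>. (cmod (\<Sum>n\<in>{1..X}. \<xi> (int n)))\<^sup>2 *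
           (cmod (resonator \<kappa> M J ((real j - real l) / real N) (\<lambda>n. \<xi> (int n))))\<^sup>2)" for j l :: nat
  have S: "S j l = char_avg q (\<lambda>\<xi>. (cmod (\<Sum>n\<in>{1..X}. \<xi> (int n)))\<^sup>2 *
           (cmod (\<Sum>a\<in>{1..Y}. of_real (r a) * npow ((real j - real l) / real N) a * \<xi> (int a)))\<^sup>2)" for j l
    unfolding S_def char_avg_def
  proof (intro arg_cong2[of _ _ _ _ "(/)"] sum.cong refl)
    fix \<xi> assume "\<xi> \<in> {\<xi>. dirichlet_character q \<xi>}"
    then have c: "dirichlet_character q \<xi>" by simp
    have "\<xi> (int 0) = 0" using dirichlet_character_eq_0_iff[OF c, of 0] prime_gt_1_nat[OF q] by simp
    then show "(cmod (\<Sum>n\<in>{1..X}. \<xi> (int n)))\<^sup>2 * (cmod (resonator \<kappa> M J ((real j - real l) / real N) (\<lambda>n. \<xi> (int n))))\<^sup>2 =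
       (cmod (\<Sum>n\<in>{1..X}. \<xi> (int n)))\<^sup>2 *
           (cmod (\<Sum>a\<in>{1..Y}. of_real (r a) * npow ((real j - real l) / real N) a * \<xi> (int a)))\<^sup>2"
      by (subst rR[OF completely_mult_character[OF c]]) (simp_all add: Y_def)
  qed
  define \<Phi> where "\<Phi> = (\<Sum>a\<in>{1..Y}. \<Sum>b\<in>{1..Y}. (r a / real a) * (r b / real b) * real (gcd a b))"
  have "(real N)\<^sup>2 * real X / 16 * \<Phi> \<le> real B * (\<Sum>j<N. \<Sum>l<N. S j l)"
    unfolding \<Phi>_def S using X by (intro char_avg_sum_resonator_ge q N1 r0 Bln) (auto simp: Y_def)
  also have "(\<Sum>j<N. \<Sum>l<N. S j l) =
      real N * char_avg q (\<lambda>\<xi>. (cmod (\<Sum>n\<in>{1..X}. \<xi> (int n)))\<^sup>2 * weight \<kappa> M J (\<lambda>n. \<xi> (int n)))"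
  proof -
    have "(\<Sum>j<N. \<Sum>l<N. S j l) = char_avg q (\<lambda>\<xi>. \<Sum>j<N. \<Sum>l<N. (cmod (\<Sum>n\<in>{1..X}. \<xi> (int n)))\<^sup>2 *
           (cmod (resonator \<kappa> M J ((real j - real l) / real N) (\<lambda>n. \<xi> (int n))))\<^sup>2)"
      unfolding S_def by (simp only: char_avg_sum)
    also have "\<dots> = char_avg q (\<lambda>\<xi>. real N * ((cmod (\<Sum>n\<in>{1..X}. \<xi> (int n)))\<^sup>2 * weight \<kappa> M J (\<lambda>n. \<xi> (int n))))"
      by (simp add: weight_def N_def sum_distrib_left[symmetric])
    also have "\<dots> = real N * char_avg q (\<lambda>\<xi>. (cmod (\<Sum>n\<in>{1..X}. \<xi> (int n)))\<^sup>2 * weight \<kappa> M J (\<lambda>n. \<xi> (int n)))"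
      by (simp add: char_avg_def sum_distrib_left[symmetric])
    finally show ?thesis .
  qed
  finally have "real X / 16 * \<Phi> \<le> 5 * real M * char_avg q (\<lambda>\<xi>. (cmod (\<Sum>n\<in>{1..X}. \<xi> (int n)))\<^sup>2 * weight \<kappa> M J (\<lambda>n. \<xi> (int n)))"
    using N1 by (simp add: B_def power2_eq_square field_simps)
  moreover have "real X / 16 * (exp (c * prime_mass J - c\<^sup>2) / 2) \<le> real X / 16 * \<Phi>"
    unfolding \<Phi>_def Y_def c_def using \<kappa> M(2) r0 rY rA by (intro mult_left_mono gcd_form_ge) auto
  ultimately have "real X / 16 * (exp (c * prime_mass J - c\<^sup>2) / 2) \<le>
     5 * real M * char_avg q (\<lambda>\<xi>. (cmod (\<Sum>n\<in>{1..X}. \<xi> (int n)))\<^sup>2 * weight \<kappa> M J (\<lambda>n. \<xi> (int n)))"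
    by linarith
  then show ?thesis using M(1) by (simp add: field_simps)
qed

subsection \<open>The moment bound\<close>

lemma sum_floor_interval:
  "(\<Sum>n\<in>{1..\<lfloor>x\<rfloor>}. F n) = (\<Sum>n\<in>{1..nat \<lfloor>x\<rfloor>}. F (int n))"
  by (rule sum.reindex_bij_witness[where i = int and j = nat]) auto

lemma nonprincipal_moment_eq:
  "nonprincipal_moment q k x = 1 / real (totient q) *
     (\<Sum>\<xi> | dirichlet_character q \<xi> \<and> \<xi> \<noteq> principal_character q.
        ((cmod (\<Sum>n\<in>{1..nat \<lfloor>x\<rfloor>}. \<xi> (int n)))\<^sup>2) powr k)"
proof -
  have "v powr (2 * k) = (v\<^sup>2) powr k" if "v \<ge> 0" for v :: real
  proof -
    have "v\<^sup>2 = v powr 2" using that by (cases "v = 0") (auto simp: powr_numeral)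
    then show ?thesis by (simp only: powr_powr)
  qed
  then show ?thesis unfolding nonprincipal_moment_def sum_floor_interval by simp
qed

lemma sum_principal_character:
  assumes q: "prime q" and X: "X < q"
  shows "(\<Sum>n\<in>{1..X}. principal_character q (int n)) = of_nat X"
proof -
  have "principal_character q (int n) = 1" if n: "n \<in> {1..X}" for n
  proof -
    have "\<not> q dvd n" using n X by (auto dest: dvd_imp_le)
    then have "coprime q n" using q by (simp add: prime_imp_coprime)
    then show ?thesis by (simp add: principal_character_def coprime_commute)
  qed
  then show ?thesis by simp
qed

text \<open>Hoelder's inequality with constant weight: the second moment over all characters is
  exactly the number \<open>X\<close> of terms. This serves for bounded \<open>y\<close>, where the
  logarithm is a constant.\<close>

lemma nonprincipal_moment_ge_power:
  assumes q: "prime q" "q > 2" and k: "k > 1" and x: "1 \<le> x" "x \<le> real q / 2"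
  shows "nonprincipal_moment q k x \<ge> (x / 4) powr k"
proof -
  define X where "X = nat \<lfloor>x\<rfloor>"
  define I where "I = {\<xi>. dirichlet_character q \<xi> \<and> \<xi> \<noteq> principal_character q}"
  have fin: "finite I" unfolding I_def
    by (rule finite_subset[OF _ finite_dirichlet_characters[of q]]) (use q in auto)
  have tot: "real (totient q) = real q - 1" using q by (simp add: totient_prime of_nat_diff)
  have Xx: "real X \<le> x" "x < real X + 1" using x by (simp_all add: X_def)
  have X1: "real X \<ge> x / 2"
  proof -
    have "1 \<le> X" using x by (simp add: X_def le_nat_floor)
    then show ?thesis using Xx by linarith
  qed
  have "real (2 * X) \<le> real q" using Xx x by simp
  then have "2 * X \<le> q" by (simp only: of_nat_le_iff)
  \<comment> \<open>Oddness sharpens \<open>2 * X \<le> q\<close> to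
    \<open>2 * X \<le> q - 1\<close>, so the principal character takes at most half of the second
    moment.\<close>
  moreover have "odd q" using q prime_odd_nat by blast
  ultimately have "2 * X \<le> q - 1" by (metis Suc_leI diff_Suc_1 dvd_triv_left le_eq_less_or_eq le_diff_conv2 Suc_eq_plus1 add_leD2 prime_ge_1_nat q(1))
  then have Xq: "2 * real X \<le> real q - 1" using q by linarith
  have Xlt: "X < q" using Xq by linarith
  have "complex_of_real (char_avg q (\<lambda>\<xi>. (cmod (\<Sum>n\<in>{1..X}. 1 * \<xi> (int n)))\<^sup>2)) =
      (\<Sum>i\<in>{1..X}. \<Sum>j\<in>{1..X}. if i = j then 1 * cnj 1 else 0)"
    using Xlt by (intro char_avg_norm_sum_sq q) auto
  also have "\<dots> = of_real (real X)" by simp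
  finally have avg: "char_avg q (\<lambda>\<xi>. (cmod (\<Sum>n\<in>{1..X}. \<xi> (int n)))\<^sup>2) = real X"
    by (simp only: of_real_eq_iff mult_1)
  have "real X = (\<Sum>\<xi>\<in>I. (cmod (\<Sum>n\<in>{1..X}. \<xi> (int n)))\<^sup>2) / real (totient q) + (real X)\<^sup>2 / real (totient q)"
    using char_avg_split_principal[of q "\<lambda>\<xi>. (cmod (\<Sum>n\<in>{1..X}. \<xi> (int n)))\<^sup>2"] q
    unfolding avg sum_principal_character[OF q(1) Xlt] by (simp add: I_def)
  moreover have "(real X)\<^sup>2 / real (totient q) \<le> real X / 2"
  proof -
    have "real X * (2 * real X) \<le> real X * (real q - 1)" using Xq by (intro mult_left_mono) auto
    then show ?thesis using q unfolding tot by (simp add: field_simps power2_eq_square)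
  qed
  ultimately have "x / 4 \<le> (\<Sum>\<xi>\<in>I. (cmod (\<Sum>n\<in>{1..X}. \<xi> (int n)))\<^sup>2) / real (totient q)"
    using X1 by linarith
  then have low: "x / 4 \<le> 1 / real (totient q) * (\<Sum>\<xi>\<in>I. (cmod (\<Sum>n\<in>{1..X}. \<xi> (int n)))\<^sup>2 * 1)"
    by simp
  have "(x / 4) powr k / 1 powr (k - 1) \<le>
      1 / real (totient q) * (\<Sum>\<xi>\<in>I. ((cmod (\<Sum>n\<in>{1..X}. \<xi> (int n)))\<^sup>2) powr k)"
  proof (rule holder_lower_bound[where w = "\<lambda>_. 1" and s = "\<lambda>\<xi>. (cmod (\<Sum>n\<in>{1..X}. \<xi> (int n)))\<^sup>2"])
    have "card I \<le> card {\<xi>. dirichlet_character q \<xi>}"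
      using finite_dirichlet_characters[of q] q by (intro card_mono) (auto simp: I_def)
    then have "card I \<le> totient q" using card_dirichlet_characters[OF q(1)] by simp
    then show "1 / real (totient q) * (\<Sum>i\<in>I. 1 powr (1 + 1 / (k - 1))) \<le> 1"
      using q by (simp add: divide_le_eq)
  qed (use low k x in auto)
  then show ?thesis by (simp add: nonprincipal_moment_eq I_def X_def)
qed

text \<open>What is left of the Hoelder quotient once the powers of \<open>x\<close> and of
  \<open>2 ^ J\<close> are taken out. The last factor stems from the constant in
  \<open>sum_prime_blocks_inverse_ge\<close>.\<close>

definition lower_const :: "real \<Rightarrow> nat \<Rightarrow> real" where
  "lower_const \<kappa> M = (1 / (640 * real M * exp ((\<kappa>\<^sup>2 + 2 * \<kappa>)\<^sup>2))) powr (\<kappa> + 1) /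
     (12 * upper_const \<kappa>) powr \<kappa> * exp (- (\<kappa> * (\<kappa> + 1) * (ln 24 + 5)))"

lemma lower_const_pos: "M \<ge> 1 \<Longrightarrow> lower_const \<kappa> M > 0"
  by (simp add: lower_const_def upper_const_def)

text \<open>\<open>E\<close> is so large that \<open>2 ^ (E * 2 ^ J) \<le> y\<close> implies all
  length conditions and bounds the weight at the principal character by \<open>sqrt y\<close>. That
  character then contributes at most \<open>2 * x / sqrt y\<close>, which the hypothesis on
  \<open>sqrt y\<close> makes at most half of the main term.\<close>

lemma nonprincipal_moment_ge_blocks:
  fixes \<kappa> x y :: real and M A J q :: nat
  defines "E \<equiv> 4 * (4 * M * (A + 1)) + 8"
  assumes \<kappa>: "\<kappa> \<ge> 1" and M: "M \<ge> 1" "real M \<ge> 172800 * \<kappa>\<^sup>2" and A: "3 * \<kappa> \<le> 2 ^ A"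
    and q: "prime q" "q > 2" and x: "1 \<le> x" "x \<le> real q / 2" and y: "y \<le> x" "y \<le> real q / x"
    and J: "2 ^ (E * 2 ^ J) \<le> y" and y0: "1280 * real M * exp ((\<kappa>\<^sup>2 + 2 * \<kappa>)\<^sup>2) \<le> sqrt y"
  shows "nonprincipal_moment q (\<kappa> + 1) x \<ge> lower_const \<kappa> M * (x powr (\<kappa> + 1) * (2 ^ J) powr (\<kappa>\<^sup>2))"
proof -
  define T :: nat where "T = 2 ^ J"
  define D where "D = 4 * M * (A + 1)"
  define X where "X = nat \<lfloor>x\<rfloor>"
  define c where "c = \<kappa>\<^sup>2 + 2 * \<kappa>"
  define L where "L = prime_mass J"
  define I where "I = {\<xi>. dirichlet_character q \<xi> \<and> \<xi> \<noteq> principal_character q}"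
  define S where "S \<xi> = (cmod (\<Sum>n\<in>{1..X}. \<xi> (int n)))\<^sup>2" for \<xi> :: "int \<Rightarrow> complex"
  define W where "W \<xi> = weight \<kappa> M J (\<lambda>n. \<xi> (int n))" for \<xi> :: "int \<Rightarrow> complex"
  have T1: "T \<ge> 1" by (simp add: T_def)
  have ED: "E = 4 * D + 8" by (simp add: E_def D_def)
  have MD: "4 * M \<le> D" by (simp add: D_def)
  have y1: "y \<ge> 1" using J one_le_power[of "2::real" "E * 2 ^ J"] by linarith
  have J': "2 ^ (E * T) \<le> y" using J by (simp add: T_def)
  have xy: "x * y \<le> real q" using y(2) x by (simp add: field_simps)
  have yy: "y\<^sup>2 \<le> real q"
  proof -
    have "y * y \<le> x * y" using y(1) y1 by (intro mult_right_mono) auto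
    then show ?thesis using xy by (simp add: power2_eq_square)
  qed
  have Xx: "real X \<le> x" "x < real X + 1" using x by (simp_all add: X_def)
  have X1: "real X \<ge> x / 2"
  proof -
    have "1 \<le> X" using x by (simp add: X_def le_nat_floor)
    then show ?thesis using Xx by linarith
  qed
  have lt: "(2::real) ^ (4 * M * T) < y"
  proof -
    have "4 * M * T < E * T" using MD T1 by (intro mult_strict_right_mono) (auto simp: ED)
    then have "(2::real) ^ (4 * M * T) < 2 ^ (E * T)" by (intro power_strict_increasing) auto
    then show ?thesis using J' by linarith
  qed
  have q8: "2 ^ (8 * M * 2 ^ J) < q"
  proof -
    have "(2::real) ^ (8 * M * T) = (2 ^ (4 * M * T))\<^sup>2" by (simp add: power_mult[symmetric] mult_ac)
    also have "\<dots> < y\<^sup>2" using lt by (intro power_strict_mono) auto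
    also have "\<dots> \<le> real q" by (rule yy)
    finally have "real (2 ^ (8 * M * T)) < real q" by simp
    then show ?thesis unfolding of_nat_less_iff T_def .
  qed
  have XYq: "X * 2 ^ (4 * M * 2 ^ J) < q"
  proof -
    have "real X * 2 ^ (4 * M * T) \<le> x * 2 ^ (4 * M * T)" using Xx by (intro mult_right_mono) auto
    also have "\<dots> < x * y" using lt x by (intro mult_strict_left_mono) auto
    also have "\<dots> \<le> real q" by (rule xy)
    finally have "real (X * 2 ^ (4 * M * T)) < real q" by simp
    then show ?thesis unfolding of_nat_less_iff T_def .
  qed
  have YX: "2 ^ (4 * M * 2 ^ J) \<le> X"
  proof -
    have "real (2 ^ (4 * M * T)) \<le> x" using lt y by simp
    then have "2 ^ (4 * M * T) \<le> X" unfolding X_def by (rule le_nat_floor)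
    then show ?thesis by (simp add: T_def)
  qed
  have Xq: "X < q" using Xx x by linarith
  have tot: "real (totient q) = real q - 1" using q by (simp add: totient_prime of_nat_diff)
  have tot_ge: "real (totient q) \<ge> real q / 2" "real (totient q) > 0" using q unfolding tot by linarith+
  have W0: "W \<xi> \<ge> 0" for \<xi> by (simp add: W_def weight_nonneg)
  have Wp: "W (principal_character q) \<le> sqrt y"
  proof -
    have R: "(cmod (resonator \<kappa> M J t (\<lambda>n. principal_character q (int n))))\<^sup>2 \<le> (2 ^ (D * T))\<^sup>2" for t
      using norm_resonator_le[OF \<kappa> M(1) _ A, of "\<lambda>n. principal_character q (int n)" J t]
      by (intro power_mono) (auto simp: D_def T_def principal_character_def)
    have "W (principal_character q) \<le> (\<Sum>j<(2::nat) ^ J. \<Sum>l<(2::nat) ^ J. (2 ^ (D * T))\<^sup>2) / 2 ^ J"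
      unfolding W_def weight_def using R by (intro divide_right_mono sum_mono) auto
    also have "\<dots> = real T * (2 ^ (D * T))\<^sup>2" by (simp add: T_def)
    also have "\<dots> \<le> 2 ^ T * (2 ^ (D * T))\<^sup>2"
      using of_nat_less_two_power[where 'a = real, of T] by (intro mult_right_mono) auto
    also have "\<dots> = 2 ^ (T + 2 * (D * T))" by (simp add: power_add power_mult[symmetric] mult_ac)
    also have "\<dots> \<le> sqrt y"
    proof (rule real_le_rsqrt)
      have "(2 ^ (T + 2 * (D * T)))\<^sup>2 = (2::real) ^ ((4 * D + 2) * T)"
        by (simp add: power_mult[symmetric] algebra_simps)
      also have "\<dots> \<le> 2 ^ (E * T)" by (intro power_increasing mult_le_mono1) (auto simp: ED)
      finally show "(2 ^ (T + 2 * (D * T)))\<^sup>2 \<le> y" using J' by linarith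
    qed
    finally show ?thesis .
  qed
  have Sp: "S (principal_character q) = (real X)\<^sup>2"
    unfolding S_def sum_principal_character[OF q(1) Xq] by simp
  have sy: "sqrt y > 0" "sqrt y * sqrt y = y" using y1 by auto
  have prin: "S (principal_character q) * W (principal_character q) / real (totient q) \<le> 2 * x / sqrt y"
  proof -
    have "S (principal_character q) * W (principal_character q) \<le> x\<^sup>2 * sqrt y"
      unfolding Sp using Xx Wp W0 by (intro mult_mono power_mono) auto
    then have "S (principal_character q) * W (principal_character q) / real (totient q) \<le> x\<^sup>2 * sqrt y / (real q / 2)"
      using tot_ge q sy x by (intro frac_le) auto
    also have "\<dots> \<le> 2 * x / sqrt y"
    proof -
      have "x * (x * y) \<le> x * real q" using xy x by (intro mult_left_mono) auto
      then have "x\<^sup>2 * (sqrt y * sqrt y) \<le> x * real q" by (simp only: sy(2) power2_eq_square mult.assoc)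
      then have "x\<^sup>2 * sqrt y \<le> x * real q / sqrt y" using sy by (simp add: pos_le_divide_eq mult.assoc)
      then have "x\<^sup>2 * sqrt y / (real q / 2) \<le> x * real q / sqrt y / (real q / 2)"
        by (intro divide_right_mono) auto
      also have "\<dots> = 2 * x / sqrt y" using q by simp
      finally show ?thesis .
    qed
    finally show ?thesis .
  qed
  \<comment> \<open>640 = 160 * 2 * 2: one factor 2 from \<open>X \<ge> x / 2\<close>, the other for
    the half given up to the principal character.\<close>
  define A' where "A' = x / (640 * real M) * exp (c * L - c\<^sup>2)"
  define B' where "B' = 12 * 2 ^ J * (upper_const \<kappa> * exp ((\<kappa> + 1)\<^sup>2 * L))"
  have uc: "upper_const \<kappa> > 0" by (simp add: upper_const_def)
  have low: "A' \<le> 1 / real (totient q) * (\<Sum>\<xi>\<in>I. S \<xi> * W \<xi>)"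
  proof -
    have "3 + 8 * \<kappa> + 6 * \<kappa>\<^sup>2 \<le> real M"
    proof -
      have "\<kappa> * 1 \<le> \<kappa> * \<kappa>" "1 \<le> \<kappa> * \<kappa>" using \<kappa> mult_mono[of 1 \<kappa> 1 \<kappa>] by (auto intro: mult_left_mono)
      then show ?thesis using M(2) by (simp add: power2_eq_square)
    qed
    then have "real X / (160 * real M) * exp (c * L - c\<^sup>2) \<le> char_avg q (\<lambda>\<xi>. S \<xi> * W \<xi>)"
      unfolding S_def W_def c_def L_def using XYq YX by (intro char_avg_weight_ge q \<kappa> M) auto
    also have "\<dots> = (\<Sum>\<xi>\<in>I. S \<xi> * W \<xi>) / real (totient q) + S (principal_character q) * W (principal_character q) / real (totient q)"
      unfolding I_def using q by (intro char_avg_split_principal) auto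
    finally have 1: "real X / (160 * real M) * exp (c * L - c\<^sup>2) - 2 * x / sqrt y \<le> (\<Sum>\<xi>\<in>I. S \<xi> * W \<xi>) / real (totient q)"
      using prin by linarith
    have "x / 2 / (160 * real M) * exp (c * L - c\<^sup>2) \<le> real X / (160 * real M) * exp (c * L - c\<^sup>2)"
      using X1 M(1) by (intro mult_right_mono divide_right_mono) auto
    then have 2: "2 * A' \<le> real X / (160 * real M) * exp (c * L - c\<^sup>2)" by (simp add: A'_def)
    have 3: "2 * x / sqrt y \<le> A'"
    proof -
      have "L \<ge> 0" unfolding L_def by (rule prime_mass_nonneg)
      then have "exp (- c\<^sup>2) \<le> exp (c * L - c\<^sup>2)" using \<kappa> by (simp add: c_def)
      then have "x / (640 * real M) * exp (- c\<^sup>2) \<le> A'"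
        unfolding A'_def using x by (intro mult_left_mono) auto
      moreover have "2 * x / sqrt y \<le> 2 * x / (1280 * real M * exp (c\<^sup>2))"
        using y0 x M(1) unfolding c_def by (intro divide_left_mono) (auto intro!: mult_pos_pos sy(1))
      moreover have "2 * x / (1280 * real M * exp (c\<^sup>2)) = x / (640 * real M) * exp (- c\<^sup>2)"
        by (simp add: exp_minus field_simps)
      ultimately show ?thesis by linarith
    qed
    show ?thesis using 1 2 3 by simp
  qed
  have up: "1 / real (totient q) * (\<Sum>\<xi>\<in>I. W \<xi> powr (1 + 1 / (\<kappa> + 1 - 1))) \<le> B'"
  proof -
    have "(\<Sum>\<xi>\<in>I. W \<xi> powr (1 + 1 / \<kappa>)) / real (totient q) \<le> char_avg q (\<lambda>\<xi>. W \<xi> powr (1 + 1 / \<kappa>))"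
      using char_avg_split_principal[of q "\<lambda>\<xi>. W \<xi> powr (1 + 1 / \<kappa>)"] q by (simp add: I_def)
    also have "\<dots> \<le> B'"
      unfolding W_def B'_def L_def by (rule char_avg_weight_powr_le[OF q(1) q8 \<kappa> M])
    finally show ?thesis by simp
  qed
  have "A' powr (\<kappa> + 1) / B' powr (\<kappa> + 1 - 1) \<le> 1 / real (totient q) * (\<Sum>\<xi>\<in>I. S \<xi> powr (\<kappa> + 1))"
  proof (rule holder_lower_bound[OF _ _ _ _ _ _ low up])
    show "A' > 0" using x M(1) by (simp add: A'_def)
    show "B' > 0" using uc by (simp add: B'_def)
  qed (use \<kappa> W0 in \<open>auto simp: S_def\<close>)
  then have main: "A' powr (\<kappa> + 1) / B' powr \<kappa> \<le> nonprincipal_moment q (\<kappa> + 1) x"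
    by (simp add: nonprincipal_moment_eq I_def S_def X_def)
  have "A' powr (\<kappa> + 1) = x powr (\<kappa> + 1) * (1 / (640 * real M * exp (c\<^sup>2))) powr (\<kappa> + 1) * exp (c * L * (\<kappa> + 1))"
  proof -
    have "A' = x * (1 / (640 * real M * exp (c\<^sup>2))) * exp (c * L)"
      by (simp add: A'_def exp_diff)
    moreover have "(x * (1 / (640 * real M * exp (c\<^sup>2))) * exp (c * L)) powr (\<kappa> + 1) =
       x powr (\<kappa> + 1) * (1 / (640 * real M * exp (c\<^sup>2))) powr (\<kappa> + 1) * exp (c * L) powr (\<kappa> + 1)"
      using x by (simp only: powr_mult)
    ultimately show ?thesis by (simp only: exp_powr_real)
  qed
  moreover have "B' powr \<kappa> = (12 * upper_const \<kappa>) powr \<kappa> * (2 ^ J) powr \<kappa> * exp ((\<kappa> + 1)\<^sup>2 * L * \<kappa>)"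
  proof -
    have "B' = (12 * upper_const \<kappa>) * 2 ^ J * exp ((\<kappa> + 1)\<^sup>2 * L)" by (simp add: B'_def)
    then show ?thesis by (simp only: powr_mult exp_powr_real)
  qed
  \<comment> \<open>The exponent of the logarithm arises here: \<open>c * (\<kappa> + 1) - \<kappa>
    * (\<kappa> + 1) ^ 2 = \<kappa> * (\<kappa> + 1)\<close> is the power of \<open>exp L\<close>,
    which is at least a constant times \<open>2 ^ J\<close>, and the number of shifts takes away
    \<open>\<kappa>\<close>.\<close>
  moreover have "(2 ^ J) powr \<kappa> * exp ((\<kappa> + 1)\<^sup>2 * L * \<kappa>) * (exp (- (\<kappa> * (\<kappa> + 1) * (ln 24 + 5))) * (2 ^ J) powr (\<kappa>\<^sup>2)) \<le>
      exp (c * L * (\<kappa> + 1))"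
  proof -
    have p2: "(2 ^ J) powr a = exp (a * (real J * ln 2))" for a :: real
      by (simp add: powr_def ln_realpow)
    have "real J * ln 2 - (ln 24 + 5) \<le> L"
      unfolding L_def prime_mass_def by (rule sum_prime_blocks_inverse_ge)
    then have "\<kappa> * (\<kappa> + 1) * (real J * ln 2 - (ln 24 + 5)) \<le> \<kappa> * (\<kappa> + 1) * L"
      using \<kappa> by (intro mult_left_mono) auto
    then have "\<kappa> * (real J * ln 2) + (\<kappa> + 1)\<^sup>2 * L * \<kappa> + (- (\<kappa> * (\<kappa> + 1) * (ln 24 + 5)) + \<kappa>\<^sup>2 * (real J * ln 2)) \<le> c * L * (\<kappa> + 1)"
      by (simp add: c_def power2_eq_square algebra_simps)
    then show ?thesis unfolding p2 exp_add[symmetric] exp_le_cancel_iff .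
  qed
  ultimately have "lower_const \<kappa> M * (x powr (\<kappa> + 1) * (2 ^ J) powr (\<kappa>\<^sup>2)) \<le> A' powr (\<kappa> + 1) / B' powr \<kappa>"
  proof -
    assume a: "A' powr (\<kappa> + 1) = x powr (\<kappa> + 1) * (1 / (640 * real M * exp (c\<^sup>2))) powr (\<kappa> + 1) * exp (c * L * (\<kappa> + 1))"
      and b: "B' powr \<kappa> = (12 * upper_const \<kappa>) powr \<kappa> * (2 ^ J) powr \<kappa> * exp ((\<kappa> + 1)\<^sup>2 * L * \<kappa>)"
      and d: "(2 ^ J) powr \<kappa> * exp ((\<kappa> + 1)\<^sup>2 * L * \<kappa>) * (exp (- (\<kappa> * (\<kappa> + 1) * (ln 24 + 5))) * (2 ^ J) powr (\<kappa>\<^sup>2)) \<le>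
      exp (c * L * (\<kappa> + 1))"
    define u where "u = x powr (\<kappa> + 1) * (1 / (640 * real M * exp (c\<^sup>2))) powr (\<kappa> + 1)"
    define v where "v = (12 * upper_const \<kappa>) powr \<kappa>"
    define e1 where "e1 = (2 ^ J) powr \<kappa> * exp ((\<kappa> + 1)\<^sup>2 * L * \<kappa>)"
    define e2 where "e2 = exp (- (\<kappa> * (\<kappa> + 1) * (ln 24 + 5))) * (2 ^ J) powr (\<kappa>\<^sup>2)"
    have pos: "u \<ge> 0" "v > 0" "e1 > 0" using uc by (simp_all add: u_def v_def e1_def)
    have "lower_const \<kappa> M * (x powr (\<kappa> + 1) * (2 ^ J) powr (\<kappa>\<^sup>2)) = u / v * e2"
      by (simp add: lower_const_def u_def v_def e2_def c_def)
    also have "\<dots> = u * (e1 * e2) / (v * e1)" using pos by simp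
    also have "\<dots> \<le> u * exp (c * L * (\<kappa> + 1)) / (v * e1)"
      using d pos unfolding e1_def[symmetric] e2_def[symmetric] by (intro divide_right_mono mult_left_mono) auto
    also have "\<dots> = A' powr (\<kappa> + 1) / B' powr \<kappa>" unfolding a b by (simp add: u_def v_def e1_def mult.assoc)
    finally show ?thesis .
  qed
  then show ?thesis using main by linarith
qed

text \<open>The first \<open>J\<close> whose successor violates the bound, so that
  \<open>2 ^ J\<close> is at least a constant multiple of \<open>ln y\<close>.\<close>

lemma ex_scale:
  fixes y :: real
  assumes E: "E \<ge> 1" and y: "2 ^ E \<le> y"
  obtains J where "2 ^ (E * 2 ^ J) \<le> y" "ln y / (2 * real E) \<le> 2 ^ J"
proof -
  define P where "P J \<longleftrightarrow> y < 2 ^ (E * 2 ^ Suc J)" for J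
  have "\<exists>J. P J"
  proof -
    obtain n where n: "y < 2 ^ n" using real_arch_pow[of 2 y] by auto
    have "n \<le> 2 ^ Suc n" using less_exp[of "Suc n"] by linarith
    also have "\<dots> \<le> E * 2 ^ Suc n" using E by simp
    finally have "(2::real) ^ n \<le> 2 ^ (E * 2 ^ Suc n)" by (intro power_increasing) auto
    then have "P n" unfolding P_def using n by linarith
    then show ?thesis ..
  qed
  define J where "J = (LEAST J. P J)"
  have PJ: "P J" unfolding J_def using \<open>\<exists>J. P J\<close> by (rule LeastI_ex)
  have low: "2 ^ (E * 2 ^ J) \<le> y"
  proof (cases J)
    case 0
    then show ?thesis using y by simp
  next
    case (Suc i)
    then have "\<not> P i" using not_less_Least[of i P] by (simp add: J_def)
    then show ?thesis by (simp add: P_def Suc not_less)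
  qed
  have "y > 0" using y by (rule less_le_trans[rotated]) simp
  then have "ln y \<le> ln (2 ^ (E * 2 ^ Suc J))" using PJ by (subst ln_le_cancel_iff) (auto simp: P_def)
  also have "\<dots> = real (E * 2 ^ Suc J) * ln 2" by (rule ln_realpow)
  also have "\<dots> \<le> real (E * 2 ^ Suc J) * 1" using ln_le_minus_one[of 2] by (intro mult_left_mono) auto
  finally have "ln y / (2 * real E) \<le> 2 ^ J" using E by (simp add: field_simps)
  then show ?thesis using that low by blast
qed

text \<open>With \<open>y\<close> free up to \<open>min x (q / x)\<close>, both ranges of
  \<open>x\<close> become instances. Below the threshold \<open>y1\<close> the logarithm is bounded,
  and the bound by a pure power of \<open>x\<close> suffices.\<close>

lemma nonprincipal_moment_lower_bound:
  fixes k :: real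
  assumes k: "k \<ge> 2"
  shows "\<exists>c>0. \<forall>q x y. prime q \<longrightarrow> q > 2 \<longrightarrow> 1 \<le> x \<longrightarrow> x \<le> real q / 2 \<longrightarrow> 1 \<le> y \<longrightarrow> y \<le> x \<longrightarrow> y \<le> real q / x \<longrightarrow>
           nonprincipal_moment q k x \<ge> c * (x powr k * ln y powr ((k - 1)\<^sup>2))"
proof -
  define \<kappa> where "\<kappa> = k - 1"
  have \<kappa>: "\<kappa> \<ge> 1" "k = \<kappa> + 1" using k by (simp_all add: \<kappa>_def)
  define M where "M = nat \<lceil>172800 * \<kappa>\<^sup>2\<rceil> + 1"
  have M: "M \<ge> 1" "real M \<ge> 172800 * \<kappa>\<^sup>2" unfolding M_def by (simp, linarith)
  obtain A where A: "3 * \<kappa> \<le> 2 ^ A" using real_arch_pow[of 2 "3 * \<kappa>"] less_imp_le by auto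
  define E where "E = 4 * (4 * M * (A + 1)) + 8"
  have E1: "E \<ge> 1" by (simp add: E_def)
  define s where "s = 1280 * real M * exp ((\<kappa>\<^sup>2 + 2 * \<kappa>)\<^sup>2)"
  define y1 where "y1 = max (s\<^sup>2) (2 ^ E)"
  have s0: "s \<ge> 0" by (simp add: s_def)
  have "(2::real) ^ 1 \<le> 2 ^ E" using E1 by (intro power_increasing) auto
  then have y12: "y1 \<ge> 2" by (simp add: y1_def)
  define G where "G = ln y1 powr (\<kappa>\<^sup>2)"
  have G: "G > 0" using y12 by (simp add: G_def)
  define c1 where "c1 = lower_const \<kappa> M * (1 / (2 * real E)) powr (\<kappa>\<^sup>2)"
  define c2 where "c2 = (1 / 4) powr k / G"
  have c1: "c1 > 0" using lower_const_pos[OF M(1), of \<kappa>] E1 by (simp add: c1_def)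
  have c2: "c2 > 0" using G by (simp add: c2_def)
  define c where "c = min c1 c2"
  have c: "c > 0" "c \<le> c1" "c \<le> c2" using c1 c2 by (auto simp: c_def)
  show ?thesis
  proof (intro exI[of _ c] conjI c(1) allI impI)
    fix q :: nat and x y :: real
    assume q: "prime q" "q > 2" and x: "1 \<le> x" "x \<le> real q / 2" and y: "1 \<le> y" "y \<le> x" "y \<le> real q / x"
    have ln0: "ln y \<ge> 0" using y by simp
    have nn: "x powr k * ln y powr (\<kappa>\<^sup>2) \<ge> 0" by simp
    show "nonprincipal_moment q k x \<ge> c * (x powr k * ln y powr ((k - 1)\<^sup>2))"
    proof (cases "y1 \<le> y")
      case True
      then have "2 ^ E \<le> y" by (simp add: y1_def)
      then obtain J where J: "2 ^ (E * 2 ^ J) \<le> y" "ln y / (2 * real E) \<le> 2 ^ J"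
        using ex_scale[OF E1] by blast
      have "s \<le> sqrt y" using True by (intro real_le_rsqrt) (simp add: y1_def)
      then have "lower_const \<kappa> M * (x powr (\<kappa> + 1) * (2 ^ J) powr (\<kappa>\<^sup>2)) \<le> nonprincipal_moment q (\<kappa> + 1) x"
        using J(1) unfolding s_def E_def by (intro nonprincipal_moment_ge_blocks[OF \<kappa>(1) M A q x y(2,3)])
      moreover have "c1 * (x powr k * ln y powr (\<kappa>\<^sup>2)) \<le> lower_const \<kappa> M * (x powr (\<kappa> + 1) * (2 ^ J) powr (\<kappa>\<^sup>2))"
      proof -
        have "(1 / (2 * real E) * ln y) powr (\<kappa>\<^sup>2) \<le> (2 ^ J) powr (\<kappa>\<^sup>2)"
          using J(2) ln0 by (intro powr_mono2) auto
        then have "(1 / (2 * real E)) powr (\<kappa>\<^sup>2) * ln y powr (\<kappa>\<^sup>2) \<le> (2 ^ J) powr (\<kappa>\<^sup>2)"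
          using ln0 by (simp only: powr_mult)
        then have "lower_const \<kappa> M * x powr (\<kappa> + 1) * ((1 / (2 * real E)) powr (\<kappa>\<^sup>2) * ln y powr (\<kappa>\<^sup>2)) \<le>
            lower_const \<kappa> M * x powr (\<kappa> + 1) * (2 ^ J) powr (\<kappa>\<^sup>2)"
          using lower_const_pos[OF M(1), of \<kappa>] by (intro mult_left_mono) auto
        then show ?thesis by (simp only: c1_def \<kappa>(2) mult_ac)
      qed
      moreover have "c * (x powr k * ln y powr (\<kappa>\<^sup>2)) \<le> c1 * (x powr k * ln y powr (\<kappa>\<^sup>2))"
        using c nn by (intro mult_right_mono) auto
      ultimately show ?thesis by (simp add: \<kappa>_def)
    next
      case False
      have "ln y powr (\<kappa>\<^sup>2) \<le> G"
        unfolding G_def using False y ln0 by (intro powr_mono2) auto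
      then have "x powr k * ln y powr (\<kappa>\<^sup>2) \<le> x powr k * G" by (intro mult_left_mono) auto
      then have "c2 * (x powr k * ln y powr (\<kappa>\<^sup>2)) \<le> c2 * (x powr k * G)"
        by (rule mult_left_mono[OF _ less_imp_le[OF c2]])
      also have "\<dots> = (x / 4) powr k" using G x by (simp add: c2_def powr_divide)
      also have "\<dots> \<le> nonprincipal_moment q k x" using k by (intro nonprincipal_moment_ge_power q x) auto
      finally have "c2 * (x powr k * ln y powr (\<kappa>\<^sup>2)) \<le> nonprincipal_moment q k x" .
      moreover have "c * (x powr k * ln y powr (\<kappa>\<^sup>2)) \<le> c2 * (x powr k * ln y powr (\<kappa>\<^sup>2))"
        using c nn by (intro mult_right_mono) auto
      ultimately show ?thesis by (simp add: \<kappa>_def)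
    qed
  qed
qed

theorem theorem1p1:
  fixes k :: real
  assumes "k \<ge> 2"
  shows "\<exists>c>0. \<forall>\<^sub>F q :: nat in sequentially. prime q \<longrightarrow>
           (\<forall>x::real. 1 \<le> x \<and> x \<le> real q powr (1/2) \<longrightarrow>
              nonprincipal_moment q k x \<ge> c * (x powr k * ln x powr ((k - 1)\<^sup>2))) \<and>
           (\<forall>x::real. real q powr (1/2) \<le> x \<and> x \<le> real q / 2 \<longrightarrow>
              nonprincipal_moment q k x \<ge> c * (x powr k * ln (real q / x) powr ((k - 1)\<^sup>2)))"
proof -
  obtain c where c: "c > 0" and bound: "\<And>q x y. prime q \<Longrightarrow> q > 2 \<Longrightarrow> 1 \<le> x \<Longrightarrow> x \<le> real q / 2 \<Longrightarrow> 1 \<le> y \<Longrightarrow>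
      y \<le> x \<Longrightarrow> y \<le> real q / x \<Longrightarrow> nonprincipal_moment q k x \<ge> c * (x powr k * ln y powr ((k - 1)\<^sup>2))"
    using nonprincipal_moment_lower_bound[OF assms] by blast
  show ?thesis
  \<comment> \<open>\<open>q \<ge> 4\<close> yields \<open>sqrt q \<le> q / 2\<close>. The free
    parameter is taken as \<open>x\<close> in the first range and as \<open>q / x\<close> in the
    second.\<close>
  proof (intro exI[of _ c] conjI c eventually_mono[OF eventually_ge_at_top[of 4]] impI allI)
    fix q :: nat and x :: real
    assume q4: "4 \<le> q" and q: "prime q" and x: "1 \<le> x \<and> x \<le> real q powr (1/2)"
    have xs: "x \<le> sqrt (real q)" using x by (simp add: powr_half_sqrt)
    have "x * x \<le> sqrt (real q) * sqrt (real q)" using x xs by (intro mult_mono) auto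
    then have xx: "x * x \<le> real q" by simp
    have "sqrt (real q) * 2 \<le> sqrt (real q) * sqrt (real q)"
      using q4 by (intro mult_left_mono real_le_rsqrt) auto
    then have "x \<le> real q / 2" using xs by simp
    moreover have "x \<le> real q / x" using xx x by (simp add: pos_le_divide_eq)
    ultimately show "nonprincipal_moment q k x \<ge> c * (x powr k * ln x powr ((k - 1)\<^sup>2))"
      using q q4 x by (intro bound) auto
  next
    fix q :: nat and x :: real
    assume q4: "4 \<le> q" and q: "prime q" and x: "real q powr (1/2) \<le> x \<and> x \<le> real q / 2"
    have xs: "sqrt (real q) \<le> x" using x by (simp add: powr_half_sqrt)
    have "1 \<le> sqrt (real q)" using q4 by simp
    then have x1: "1 \<le> x" using xs by linarith
    have "sqrt (real q) * sqrt (real q) \<le> x * x" using xs x1 by (intro mult_mono) auto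
    then have "real q / x \<le> x" using x1 by (simp add: pos_divide_le_eq)
    moreover have "1 \<le> real q / x" using x x1 by (simp add: pos_le_divide_eq)
    ultimately show "nonprincipal_moment q k x \<ge> c * (x powr k * ln (real q / x) powr ((k - 1)\<^sup>2))"
      using q q4 x x1 by (intro bound) auto
  qed
qed

end
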